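(* Let $0<\nu<\frac12$ and $\lambda>0$. The law $\mathfrak{l}_\nu(x,t)$ of the process $\mathcal{L}^\nu(t)$, $t>0$, solves the time-fractional boundary-initial problem $$ \begin{cases} \left(\dfrac{\partial^{2\nu}}{\partial t^{2\nu}}+2\lambda\dfrac{\partial^{\nu}}{\partial t^{\nu}}\right)\mathfrak{l}_\nu(x,t)=-\dfrac{\partial}{\partial x}\mathfrak{l}_\nu(x,t), & x>0,\ t>0,\\[2mm] \mathfrak{l}_\nu(x,0)=\delta(x),\\[1mm] \mathfrak{l}_\nu(0,t)=\dfrac{t^{-2\nu}}{\Gamma(1-2\nu)}+2\lambda\dfrac{t^{-\nu}}{\Gamma(1-\nu)}, \end{cases} $$ where the fractional derivatives are in the Riemann-Liouville sense, and it has $x$-Laplace transform $\widetilde{\mathfrak{l}_\nu}(\gamma,t)=\int_0^\infty e^{-\gamma x}\mathfrak{l}_\nu(x,t)\,dx$ which reads, for $0<\gamma<\lambda^2$, $$ \widetilde{\mathfrak{l}_\nu}(\gamma,t)=\frac12\left[\left(1+\frac{\lambda}{\sqrt{\lambda^2-\gamma}}\right)E_{\nu,1}(r_1t^\nu)+\left(1-\frac{\lambda}{\sqrt{\lambda^2-\gamma}}\right)E_{\nu,1}(r_2t^\nu)\right], $$ where $r_1=-\lambda+\sqrt{\lambda^2-\gamma}$ and $r_2=-\lambda-\sqrt{\lambda^2-\gamma}$.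
   Context: For $0<\alpha<1$, $H^\alpha(t)$, $t>0$, denotes the totally positively skewed stable process (stable subordinator) with Laplace transform $\mathbb{E}e^{-\mu H^\alpha(t)}=e^{-t\mu^\alpha}$, $\mu>0$. Let $H_1^{2\nu}$ and $H_2^\nu$ be independent stable subordinators of orders $2\nu$ and $\nu$, and set $\mathcal{H}^\nu(t)=H_1^{2\nu}(t)+(2\lambda)^{1/\nu}H_2^\nu(t)$, $t>0$. Its inverse process is $$\mathcal{L}^\nu(t)=\inf\{s>0:\ \mathcal{H}^\nu(s)\ge t\},\qquad t>0,$$ so that $\Pr\{\mathcal{L}^\nu(t)<x\}=\Pr\{\mathcal{H}^\nu(x)>t\}$ for $x,t>0$. "Law" means probability density: $\Pr\{\mathcal{L}^\nu(t)\in dx\}=\mathfrak{l}_\nu(x,t)\,dx$, $x\ge0$. $\delta$ is the Dirac delta. The Riemann-Liouville fractional derivative of order $\alpha$, $m-1<\alpha<m$, $m\in\mathbb{N}$, is $$\frac{\partial^\alpha}{\partial t^\alpha}f(t)=\frac{1}{\Gamma(m-\alpha)}\frac{d^m}{dt^m}\int_0^t\frac{f(s)}{(t-s)^{\alpha+1-m}}\,ds .$$ The two-parameter Mittag-Leffler function is $E_{\nu,\psi}(x)=\sum_{k=0}^\infty\frac{x^k}{\Gamma(\nu k+\psi)}$, $\nu,\psi>0$. *)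

theory Defs
  imports "HOL-Probability.Probability"
begin

locale stable_subordinator = prob_space M
  for M :: "'a measure" and \<alpha> :: real and H :: "real \<Rightarrow> 'a \<Rightarrow> real" +
  assumes order: "0 < \<alpha>" "\<alpha> < 1"
    and measurable: "\<And>t. t \<ge> 0 \<Longrightarrow> random_variable borel (H t)"
    and start: "\<And>\<omega>. \<omega> \<in> space M \<Longrightarrow> H 0 \<omega> = 0"
    and nondecreasing: "\<And>\<omega>. \<omega> \<in> space M \<Longrightarrow> mono_on {0..} (\<lambda>t. H t \<omega>)"
    and right_continuous:
      "\<And>\<omega> t. \<omega> \<in> space M \<Longrightarrow> t \<ge> 0 \<Longrightarrow> continuous (at_right t) (\<lambda>s. H s \<omega>)"
    and independent_increments:
      "\<And>t :: nat \<Rightarrow> real. incseq t \<Longrightarrow> t 0 \<ge> 0 \<Longrightarrow>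
         indep_vars (\<lambda>_. borel) (\<lambda>i \<omega>. H (t (Suc i)) \<omega> - H (t i) \<omega>) UNIV"
    and stationary_increments:
      "\<And>s t. s \<ge> 0 \<Longrightarrow> t \<ge> 0 \<Longrightarrow>
         distr M borel (\<lambda>\<omega>. H (s + t) \<omega> - H s \<omega>) = distr M borel (H t)"
    and laplace:
      "\<And>t \<mu>. t > 0 \<Longrightarrow> \<mu> > 0 \<Longrightarrow>
         expectation (\<lambda>\<omega>. exp (- \<mu> * H t \<omega>)) = exp (- t * \<mu> powr \<alpha>)"

text \<open>Independence of the whole processes, i.e. of the random elements they induce in the
  product space of real functions on the half-line, not merely of their one-dimensional
  marginals.\<close>

definition independent_processes ::
  "'a measure \<Rightarrow> (real \<Rightarrow> 'a \<Rightarrow> real) \<Rightarrow> (real \<Rightarrow> 'a \<Rightarrow> real) \<Rightarrow> bool" where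
  "independent_processes M X Y \<longleftrightarrow>
     prob_space.indep_var M
       (PiM {0..} (\<lambda>_. borel)) (\<lambda>\<omega>. \<lambda>t\<in>{0..}. X t \<omega>)
       (PiM {0..} (\<lambda>_. borel)) (\<lambda>\<omega>. \<lambda>t\<in>{0..}. Y t \<omega>)"

definition inverse_process :: "(real \<Rightarrow> 'a \<Rightarrow> real) \<Rightarrow> real \<Rightarrow> 'a \<Rightarrow> real" where
  "inverse_process H t \<omega> = Inf {s. s > 0 \<and> H s \<omega> \<ge> t}"

text \<open>A density is determined only almost everywhere, while the law is to be evaluated
  pointwise, also at the boundary point 0.  The law is therefore the density
  that is continuous on the closed half-line; this fixes \<open>l x t\<close> for all
  \<open>x \<ge> 0\<close> and \<open>t > 0\<close>.  Values of \<open>l\<close> elsewhere are irrelevant.\<close>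

definition has_law ::
  "'a measure \<Rightarrow> (real \<Rightarrow> 'a \<Rightarrow> real) \<Rightarrow> (real \<Rightarrow> real \<Rightarrow> real) \<Rightarrow> bool" where
  "has_law M L l \<longleftrightarrow> (\<forall>t>0.
     (\<forall>x\<ge>0. l x t \<ge> 0) \<and>
     continuous_on {0..} (\<lambda>x. l x t) \<and>
     distributed M lborel (L t) (\<lambda>x. ennreal (l x t * indicator {0..} x)))"

text \<open>Riemann--Liouville derivative of non-integer order \<open>\<alpha> > 0\<close>.  The integer \<open>m\<close> with
  \<open>m - 1 < \<alpha> < m\<close> is the ceiling of \<open>\<alpha>\<close>.  Since \<^const>\<open>deriv\<close> and the Lebesgue integral
  are total, \<open>rl_differentiable\<close> says separately that the integral and all the
  derivatives involved exist.\<close>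

definition rl_order :: "real \<Rightarrow> nat" where
  "rl_order \<alpha> = nat \<lceil>\<alpha>\<rceil>"

definition rl_kernel :: "real \<Rightarrow> (real \<Rightarrow> real) \<Rightarrow> real \<Rightarrow> real \<Rightarrow> real" where
  "rl_kernel \<alpha> f t s = f s / (t - s) powr (\<alpha> + 1 - real (rl_order \<alpha>))"

definition rl_integral :: "real \<Rightarrow> (real \<Rightarrow> real) \<Rightarrow> real \<Rightarrow> real" where
  "rl_integral \<alpha> f t = (LBINT s:{0<..<t}. rl_kernel \<alpha> f t s)"

definition rl_deriv :: "real \<Rightarrow> (real \<Rightarrow> real) \<Rightarrow> real \<Rightarrow> real" where
  "rl_deriv \<alpha> f t =
     1 / Gamma (real (rl_order \<alpha>) - \<alpha>) * (deriv ^^ rl_order \<alpha>) (rl_integral \<alpha> f) t"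

definition rl_differentiable :: "real \<Rightarrow> (real \<Rightarrow> real) \<Rightarrow> real \<Rightarrow> bool" where
  "rl_differentiable \<alpha> f t \<longleftrightarrow> (\<forall>\<^sub>F u in nhds t.
     set_integrable lborel {0<..<u} (rl_kernel \<alpha> f u) \<and>
     (\<forall>j<rl_order \<alpha>. (deriv ^^ j) (rl_integral \<alpha> f) differentiable (at u)))"

definition mittag_leffler :: "real \<Rightarrow> real \<Rightarrow> real \<Rightarrow> real" where
  "mittag_leffler \<nu> \<psi> x = (\<Sum>k. x ^ k / Gamma (\<nu> * real k + \<psi>))"

text \<open>The condition \<open>l(x,0) = \<delta>(x)\<close>: as \<open>t \<rightarrow> 0+\<close>, the measures \<open>l(x,t) dx\<close> on the
  half-line converge weakly to the unit mass at 0.\<close>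

definition initially_delta :: "(real \<Rightarrow> real \<Rightarrow> real) \<Rightarrow> bool" where
  "initially_delta l \<longleftrightarrow>
     (\<forall>\<phi> :: real \<Rightarrow> real. continuous_on {0..} \<phi> \<longrightarrow> bounded (\<phi> ` {0..}) \<longrightarrow>
        ((\<lambda>t. LBINT x:{0..}. \<phi> x * l x t) \<longlongrightarrow> \<phi> 0) (at_right 0))"

end

theory Submission
  imports Defs "HOL-Complex_Analysis.Complex_Analysis"
begin

text \<open>With \<open>\<phi>(\<mu>) = \<mu>^{2\<nu>} + 2\<lambda>\<mu>^\<nu>\<close> the law of the inverse process must have the \<open>t\<close>-Laplace transform
  \<open>\<phi>(\<mu>) exp (- x \<phi>(\<mu>)) / \<mu>\<close>.  Since \<open>2\<nu> < 1\<close>, the Bromwich contour can be bent onto the rays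
  \<open>arg z = \<plusminus>\<theta>\<close> for some \<open>\<theta>\<close> slightly larger than \<open>\<pi>/2\<close>, on which both \<open>exp (t z)\<close> and
  \<open>exp (- x \<phi>(z))\<close> decay; in the variable \<open>w = log z\<close> everything is holomorphic in a horizontal
  strip and there is no branch cut.  The resulting integral defines an explicit candidate density, continuous up to \<open>x = 0\<close>.
  A residue computation gives its Laplace transform, and uniqueness of Laplace transforms identifies it
  with the law, identifies its Abel integrals in \<open>t\<close> (so that applying the Riemann--Liouville derivative of
  order \<open>\<alpha>\<close> inserts a factor \<open>z^\<alpha>\<close> under the integral), its boundary values, and its \<open>x\<close>-Laplace
  transform (a partial fraction decomposition of \<open>\<phi> / (\<gamma> + \<phi>)\<close> in the variable \<open>\<mu>^\<nu>\<close>).\<close>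

section \<open>Parameter integrals and uniqueness of Laplace transforms\<close>

text \<open>Because \<nu> < 1/2 there is an angle \<omega> > pi/2 with 2\<nu>\<omega> \<le> pi/2;
  this is what lets \<open>exp (t z)\<close> decay on the rays while z^(2\<nu>) keeps a nonnegative
  real part. Nonnegativity of the candidate density cannot be seen from an oscillating integral. The
  link with the process is therefore made through distribution functions: for fixed x the map t ->
  P(H(x) < t) is monotone with a known Laplace transform, hence equals an explicit continuous
  function at every t > 0, and the density inherits its sign from the monotonicity in x of these
  probabilities. No derivative is taken under a singular kernel: each Abel integral is identified
  with a constant multiple of an ordinary primitive, to which the fundamental theorem applies. This
  requires integrands bounded down to t = 0, hence x > 0. The x-Laplace transform comes from an
  explicit primitive in x, with no interchange of integrals. Transforms are compared at large
  integers, since the series for the Mittag-Leffler transform converges for large arguments.\<close>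

lemma integrable_dominated:
  fixes f :: "'a \<Rightarrow> 'c::{banach,second_countable_topology}" and w :: "'a \<Rightarrow> real"
  assumes "integrable M w" "f \<in> borel_measurable M" "\<And>u. norm (f u) \<le> w u"
  shows "integrable M f"
  by (rule Bochner_Integration.integrable_bound[OF assms(1,2)])
     (auto intro!: AE_I2 order_trans[OF assms(3)])

text \<open>The filter \<open>at x within S\<close> is determined by sequences in S that avoid x, so
  sequential dominated convergence carries over.\<close>

lemma tendsto_lebesgue_at_within:
  fixes f :: "real \<Rightarrow> 'a \<Rightarrow> 'c::{banach,second_countable_topology}"
  assumes "\<And>y. y \<in> S \<Longrightarrow> f y \<in> borel_measurable M" "l \<in> borel_measurable M" "integrable M w"
    and "AE u in M. ((\<lambda>y. f y u) \<longlongrightarrow> l u) (at x within S)"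
    and "\<And>y u. y \<in> S \<Longrightarrow> y \<noteq> x \<Longrightarrow> norm (f y u) \<le> w u"
  shows "((\<lambda>y. \<integral>u. f y u \<partial>M) \<longlongrightarrow> (\<integral>u. l u \<partial>M)) (at x within S)"
  unfolding tendsto_at_iff_sequentially comp_def
proof (intro allI impI)
  fix X assume X: "\<forall>i. X i \<in> S - {x}" "X \<longlonglongrightarrow> x"
  show "(\<lambda>n. \<integral>u. f (X n) u \<partial>M) \<longlonglongrightarrow> (\<integral>u. l u \<partial>M)"
  proof (rule integral_dominated_convergence[where w = w])
    show "AE u in M. (\<lambda>i. f (X i) u) \<longlonglongrightarrow> l u"
      using assms(4) by eventually_elim (use X in \<open>auto simp: tendsto_at_iff_sequentially comp_def\<close>)
  qed (use X assms in auto)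
qed

text \<open>Dominated convergence for the difference quotients, with \<open>lip\<close> supplying
  the majorant. Working within S lets the end point 0 of the half-line count as a point of
  (one-sided) differentiability.\<close>

lemma has_real_derivative_lebesgue:
  fixes f :: "real \<Rightarrow> 'a \<Rightarrow> real"
  assumes int: "\<And>y. y \<in> S \<Longrightarrow> integrable M (f y)" and x: "x \<in> S"
    and f': "f' \<in> borel_measurable M" and w: "integrable M w"
    and der: "\<And>u. ((\<lambda>y. f y u) has_real_derivative f' u) (at x within S)"
    and lip: "\<And>y u. y \<in> S \<Longrightarrow> \<bar>f y u - f x u\<bar> \<le> \<bar>y - x\<bar> * w u"
  shows "((\<lambda>y. \<integral>u. f y u \<partial>M) has_real_derivative (\<integral>u. f' u \<partial>M)) (at x within S)"
proof -
  have "((\<lambda>y. \<integral>u. (f y u - f x u) / (y - x) \<partial>M) \<longlongrightarrow> (\<integral>u. f' u \<partial>M)) (at x within S)"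
  proof (rule tendsto_lebesgue_at_within[OF _ f' w])
    show "(\<lambda>u. (f y u - f x u) / (y - x)) \<in> borel_measurable M" if "y \<in> S" for y
      using int[OF that] int[OF x] by measurable
    show "AE u in M. ((\<lambda>y. (f y u - f x u) / (y - x)) \<longlongrightarrow> f' u) (at x within S)"
      using der by (auto simp: has_field_derivative_iff)
    show "norm ((f y u - f x u) / (y - x)) \<le> w u" if "y \<in> S" "y \<noteq> x" for y u
      using lip[OF that(1), of u] that by (simp add: field_simps)
  qed
  moreover have "\<forall>\<^sub>F y in at x within S. (\<integral>u. (f y u - f x u) / (y - x) \<partial>M)
      = ((\<integral>u. f y u \<partial>M) - (\<integral>u. f x u \<partial>M)) / (y - x)"
    unfolding eventually_at_filter
    by (rule always_eventually) (use int x in auto)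
  ultimately show ?thesis
    unfolding has_field_derivative_iff by (rule Lim_transform_eventually)
qed

section \<open>Exponential and Gamma integrals\<close>

lemma integrable_exp_neg_abs:
  fixes k :: real
  assumes "k > 0"
  shows "integrable lborel (\<lambda>u. exp (- k * \<bar>u\<bar>))"
proof -
  have 1: "integrable lborel (\<lambda>x. indicator {0<..} x * exp (- (x * k)))"
    using integrable_I0i_exp_mscale[OF assms] by (simp add: set_integrable_def)
  have 2: "integrable lborel (\<lambda>x. indicator {0<..} (- x) * exp (x * k))"
    using lborel_integrable_real_affine[OF 1, of "-1" 0] by simp
  \<comment> \<open>Both half-line pieces vanish at 0, where the target is 1, so that point is taken
    out here and put back afterwards.\<close>
  have "integrable lborel (\<lambda>u. exp (- k * \<bar>u\<bar>) - indicator {0} u)"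
    by (rule Bochner_Integration.integrable_bound[OF Bochner_Integration.integrable_add[OF 1 2]])
       (auto simp: indicator_def abs_if mult.commute intro!: AE_I2)
  moreover have "integrable lborel (\<lambda>u::real. indicator {0} u :: real)"
    by (simp add: integrable_indicator_iff)
  ultimately have "integrable lborel (\<lambda>u. (exp (- k * \<bar>u\<bar>) - indicator {0} u) + indicator {0} u)"
    by (rule Bochner_Integration.integrable_add)
  then show ?thesis by simp
qed

text \<open>Euler's integral for Gamma, rescaled by \<mu>. Using \<open>has_bochner_integral\<close>
  with the indicator of the open half-line fixes the shape in which Laplace transforms in t are
  stated from here on: existence and value in one fact.\<close>

lemma exp_powr_integral:
  fixes a \<mu> :: real
  assumes "a > -1" "\<mu> > 0"
  shows "has_bochner_integral lborel (\<lambda>t. indicator {0<..} t * (exp (- \<mu> * t) * t powr a))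
           (Gamma (a + 1) / \<mu> powr (a + 1))"
proof -
  define g where "g = (\<lambda>t. indicator {0..} t * t powr a / exp t :: real)"
  have nn: "(\<integral>\<^sup>+ t. ennreal (g t) \<partial>lborel) = ennreal (Gamma (a + 1))"
    using Gamma_conv_nn_integral_real[of "a + 1"] assms by (simp add: g_def)
  have "has_bochner_integral lborel g (Gamma (a + 1))"
    by (rule has_bochner_integral_nn_integral[OF _ _ _ nn])
       (use assms in \<open>auto simp: g_def Gamma_real_nonneg intro!: AE_I2\<close>)
  then have "has_bochner_integral lborel (\<lambda>t. g (0 + \<mu> * t)) (Gamma (a + 1) /\<^sub>R \<bar>\<mu>\<bar>)"
    using lborel_has_bochner_integral_real_affine_iff[of \<mu> g "Gamma (a + 1)" 0] assms by auto
  then have "has_bochner_integral lborel (\<lambda>t. (1 / \<mu> powr a) * g (\<mu> * t))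
               ((1 / \<mu> powr a) * (Gamma (a + 1) /\<^sub>R \<mu>))"
    using assms by (intro has_bochner_integral_mult_right) auto
  also have "(1 / \<mu> powr a) * (Gamma (a + 1) /\<^sub>R \<mu>) = Gamma (a + 1) / \<mu> powr (a + 1)"
    using assms by (simp add: powr_add field_simps)
  finally have *: "has_bochner_integral lborel (\<lambda>t. (1 / \<mu> powr a) * g (\<mu> * t))
      (Gamma (a + 1) / \<mu> powr (a + 1))" .
  have "(1 / \<mu> powr a) * g (\<mu> * t) = indicator {0<..} t * (exp (- \<mu> * t) * t powr a)" for t
    using assms by (cases "t = 0")
      (auto simp: g_def indicator_def powr_mult exp_minus field_simps zero_le_mult_iff)
  with * show ?thesis by simp
qed

lemma exp_integral:
  fixes \<mu> :: real
  assumes "\<mu> > 0"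
  shows "has_bochner_integral lborel (\<lambda>t. indicator {0<..} t * exp (- \<mu> * t)) (1 / \<mu>)"
proof -
  have "(\<lambda>t. indicator {0<..} t * (exp (- \<mu> * t) * t powr 0)) = (\<lambda>t::real. indicator {0<..} t * exp (- \<mu> * t))"
    by (auto simp: indicator_def fun_eq_iff)
  with exp_powr_integral[of 0 \<mu>] assms show ?thesis
    by simp
qed

text \<open>The functions \<open>exp (- n t)\<close> are the powers of \<open>exp (- t)\<close>, so by Weierstrass \<open>d\<close> is
  orthogonal to every continuous function of \<open>exp (- t)\<close>, in particular to a bump supported where
  \<open>d\<close> is positive.\<close>

lemma laplace_zero_not_positive:
  fixes d :: "real \<Rightarrow> real" and N :: nat
  assumes int: "\<And>n. n \<ge> N \<Longrightarrow> integrable lborel (\<lambda>t. indicator {0<..} t * (exp (- real n * t) * d t))"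
    and zero: "\<And>n. n \<ge> N \<Longrightarrow> (\<integral>t. indicator {0<..} t * (exp (- real n * t) * d t) \<partial>lborel) = 0"
    and ab: "0 \<le> a" "a < b" and pos: "\<And>t. a < t \<Longrightarrow> t < b \<Longrightarrow> d t > 0"
  shows False
proof -
  define h where "h = (\<lambda>t. indicator {0<..} t * (exp (- real N * t) * d t))"
  have h: "integrable lborel h" using int[of N] by (simp add: h_def)
  have shift: "exp (- t) ^ n * h t = indicator {0<..} t * (exp (- real (N + n) * t) * d t)" for t n
    by (simp add: h_def exp_of_nat_mult[symmetric] exp_add[symmetric] algebra_simps)
  have poly: "integrable lborel (\<lambda>t. p (exp (- t)) * h t) \<and> (\<integral>t. p (exp (- t)) * h t \<partial>lborel) = 0"
    if p: "real_polynomial_function p" for p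
  proof -
    obtain a n where p': "p = (\<lambda>x. \<Sum>i\<le>n. a i * x ^ i)"
      using p unfolding real_polynomial_function_iff_sum by blast
    define K where "K = (\<lambda>i t. exp (- t) ^ i * h t)"
    have "integrable lborel (K i)" "integral\<^sup>L lborel (K i) = 0" for i
      using int[of "N + i"] zero[of "N + i"] by (simp_all add: K_def shift)
    moreover have "p (exp (- t)) * h t = (\<Sum>i\<le>n. a i * K i t)" for t
      by (simp add: p' K_def sum_distrib_right mult.assoc)
    ultimately show ?thesis
      by auto
  qed
  \<comment> \<open>In the variable \<open>exp (- t)\<close> the interval a < t < b reads exp (- b)
    < x < exp (- a); the parabola truncated at 0 is positive exactly there.\<close>
  define q where "q = (\<lambda>x::real. max 0 ((x - exp (- b)) * (exp (- a) - x)))"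
  have qcont: "continuous_on UNIV q"
    unfolding q_def by (intro continuous_intros)
  have qpos: "q (exp (- t)) > 0" if "a < t" "t < b" for t
    using that by (simp add: q_def)
  have qzero: "q (exp (- t)) = 0" if "\<not> (a < t \<and> t < b)" for t
    using that ab by (auto simp: q_def max_def mult_le_0_iff zero_le_mult_iff not_less)
  have qbound: "\<bar>q (exp (- t))\<bar> \<le> 1" if "t > 0" for t
  proof (cases "a < t \<and> t < b")
    case True
    have "(exp (- t) - exp (- b)) * (exp (- a) - exp (- t)) \<le> 1 * 1"
    proof (rule mult_mono)
      have "exp (- t) \<le> 1" "exp (- a) \<le> 1" using that ab by auto
      moreover have "exp (- b) > 0" "exp (- t) > 0" by auto
      ultimately show "exp (- t) - exp (- b) \<le> 1" "exp (- a) - exp (- t) \<le> 1" by linarith+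
    qed (use True in auto)
    then show ?thesis by (auto simp: q_def)
  qed (simp add: qzero)
  have [measurable]: "q \<in> borel_measurable borel"
    using qcont by (rule borel_measurable_continuous_onI)
  have [measurable]: "h \<in> borel_measurable lborel" using h by auto
  have supp: "h t = 0" if "t \<le> 0" for t using that by (simp add: h_def)
  have qint: "integrable lborel (\<lambda>t. q (exp (- t)) * h t)"
  proof (rule Bochner_Integration.integrable_bound[OF h])
    show "AE t in lborel. norm (q (exp (- t)) * h t) \<le> norm (h t)"
    proof (rule AE_I2)
      fix t :: real
      show "norm (q (exp (- t)) * h t) \<le> norm (h t)"
        using mult_right_mono[OF qbound, of t "\<bar>h t\<bar>"] supp[of t]
        by (cases "t > 0") (auto simp: abs_mult)
    qed
  qed simp
  have q0: "(\<integral>t. q (exp (- t)) * h t \<partial>lborel) = 0"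
  proof (rule ccontr)
    define I where "I = \<bar>\<integral>t. q (exp (- t)) * h t \<partial>lborel\<bar>"
    define J where "J = (\<integral>t. \<bar>h t\<bar> \<partial>lborel)"
    assume "\<not> ?thesis"
    then have I: "I > 0" by (simp add: I_def)
    have J: "J \<ge> 0" by (simp add: J_def)
    \<comment> \<open>For t > 0 the point \<open>exp (- t)\<close> lies in [0,1], so uniform
      closeness there controls the integral against h. The summand 1 keeps the tolerance positive
      even if J = 0.\<close>
    obtain p where p: "real_polynomial_function p" "\<And>x. x \<in> {0..1} \<Longrightarrow> \<bar>q x - p x\<bar> < I / (J + 1)"
      using Stone_Weierstrass_real_polynomial_function[of "{0..1}" q "I / (J + 1)"] I J
        continuous_on_subset[OF qcont, of "{0..1}"] by auto
    have "I = \<bar>(\<integral>t. q (exp (- t)) * h t \<partial>lborel) - (\<integral>t. p (exp (- t)) * h t \<partial>lborel)\<bar>"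
      using poly[OF p(1)] by (simp add: I_def)
    also have "\<dots> = \<bar>\<integral>t. (q (exp (- t)) - p (exp (- t))) * h t \<partial>lborel\<bar>"
      using poly[OF p(1)] qint by (simp add: left_diff_distrib Bochner_Integration.integral_diff)
    also have "\<dots> \<le> (\<integral>t. \<bar>(q (exp (- t)) - p (exp (- t))) * h t\<bar> \<partial>lborel)"
      by (rule integral_abs_bound)
    also have "\<dots> \<le> (\<integral>t. I / (J + 1) * \<bar>h t\<bar> \<partial>lborel)"
    proof (rule integral_mono)
      show "integrable lborel (\<lambda>t. \<bar>(q (exp (- t)) - p (exp (- t))) * h t\<bar>)"
        using poly[OF p(1)] qint by (auto simp: left_diff_distrib)
      show "integrable lborel (\<lambda>t. I / (J + 1) * \<bar>h t\<bar>)" using h by auto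
      show "\<bar>(q (exp (- t)) - p (exp (- t))) * h t\<bar> \<le> I / (J + 1) * \<bar>h t\<bar>" for t
        using mult_right_mono[OF less_imp_le[OF p(2)[of "exp (- t)"]], of "\<bar>h t\<bar>"] supp[of t]
        by (cases "t > 0") (auto simp: abs_mult)
    qed
    also have "\<dots> = I / (J + 1) * J" by (simp add: J_def)
    also have "\<dots> < I" using I J by (simp add: field_simps)
    finally show False by simp
  qed
  have nonneg: "q (exp (- t)) * h t \<ge> 0" for t
    using pos[of t] qzero[of t] qpos[of t] ab by (cases "a < t \<and> t < b") (auto simp: h_def)
  have "AE t in lborel. q (exp (- t)) * h t = 0"
    using integral_nonneg_eq_0_iff_AE[OF qint] nonneg q0 by auto
  then have "AE t in lborel. t \<notin> {a<..<b}"
  proof eventually_elim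
    fix t assume "q (exp (- t)) * h t = 0"
    then show "t \<notin> {a<..<b}"
      using pos[of t] qpos[of t] ab by (auto simp: h_def)
  qed
  then have "emeasure lborel {a<..<b} = 0"
    by (subst (asm) AE_iff_measurable[of "{a<..<b}"]) auto
  then show False using ab by simp
qed

text \<open>If f and g differed at t, their difference would keep one sign on an interval touching
  t, against \<open>laplace_zero_not_positive\<close>. The interval surrounds t when both are
  continuous; for monotone f it lies on the side of t where f moves further away from g t. The
  monotone case serves distribution functions, whose continuity is a consequence and not an
  assumption.\<close>

lemma laplace_unique_continuous:
  fixes f g :: "real \<Rightarrow> real"
  assumes "\<And>n::nat. n \<ge> N \<Longrightarrow>
      has_bochner_integral lborel (\<lambda>t. indicator {0<..} t * (exp (- real n * t) * f t)) (F n)"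
    and "\<And>n::nat. n \<ge> N \<Longrightarrow>
      has_bochner_integral lborel (\<lambda>t. indicator {0<..} t * (exp (- real n * t) * g t)) (F n)"
    and g: "continuous_on {0<..} g"
    and f: "continuous_on {0<..} f \<or> mono_on {0<..} f"
    and t: "t > 0"
  shows "f t = g t"
proof -
  have fg: "has_bochner_integral lborel (\<lambda>t. indicator {0<..} t * (exp (- real n * t) * (f t - g t))) 0"
    if "n \<ge> N" for n
    using has_bochner_integral_diff[OF assms(1,2)[OF that]] by (simp add: right_diff_distrib)
  have gf: "has_bochner_integral lborel (\<lambda>t. indicator {0<..} t * (exp (- real n * t) * (g t - f t))) 0"
    if "n \<ge> N" for n
    using has_bochner_integral_diff[OF assms(2,1)[OF that]] by (simp add: right_diff_distrib)
  have no: False if "0 \<le> a" "a < b" "(\<forall>t. a < t \<and> t < b \<longrightarrow> f t > g t) \<or> (\<forall>t. a < t \<and> t < b \<longrightarrow> f t < g t)" for a b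
    using that(3)
  proof
    assume "\<forall>t. a < t \<and> t < b \<longrightarrow> f t > g t"
    then show False
      using laplace_zero_not_positive[of N "\<lambda>t. f t - g t" a b] fg that(1,2)
      by (auto simp: has_bochner_integral_iff)
  next
    assume "\<forall>t. a < t \<and> t < b \<longrightarrow> f t < g t"
    then show False
      using laplace_zero_not_positive[of N "\<lambda>t. g t - f t" a b] gf that(1,2)
      by (auto simp: has_bochner_integral_iff)
  qed
  \<comment> \<open>The extra bound \<delta> < t keeps the interval inside the half-line on which
    the transforms test the functions.\<close>
  have near: "\<exists>\<delta>>0. \<delta> < t \<and> (\<forall>s. \<bar>s - t\<bar> < \<delta> \<longrightarrow> P s)" if ev: "\<forall>\<^sub>F s in nhds t. P s" for P
  proof -
    obtain e where "e > 0" "\<And>s. dist s t < e \<Longrightarrow> P s"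
      using ev unfolding eventually_nhds_metric by blast
    then show ?thesis using t
      by (intro exI[of _ "min e (t / 2)"]) (auto simp: dist_real_def)
  qed
  have gt: "(g \<longlongrightarrow> g t) (nhds t)"
    using g t by (metis continuous_on_eq_continuous_at continuous_at greaterThan_iff open_greaterThan
        tendsto_at_iff_tendsto_nhds isContD)
  show ?thesis
    using f
  proof
    assume "continuous_on {0<..} f"
    then have "(f \<longlongrightarrow> f t) (nhds t)"
      using t by (metis continuous_on_eq_continuous_at continuous_at greaterThan_iff open_greaterThan
        tendsto_at_iff_tendsto_nhds isContD)
    then have lim: "((\<lambda>s. f s - g s) \<longlongrightarrow> f t - g t) (nhds t)"
      using gt by (rule tendsto_diff)
    show ?thesis
    proof (rule ccontr)
      assume "f t \<noteq> g t"
      then consider "f t - g t > 0" | "f t - g t < 0" by linarith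
      then show False
      proof cases
        case 1
        obtain \<delta> where "\<delta> > 0" "\<delta> < t" "\<forall>s. \<bar>s - t\<bar> < \<delta> \<longrightarrow> 0 < f s - g s"
          using near[OF order_tendstoD(1)[OF lim 1]] by auto
        then show False using no[of "t - \<delta>" "t + \<delta>"] by (auto simp: abs_less_iff)
      next
        case 2
        obtain \<delta> where "\<delta> > 0" "\<delta> < t" "\<forall>s. \<bar>s - t\<bar> < \<delta> \<longrightarrow> 0 > f s - g s"
          using near[OF order_tendstoD(2)[OF lim 2]] by auto
        then show False using no[of "t - \<delta>" "t + \<delta>"] by (auto simp: abs_less_iff)
      qed
    qed
  next
    assume mono: "mono_on {0<..} f"
    show ?thesis
    proof (rule ccontr)
      assume "f t \<noteq> g t"
      then consider "g t < f t" | "f t < g t" by linarith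
      then show False
      proof cases
        case 1
        obtain \<delta> where \<delta>: "\<delta> > 0" "\<delta> < t" "\<forall>s. \<bar>s - t\<bar> < \<delta> \<longrightarrow> g s < f t"
          using near[OF order_tendstoD(2)[OF gt 1]] by auto
        have "\<forall>s. t < s \<and> s < t + \<delta> \<longrightarrow> g s < f s"
        proof (intro allI impI)
          fix s assume s: "t < s \<and> s < t + \<delta>"
          then have "g s < f t" using \<delta>(3) by (auto simp: abs_less_iff)
          also have "\<dots> \<le> f s" using mono t s by (auto intro: mono_onD)
          finally show "g s < f s" .
        qed
        then show False using no[of t "t + \<delta>"] t \<delta> by auto
      next
        case 2
        obtain \<delta> where \<delta>: "\<delta> > 0" "\<delta> < t" "\<forall>s. \<bar>s - t\<bar> < \<delta> \<longrightarrow> f t < g s"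
          using near[OF order_tendstoD(1)[OF gt 2]] by auto
        have "\<forall>s. t - \<delta> < s \<and> s < t \<longrightarrow> f s < g s"
        proof (intro allI impI)
          fix s assume s: "t - \<delta> < s \<and> s < t"
          then have "f s \<le> f t" using mono t \<delta> by (auto intro: mono_onD)
          also have "\<dots> < g s" using \<delta>(3) s by (auto simp: abs_less_iff)
          finally show "f s < g s" .
        qed
        then show False using no[of "t - \<delta>" t] t \<delta> by auto
      qed
    qed
  qed
qed

section \<open>Hankel integrals along a ray\<close>

text \<open>The three inequalities have separate roles: \<theta> > pi/2 makes cos \<theta> negative,
  so that \<open>exp (t z)\<close> decays along the ray; \<omega> > \<theta> puts the closed contour
  into an open domain of holomorphy; \<omega> < pi keeps exp injective on the strip.\<close>

locale hankel_strip =
  fixes \<theta> \<omega> :: real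
  assumes angles: "pi / 2 < \<theta>" "\<theta> < \<omega>" "\<omega> < pi"
begin

definition strip :: "complex set" where
  "strip = {w. \<bar>Im w\<bar> < \<omega>}"

definition ray :: "real \<Rightarrow> complex" where
  "ray u = Complex u \<theta>"

text \<open>\<open>tame\<close> makes the integral below converge for \<open>t > 0\<close>; \<open>admissible\<close> also controls it as
  \<open>t \<rightarrow> 0\<close>, as its Laplace transform requires.\<close>

definition tame :: "(complex \<Rightarrow> complex) \<Rightarrow> bool" where
  "tame g \<longleftrightarrow> continuous_on strip g \<and>
     (\<exists>C k. k > 0 \<and> (\<forall>u. norm (g (ray u)) \<le> C * exp (- k * \<bar>u\<bar>) * (1 + exp u)\<^sup>2))"

definition admissible :: "(complex \<Rightarrow> complex) \<Rightarrow> bool" where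
  "admissible g \<longleftrightarrow> g holomorphic_on strip \<and> (\<forall>w\<in>strip. g (cnj w) = cnj (g w)) \<and>
     (\<exists>C k. k > 0 \<and> (\<forall>w\<in>strip. norm (g w) \<le> C * exp (- k * \<bar>Re w\<bar>) * (1 + exp (Re w))))"

text \<open>In the variable \<open>z = exp w\<close> this is the Bromwich integral of \<open>g z / z\<close>, with the contour
  bent onto the two rays \<open>arg z = \<plusminus>\<theta>\<close>.\<close>

definition hankel :: "(complex \<Rightarrow> complex) \<Rightarrow> real \<Rightarrow> real" where
  "hankel g t = (\<integral>u. Im (exp (of_real t * exp (ray u)) * g (ray u)) \<partial>lborel) / pi"

lemma cos_neg: "cos \<theta> < 0"
proof -
  have "cos \<theta> < cos (pi / 2)"
    by (rule cos_monotone_0_pi) (use angles pi_gt_zero in linarith)+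
  then show ?thesis by simp
qed

lemma ray_simps [simp]: "Re (ray u) = u" "Im (ray u) = \<theta>" "ray u \<in> strip"
  using angles pi_gt_zero by (auto simp: ray_def strip_def)

lemma Re_exp_ray: "Re (exp (ray u)) = exp u * cos \<theta>"
  by (simp add: Re_exp)

lemma continuous_ray: "continuous_on A ray"
  unfolding ray_def Complex_eq by (intro continuous_intros)

lemma ray_measurable [measurable]: "ray \<in> borel_measurable borel"
  by (intro borel_measurable_continuous_onI continuous_ray)

lemma strip_measurable: "continuous_on strip g \<Longrightarrow> (\<lambda>u. g (ray u)) \<in> borel_measurable borel"
  by (intro borel_measurable_continuous_onI continuous_on_compose2[OF _ continuous_ray]) auto

lemma norm_exp_ray:
  assumes "t0 \<le> t"
  shows "norm (exp (of_real t * exp (ray u))) \<le> exp (t0 * exp u * cos \<theta>)"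
  using assms cos_neg by (simp add: Re_exp_ray mult.assoc mult_right_mono_neg mult_le_0_iff)

text \<open>On the ray the exponential decays doubly exponentially as u grows, which absorbs any
  power of \<open>exp u\<close>; the square is what the second x-derivative calls for. Uniformity in
  t \<ge> t0 yields one majorant for all these t.\<close>

lemma exp_ray_damp:
  assumes "t0 > 0"
  shows "\<exists>K>0. \<forall>t\<ge>t0. \<forall>u. norm (exp (of_real t * exp (ray u))) * (1 + exp u)\<^sup>2 \<le> K"
proof -
  \<comment> \<open>The bound 1 gives m * (1 + exp u) \<le> 1 + s, and the other bound gives s \<le>
    - t0 * exp u * cos \<theta>, where s = m * exp u.\<close>
  define m where "m = min 1 (- t0 * cos \<theta>)"
  have m: "0 < m" "m \<le> 1" "m \<le> - t0 * cos \<theta>"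
    using assms cos_neg by (auto simp: m_def mult_less_0_iff)
  show ?thesis
  proof (intro exI[of _ "2 / m\<^sup>2"] conjI allI impI)
    fix t u assume t: "t0 \<le> t"
    define s where "s = m * exp u"
    have s: "s \<ge> 0" using m by (simp add: s_def)
    have "norm (exp (of_real t * exp (ray u))) \<le> exp (t0 * exp u * cos \<theta>)"
      using t by (rule norm_exp_ray)
    also have "\<dots> \<le> exp (- s)"
      using mult_right_mono[OF m(3), of "exp u"] by (simp add: s_def algebra_simps)
    finally have 1: "norm (exp (of_real t * exp (ray u))) \<le> exp (- s)" .
    have "(m * (1 + exp u))\<^sup>2 \<le> (1 + s)\<^sup>2"
      using m by (intro power_mono) (auto simp: s_def algebra_simps)
    also have "\<dots> \<le> 2 * exp s"
      using exp_lower_Taylor_quadratic[OF s] s by (simp add: power2_eq_square algebra_simps)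
    finally have "m\<^sup>2 * (1 + exp u)\<^sup>2 \<le> 2 * exp s" by (simp add: power_mult_distrib)
    then have 2: "(1 + exp u)\<^sup>2 \<le> 2 / m\<^sup>2 * exp s"
      using m by (simp add: field_simps)
    have "norm (exp (of_real t * exp (ray u))) * (1 + exp u)\<^sup>2 \<le> exp (- s) * (2 / m\<^sup>2 * exp s)"
      using 1 2 by (intro mult_mono) auto
    also have "\<dots> = 2 / m\<^sup>2" by (simp add: exp_minus field_simps)
    finally show "norm (exp (of_real t * exp (ray u))) * (1 + exp u)\<^sup>2 \<le> 2 / m\<^sup>2" .
  qed (use m in simp)
qed

lemma tame_bound:
  assumes "tame g" "t0 > 0"
  obtains w where "integrable lborel w"
    "\<And>t u. t \<ge> t0 \<Longrightarrow> norm (exp (of_real t * exp (ray u)) * g (ray u)) \<le> w u"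
proof -
  obtain K where K: "K > 0"
    "\<And>t u. t \<ge> t0 \<Longrightarrow> norm (exp (of_real t * exp (ray u))) * (1 + exp u)\<^sup>2 \<le> K"
    using exp_ray_damp[OF assms(2)] by blast
  obtain C k where C: "k > 0" "\<And>u. norm (g (ray u)) \<le> C * exp (- k * \<bar>u\<bar>) * (1 + exp u)\<^sup>2"
    using assms(1) unfolding tame_def by blast
  have "0 \<le> C * exp (- k * \<bar>0\<bar>) * (1 + exp 0)\<^sup>2"
    by (rule order_trans[OF norm_ge_zero C(2)])
  then have C0: "C \<ge> 0" by simp
  show ?thesis
  proof (rule that[of "\<lambda>u. K * C * exp (- k * \<bar>u\<bar>)"])
    show "integrable lborel (\<lambda>u. K * C * exp (- k * \<bar>u\<bar>))"
      using integrable_exp_neg_abs[OF C(1)] by simp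
    fix t u assume "t \<ge> t0"
    let ?e = "norm (exp (of_real t * exp (ray u)))"
    have "norm (exp (of_real t * exp (ray u)) * g (ray u)) \<le> ?e * (C * exp (- k * \<bar>u\<bar>) * (1 + exp u)\<^sup>2)"
      unfolding norm_mult by (intro mult_left_mono C) auto
    also have "\<dots> = (?e * (1 + exp u)\<^sup>2) * (C * exp (- k * \<bar>u\<bar>))" by simp
    also have "\<dots> \<le> K * (C * exp (- k * \<bar>u\<bar>))"
      using K \<open>t \<ge> t0\<close> C0 by (intro mult_right_mono) auto
    finally show "norm (exp (of_real t * exp (ray u)) * g (ray u)) \<le> K * C * exp (- k * \<bar>u\<bar>)" by simp
  qed
qed

lemma tame_measurable:
  assumes "tame g"
  shows "(\<lambda>u. g (ray u)) \<in> borel_measurable borel"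
  by (rule strip_measurable) (use assms in \<open>simp add: tame_def\<close>)

lemma tame_integrable:
  assumes "tame g" "t > 0"
  shows "integrable lborel (\<lambda>u. exp (of_real t * exp (ray u)) * g (ray u))"
proof -
  obtain w where w: "integrable lborel w"
    "\<And>s u. s \<ge> t \<Longrightarrow> norm (exp (of_real s * exp (ray u)) * g (ray u)) \<le> w u"
    by (rule tame_bound[OF assms]) (rule that)
  note [measurable] = tame_measurable[OF assms(1)]
  show ?thesis
    by (rule integrable_dominated[OF w(1) _ w(2)[OF order_refl]]) simp
qed

text \<open>Domination is local: near t the damping available from time t / 2 onwards provides the
  majorant. Nothing is claimed at t = 0, where the damping disappears.\<close>

lemma hankel_continuous:
  assumes "tame g"
  shows "continuous_on {0<..} (hankel g)"
proof -
  note [measurable] = tame_measurable[OF assms(1)]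
  have "isCont (hankel g) t" if t: "t > 0" for t
  proof -
    obtain w where w: "integrable lborel w"
      "\<And>s u. s \<ge> t / 2 \<Longrightarrow> norm (exp (of_real s * exp (ray u)) * g (ray u)) \<le> w u"
      using t by (rule tame_bound[OF assms half_gt_zero]) (rule that)
    have "((\<lambda>s. \<integral>u. Im (exp (of_real s * exp (ray u)) * g (ray u)) \<partial>lborel) \<longlongrightarrow>
        (\<integral>u. Im (exp (of_real t * exp (ray u)) * g (ray u)) \<partial>lborel)) (at t within {t / 2<..})"
    proof (rule tendsto_lebesgue_at_within[OF _ _ w(1)])
      show "norm (Im (exp (of_real s * exp (ray u)) * g (ray u))) \<le> w u"
        if "s \<in> {t / 2<..}" for s u
        using order_trans[OF abs_Im_le_cmod w(2)] that by simp
      show "AE u in lborel. ((\<lambda>s. Im (exp (of_real s * exp (ray u)) * g (ray u))) \<longlongrightarrow>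
          Im (exp (of_real t * exp (ray u)) * g (ray u))) (at t within {t / 2<..})"
        by (intro AE_I2 tendsto_intros)
    qed measurable
    then have "(hankel g \<longlongrightarrow> hankel g t) (at t within {t / 2<..})"
      unfolding hankel_def by (rule tendsto_divide[OF _ tendsto_const]) simp
    moreover have "at t within {t / 2<..} = at t"
      using t by (intro at_within_open) auto
    ultimately show ?thesis
      by (simp only: isCont_def)
  qed
  then show ?thesis
    by (intro continuous_at_imp_continuous_on ballI) (simp only: greaterThan_iff)
qed

lemma hankel_le:
  assumes g: "tame g" and f: "continuous_on strip f" and t: "t > 0"
    and le: "\<And>u. norm (f (ray u)) \<le> c * norm (g (ray u))"
  shows "\<bar>hankel f t\<bar> \<le> c * (\<integral>u. norm (exp (of_real t * exp (ray u)) * g (ray u)) \<partial>lborel) / pi"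
proof -
  note [measurable] = strip_measurable[OF f]
  have gi: "integrable lborel (\<lambda>u. c * norm (exp (of_real t * exp (ray u)) * g (ray u)))"
    using tame_integrable[OF g t] by simp
  have bd: "\<bar>Im (exp (of_real t * exp (ray u)) * f (ray u))\<bar>
      \<le> c * norm (exp (of_real t * exp (ray u)) * g (ray u))" for u
  proof -
    have "\<bar>Im (exp (of_real t * exp (ray u)) * f (ray u))\<bar> \<le> norm (exp (of_real t * exp (ray u)) * f (ray u))"
      by (rule abs_Im_le_cmod)
    also have "\<dots> \<le> norm (exp (of_real t * exp (ray u))) * (c * norm (g (ray u)))"
      unfolding norm_mult by (intro mult_left_mono le) auto
    finally show ?thesis by (simp add: norm_mult mult_ac)
  qed
  have "integrable lborel (\<lambda>u. Im (exp (of_real t * exp (ray u)) * f (ray u)))"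
    by (rule integrable_dominated[OF gi]) (measurable, use bd in simp)
  then have "\<bar>\<integral>u. Im (exp (of_real t * exp (ray u)) * f (ray u)) \<partial>lborel\<bar>
      \<le> (\<integral>u. c * norm (exp (of_real t * exp (ray u)) * g (ray u)) \<partial>lborel)"
    using bd gi by (intro order_trans[OF integral_abs_bound] integral_mono) auto
  then show ?thesis
    by (simp add: hankel_def divide_right_mono)
qed

text \<open>On the ray \<open>exp (t z)\<close> has modulus at most 1 for every t \<ge> 0, so when g
  is integrable by itself the estimate is uniform down to t = 0. The Abel integrals need this
  uniformity.\<close>

lemma hankel_bounded:
  assumes g: "continuous_on strip g" and k: "k > 0"
    and le: "\<And>u. norm (g (ray u)) \<le> C * exp (- k * \<bar>u\<bar>)"
  shows "\<exists>B. \<forall>t\<ge>0. \<bar>hankel g t\<bar> \<le> B"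
proof (intro exI allI impI)
  fix t :: real assume t: "t \<ge> 0"
  note [measurable] = strip_measurable[OF g]
  have i: "integrable lborel (\<lambda>u. C * exp (- k * \<bar>u\<bar>))"
    using integrable_exp_neg_abs[OF k] by simp
  have bd: "\<bar>Im (exp (of_real t * exp (ray u)) * g (ray u))\<bar> \<le> C * exp (- k * \<bar>u\<bar>)" for u
  proof -
    have "\<bar>Im (exp (of_real t * exp (ray u)) * g (ray u))\<bar> \<le> norm (exp (of_real t * exp (ray u)) * g (ray u))"
      by (rule abs_Im_le_cmod)
    also have "\<dots> \<le> 1 * (C * exp (- k * \<bar>u\<bar>))"
      unfolding norm_mult using norm_exp_ray[OF t, of u] by (intro mult_mono le) auto
    finally show ?thesis by simp
  qed
  have "integrable lborel (\<lambda>u. Im (exp (of_real t * exp (ray u)) * g (ray u)))"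
    by (rule integrable_dominated[OF i]) (measurable, use bd in simp)
  then have "\<bar>\<integral>u. Im (exp (of_real t * exp (ray u)) * g (ray u)) \<partial>lborel\<bar>
      \<le> (\<integral>u. C * exp (- k * \<bar>u\<bar>) \<partial>lborel)"
    using bd i by (intro order_trans[OF integral_abs_bound] integral_mono) auto
  then show "\<bar>hankel g t\<bar> \<le> (\<integral>u. C * exp (- k * \<bar>u\<bar>) \<partial>lborel) / pi"
    by (simp add: hankel_def divide_right_mono)
qed

text \<open>The increments in y are controlled by a single tame function q, so differentiating in x
  costs a growth condition on q and leaves t fixed.\<close>

lemma hankel_has_derivative:
  fixes G :: "real \<Rightarrow> complex \<Rightarrow> complex"
  assumes t: "t > 0" and x: "x \<in> S"
    and G: "\<And>y. y \<in> S \<Longrightarrow> tame (G y)" and G': "continuous_on strip G'" and q: "tame q"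
    and der: "\<And>u. ((\<lambda>y. G y (ray u)) has_vector_derivative G' (ray u)) (at x within S)"
    and lip: "\<And>y u. y \<in> S \<Longrightarrow> norm (G y (ray u) - G x (ray u)) \<le> \<bar>y - x\<bar> * norm (q (ray u))"
  shows "((\<lambda>y. hankel (G y) t) has_real_derivative hankel G' t) (at x within S)"
proof -
  note [measurable] = strip_measurable[OF G']
  have "((\<lambda>y. \<integral>u. Im (exp (of_real t * exp (ray u)) * G y (ray u)) \<partial>lborel) has_real_derivative
      (\<integral>u. Im (exp (of_real t * exp (ray u)) * G' (ray u)) \<partial>lborel)) (at x within S)"
  proof (rule has_real_derivative_lebesgue[OF _ x])
    show "integrable lborel (\<lambda>u. Im (exp (of_real t * exp (ray u)) * G y (ray u)))" if "y \<in> S" for y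
      by (rule integrable_Im[OF tame_integrable[OF G[OF that] t]])
    show "(\<lambda>u. Im (exp (of_real t * exp (ray u)) * G' (ray u))) \<in> borel_measurable lborel"
      by measurable
    show "integrable lborel (\<lambda>u. norm (exp (of_real t * exp (ray u)) * q (ray u)))"
      using tame_integrable[OF q t] by simp
    fix u
    have "((\<lambda>y. Im (exp (of_real t * exp (ray u)) * G y (ray u))) has_vector_derivative
       Im (exp (of_real t * exp (ray u)) * G' (ray u))) (at x within S)"
      by (intro bounded_linear.has_vector_derivative[OF bounded_linear_Im]
          bounded_linear.has_vector_derivative[OF bounded_linear_mult_right] der)
    then show "((\<lambda>y. Im (exp (of_real t * exp (ray u)) * G y (ray u))) has_real_derivative
       Im (exp (of_real t * exp (ray u)) * G' (ray u))) (at x within S)"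
      by (simp add: has_real_derivative_iff_has_vector_derivative)
    fix y assume y: "y \<in> S"
    have "\<bar>Im (exp (of_real t * exp (ray u)) * G y (ray u)) - Im (exp (of_real t * exp (ray u)) * G x (ray u))\<bar>
      \<le> norm (exp (of_real t * exp (ray u)) * (G y (ray u) - G x (ray u)))"
      unfolding right_diff_distrib minus_complex.simps(2)[symmetric] by (rule abs_Im_le_cmod)
    also have "\<dots> \<le> norm (exp (of_real t * exp (ray u))) * (\<bar>y - x\<bar> * norm (q (ray u)))"
      unfolding norm_mult[of _ "_ - _"] by (intro mult_left_mono lip y) auto
    finally show "\<bar>Im (exp (of_real t * exp (ray u)) * G y (ray u)) - Im (exp (of_real t * exp (ray u)) * G x (ray u))\<bar>
       \<le> \<bar>y - x\<bar> * norm (exp (of_real t * exp (ray u)) * q (ray u))"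
      by (simp add: norm_mult mult_ac)
  qed
  then show ?thesis
    unfolding hankel_def by (rule DERIV_cdivide)
qed

end

section \<open>Contour integrals in the strip and the residue at ln \<mu>\<close>

lemma has_contour_integral_horizontal:
  assumes "a < b"
  shows "(f has_contour_integral I) (linepath (Complex a y) (Complex b y)) \<longleftrightarrow>
         ((\<lambda>x. f (Complex x y)) has_integral I) {a..b}"
proof -
  have lp: "linepath (Complex a y) (Complex b y) x = linepath (of_real a) (of_real b) x + \<i> * of_real y" for x
    by (simp add: linepath_def complex_eq_iff algebra_simps)
  have df: "Complex b y - Complex a y = of_real b - of_real a"
    by (simp add: complex_eq_iff)
  have "(f has_contour_integral I) (linepath (Complex a y) (Complex b y)) \<longleftrightarrow>
      ((\<lambda>z. f (z + \<i> * of_real y)) has_contour_integral I) (linepath (of_real a) (of_real b))"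
    by (simp only: has_contour_integral_linepath lp df)
  also have "\<dots> \<longleftrightarrow> ((\<lambda>x. f (of_real x + \<i> * of_real y)) has_integral I) {a..b}"
    using assms by (subst has_contour_integral_linepath_Reals_iff) auto
  finally show ?thesis by (simp add: Complex_eq)
qed

lemma exp_complex_integral:
  fixes z :: complex
  assumes z: "Re z > 0"
  shows "has_bochner_integral lborel (\<lambda>t. indicator {0<..} t *\<^sub>R exp (- z * of_real t)) (1 / z)"
proof -
  have int: "integrable lborel (\<lambda>t. indicator {0<..} t *\<^sub>R exp (- z * of_real t))"
  proof (rule integrable_dominated)
    show "integrable lborel (\<lambda>t. indicator {0<..} t * exp (- Re z * t))"
      using exp_integral[OF z] by (simp add: has_bochner_integral_iff)
    show "norm (indicator {0<..} t *\<^sub>R exp (- z * of_real t)) \<le> indicator {0<..} t * exp (- Re z * t)" for t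
      by (simp add: indicator_def)
  qed measurable
  have ei: "einterval 0 \<infinity> = {0<..}"
    by (auto simp: einterval_def zero_ereal_def)
  have "(LBINT t=0..\<infinity>. exp (- z * of_real t)) = 0 - (- 1 / z)"
  proof (rule interval_integral_FTC_integrable[where F = "\<lambda>t. - exp (- z * of_real t) / z"])
    show "((\<lambda>t. - exp (- z * of_real t) / z) has_vector_derivative exp (- z * of_real t)) (at t)" for t
    proof -
      have "((\<lambda>t. - exp (- z * t) / z) has_field_derivative exp (- z * of_real t)) (at (of_real t))"
        using z by (auto intro!: derivative_eq_intros simp: field_simps)
      from has_vector_derivative_real_field[OF this] show ?thesis by simp
    qed
    show "isCont (\<lambda>t. exp (- z * of_real t)) t" for t
      by (intro continuous_intros)
    show "set_integrable lborel (einterval 0 \<infinity>) (\<lambda>t. exp (- z * of_real t))"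
      using int by (simp add: ei set_integrable_def)
    have "((\<lambda>t. - exp (- z * of_real t) / z) \<longlongrightarrow> - exp (- z * of_real 0) / z) (at_right 0)"
      using z by (intro tendsto_intros) auto
    then show "(((\<lambda>t. - exp (- z * of_real t) / z) \<circ> real_of_ereal) \<longlongrightarrow> - 1 / z) (at_right 0)"
      by (simp add: zero_ereal_def at_right_ereal filterlim_filtermap comp_def)
    have "((\<lambda>t. - exp (- z * of_real t) / z) \<longlongrightarrow> 0) at_top"
    proof (rule tendsto_norm_zero_cancel)
      have "((\<lambda>t. exp (- (Re z * t)) / norm z) \<longlongrightarrow> 0 / norm z) at_top"
        using z by (intro tendsto_divide tendsto_const filterlim_compose[OF exp_at_bot]
            filterlim_compose[OF filterlim_uminus_at_bot_at_top]
            filterlim_tendsto_pos_mult_at_top[OF tendsto_const] filterlim_ident) auto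
      then show "((\<lambda>t. norm (- exp (- z * of_real t) / z)) \<longlongrightarrow> 0) at_top"
        by (simp add: norm_divide)
    qed
    then show "(((\<lambda>t. - exp (- z * of_real t) / z) \<circ> real_of_ereal) \<longlongrightarrow> 0) (at_left \<infinity>)"
      by (simp add: at_left_PInf filterlim_filtermap comp_def)
  qed auto
  then have "(\<integral>t. indicator {0<..} t *\<^sub>R exp (- z * of_real t) \<partial>lborel) = 1 / z"
    by (simp add: interval_lebesgue_integral_def ei set_lebesgue_integral_def)
  with int show ?thesis
    by (simp add: has_bochner_integral_iff)
qed

context hankel_strip
begin

lemma open_strip: "open strip"
proof -
  have "strip = {w. Im w < \<omega>} \<inter> {w. - \<omega> < Im w}" by (auto simp: strip_def)
  then show ?thesis by (simp add: open_Int open_halfspace_Im_lt open_halfspace_Im_gt)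
qed

lemma convex_strip: "convex strip"
proof -
  have "strip = {w. Im w < \<omega>} \<inter> {w. - \<omega> < Im w}" by (auto simp: strip_def)
  then show ?thesis by (simp add: convex_Int convex_halfspace_Im_lt convex_halfspace_Im_gt)
qed

lemma admissible_tame: "admissible g \<Longrightarrow> tame g"
  unfolding admissible_def tame_def
proof (elim conjE exE, intro conjI)
  fix C k assume hol: "g holomorphic_on strip" and k: "k > 0"
    and b: "\<forall>w\<in>strip. norm (g w) \<le> C * exp (- k * \<bar>Re w\<bar>) * (1 + exp (Re w))"
  show "continuous_on strip g" using hol by (rule holomorphic_on_imp_continuous_on)
  have C: "0 \<le> C"
    using order_trans[OF norm_ge_zero b[rule_format, of "ray 0"]] by simp
  have "norm (g (ray u)) \<le> C * exp (- k * \<bar>u\<bar>) * (1 + exp u)\<^sup>2" for u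
  proof -
    have "norm (g (ray u)) \<le> C * exp (- k * \<bar>u\<bar>) * (1 + exp u)"
      using b[rule_format, of "ray u"] by simp
    also have "\<dots> \<le> C * exp (- k * \<bar>u\<bar>) * (1 + exp u)\<^sup>2"
      using C by (intro mult_left_mono) (auto simp: power2_eq_square algebra_simps)
    finally show ?thesis .
  qed
  with k show "\<exists>C k. k > 0 \<and> (\<forall>u. norm (g (ray u)) \<le> C * exp (- k * \<bar>u\<bar>) * (1 + exp u)\<^sup>2)"
    by blast
qed

text \<open>Points with the same exponential differ by a multiple of 2 pi i, and the strip is
  narrower than that; so \<open>ln \<mu>\<close> is the one pole of the kernel.\<close>

lemma exp_ne_on_strip:
  assumes "\<mu> > 0" "w \<in> strip" "w \<noteq> of_real (ln \<mu>)"
  shows "of_real \<mu> - exp w \<noteq> 0"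
proof
  assume "of_real \<mu> - exp w = 0"
  then have "exp w = exp (of_real (ln \<mu>))"
    using assms(1) by (simp add: exp_of_real)
  then have "w = of_real (ln \<mu>)"
    by (rule exp_complex_eqI[rotated]) (use assms(2) angles in \<open>auto simp: strip_def\<close>)
  with assms(3) show False by simp
qed

text \<open>Along the ray the denominator grows like 1 + exp u, which cancels the growth allowed to
  admissible functions and leaves the integrable factor
  \<open>exp (- k * \<bar>u\<bar>)\<close>.\<close>

lemma kernel_bound:
  assumes "admissible g" "\<mu> > 0"
  shows "integrable lborel (\<lambda>u. norm (g (ray u)) / (\<mu> - exp u * cos \<theta>))"
proof -
  obtain C k where k: "k > 0"
    and b: "\<And>w. w \<in> strip \<Longrightarrow> norm (g w) \<le> C * exp (- k * \<bar>Re w\<bar>) * (1 + exp (Re w))"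
    using assms(1) unfolding admissible_def by blast
  have C: "0 \<le> C"
    using order_trans[OF norm_ge_zero b[of "ray 0"]] by simp
  \<comment> \<open>Since cos \<theta> < 0, the denominator is a combination of 1 and
    \<open>exp u\<close> with positive coefficients; m is the smaller one.\<close>
  define m where "m = min \<mu> (- cos \<theta>)"
  have m: "m > 0" "m \<le> \<mu>" "m \<le> - cos \<theta>" using assms cos_neg by (auto simp: m_def)
  note [measurable] = tame_measurable[OF admissible_tame[OF assms(1)]]
  show ?thesis
  proof (rule integrable_dominated)
    show "integrable lborel (\<lambda>u. C / m * exp (- k * \<bar>u\<bar>))"
      using integrable_exp_neg_abs[OF k] by simp
    fix u
    have D: "m * (1 + exp u) \<le> \<mu> - exp u * cos \<theta>"
      using m mult_right_mono[OF m(3), of "exp u"] by (simp add: algebra_simps)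
    have "norm (g (ray u)) / (\<mu> - exp u * cos \<theta>) \<le> (C * exp (- k * \<bar>u\<bar>) * (1 + exp u)) / (m * (1 + exp u))"
    proof (rule frac_le)
      show "norm (g (ray u)) \<le> C * exp (- k * \<bar>u\<bar>) * (1 + exp u)"
        using b[of "ray u"] by simp
      show "0 < m * (1 + exp u)" using m by (simp add: add_pos_pos)
    qed (use D C in auto)
    also have "\<dots> = C / m * exp (- k * \<bar>u\<bar>)"
    proof -
      have "1 + exp u \<noteq> 0" using exp_gt_zero[of u] by linarith
      then show ?thesis by simp
    qed
    finally have *: "norm (g (ray u)) / (\<mu> - exp u * cos \<theta>) \<le> C / m * exp (- k * \<bar>u\<bar>)" .
    have "0 < m * (1 + exp u)" using m by (simp add: add_pos_pos)
    with D have "0 < \<mu> - exp u * cos \<theta>" by linarith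
    with * show "norm (norm (g (ray u)) / (\<mu> - exp u * cos \<theta>)) \<le> C / m * exp (- k * \<bar>u\<bar>)"
      by simp
  qed measurable
qed

lemma norm_kernel_le:
  assumes "\<mu> > 0"
  shows "\<mu> - exp u * cos \<theta> \<le> norm (of_real \<mu> - exp (ray u))"
  using complex_Re_le_cmod[of "of_real \<mu> - exp (ray u)"] by (simp add: Re_exp_ray)

lemma kernel_integrable:
  assumes "admissible g" "\<mu> > 0"
  shows "integrable lborel (\<lambda>u. g (ray u) / (of_real \<mu> - exp (ray u)))"
proof (rule integrable_dominated[OF kernel_bound[OF assms]])
  note [measurable] = tame_measurable[OF admissible_tame[OF assms(1)]]
  show "(\<lambda>u. g (ray u) / (of_real \<mu> - exp (ray u))) \<in> borel_measurable lborel" by measurable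
  fix u
  have "0 < \<mu> - exp u * cos \<theta>"
    using assms(2) cos_neg by (simp add: mult_pos_neg order_less_trans[of _ 0])
  then show "norm (g (ray u) / (of_real \<mu> - exp (ray u))) \<le> norm (g (ray u)) / (\<mu> - exp u * cos \<theta>)"
    using norm_kernel_le[OF assms(2), of u] by (auto simp: norm_divide intro!: frac_le)
qed

text \<open>The denominator has derivative - \<mu> at its simple zero \<open>ln \<mu>\<close>, which
  accounts for the minus sign and the division by \<mu>.\<close>

lemma strip_residue:
  assumes g: "g holomorphic_on strip" and \<mu>: "\<mu> > 0" and R: "\<bar>ln \<mu>\<bar> < R"
  defines "f \<equiv> \<lambda>w. g w / (of_real \<mu> - exp w)"
  shows "contour_integral (rectpath (Complex (- R) (- \<theta>)) (Complex R \<theta>)) f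
      = - 2 * pi * \<i> * g (of_real (ln \<mu>)) / of_real \<mu>"
proof -
  define z0 where "z0 = complex_of_real (ln \<mu>)"
  let ?r = "rectpath (Complex (- R) (- \<theta>)) (Complex R \<theta>)"
  have \<theta>: "0 < \<theta>" "\<theta> < \<omega>" using angles pi_gt_zero by linarith+
  have z0: "z0 \<in> strip" using \<theta> by (simp add: z0_def strip_def)
  have ez0: "exp z0 = of_real \<mu>" using \<mu> by (simp add: z0_def exp_of_real)
  have holf: "f holomorphic_on strip - {z0}"
    unfolding f_def using exp_ne_on_strip[OF \<mu>] g
    by (intro holomorphic_intros) (auto simp: z0_def intro: holomorphic_on_subset)
  have in_box: "z0 \<in> box (Complex (- R) (- \<theta>)) (Complex R \<theta>)"
    using R \<theta> by (auto simp: in_box_complex_iff z0_def)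
  have pimg: "path_image ?r \<subseteq> strip - {z0}"
  proof -
    have "path_image ?r = cbox (Complex (- R) (- \<theta>)) (Complex R \<theta>) - box (Complex (- R) (- \<theta>)) (Complex R \<theta>)"
      using R \<theta> by (intro path_image_rectpath_cbox_minus_box) auto
    also have "\<dots> \<subseteq> strip - {z0}"
      using in_box \<theta> by (auto simp: in_cbox_complex_iff strip_def)
    finally show ?thesis .
  qed
  have "residue f z0 = - (g z0 / of_real \<mu>)"
  proof (rule residue_simple'[OF open_strip z0 holf])
    have "((\<lambda>w. (exp w - exp z0) / (w - z0)) \<longlongrightarrow> exp z0) (at z0)"
      using DERIV_exp[of z0] by (simp add: has_field_derivative_iff)
    moreover have "(g \<longlongrightarrow> g z0) (at z0)"
      using g z0 open_strip holomorphic_on_imp_continuous_on continuous_on_eq_continuous_at isContD by blast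
    ultimately have "((\<lambda>w. - (g w / ((exp w - exp z0) / (w - z0)))) \<longlongrightarrow> - (g z0 / exp z0)) (at z0)"
      by (intro tendsto_intros) auto
    moreover have "- (g w / ((exp w - exp z0) / (w - z0))) = f w * (w - z0)" for w
    proof -
      have "of_real \<mu> - exp w = - (exp w - exp z0)" by (simp add: ez0)
      then show ?thesis unfolding f_def by (simp only: minus_divide_right[symmetric]) simp
    qed
    ultimately show "((\<lambda>w. f w * (w - z0)) \<longlongrightarrow> - (g z0 / of_real \<mu>)) (at z0)"
      by (simp add: ez0)
  qed
  moreover have "contour_integral ?r f = 2 * pi * \<i> * (\<Sum>p\<in>{z0}. winding_number ?r p * residue f p)"
  proof (rule Residue_theorem[OF open_strip convex_connected[OF convex_strip] _ holf])
    show "\<forall>z. z \<notin> strip \<longrightarrow> winding_number ?r z = 0"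
      using pimg by (auto intro!: simply_connected_imp_winding_number_zero[OF convex_imp_simply_connected[OF convex_strip]])
  qed (use pimg in auto)
  moreover have "winding_number ?r z0 = 1"
    using in_box by (rule winding_number_rectpath)
  ultimately show ?thesis by (simp add: z0_def)
qed

text \<open>Reflection symmetry makes the lower edge of a wide rectangle the conjugate of the upper
  one, so the two edges together leave the imaginary part along a single ray. The vertical edges
  vanish as the rectangle widens, by the decay in \<open>admissible\<close>.\<close>

lemma hankel_residue:
  assumes adm: "admissible g" and \<mu>: "\<mu> > 0"
  shows "(\<integral>u. Im (g (ray u) / (of_real \<mu> - exp (ray u))) \<partial>lborel) = pi * Re (g (of_real (ln \<mu>))) / \<mu>"
proof -
  define f where "f = (\<lambda>w. g w / (of_real \<mu> - exp w))"
  obtain C k where k: "k > 0"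
    and b: "\<And>w. w \<in> strip \<Longrightarrow> norm (g w) \<le> C * exp (- k * \<bar>Re w\<bar>) * (1 + exp (Re w))"
    and hol: "g holomorphic_on strip" and sym: "\<And>w. w \<in> strip \<Longrightarrow> g (cnj w) = cnj (g w)"
    using adm unfolding admissible_def by blast
  have C: "0 \<le> C"
    using order_trans[OF norm_ge_zero b[of "ray 0"]] by simp
  have \<theta>: "0 < \<theta>" "\<theta> < \<omega>" using angles pi_gt_zero by linarith+
  have contf: "continuous_on (strip - {of_real (ln \<mu>)}) f"
    unfolding f_def using exp_ne_on_strip[OF \<mu>]
    by (intro continuous_intros continuous_on_subset[OF holomorphic_on_imp_continuous_on[OF hol]]) auto
  define H where "H = (\<lambda>R. integral {- R..R} (\<lambda>x. f (ray x)))"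
  \<comment> \<open>A common bound for both vertical edges: the right one gives 4 C exp (- k R), the
    left one the same divided by \<mu>.\<close>
  define B where "B = (\<lambda>R. 4 * C * (1 + 1 / \<mu>) * exp (- k * R))"
  have B0: "B R \<ge> 0" for R using C \<mu> by (simp add: B_def)
  \<comment> \<open>The margin ln 2 in the condition on R makes |exp w| at least 2\<mu> on the right
    edge and at most \<mu>/2 on the left, so |\<mu> - exp w| is at least half the larger of the two
    moduli.\<close>
  have main: "\<bar>Im (H R) - pi * Re (g (of_real (ln \<mu>))) / \<mu>\<bar> \<le> 2 * \<theta> * B R"
    if R: "R > \<bar>ln \<mu>\<bar> + ln 2" for R
  proof -
    have lnR: "\<bar>ln \<mu>\<bar> < R" "R > 0" using R ln_gt_zero[of "2::real"] by linarith+
    have eR: "2 * \<mu> \<le> exp R"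
    proof -
      have "exp (ln \<mu> + ln 2) \<le> exp R" using R by (subst exp_le_cancel_iff) linarith
      then show ?thesis using \<mu> by (simp add: exp_add)
    qed
    have emR: "2 * exp (- R) \<le> \<mu>"
    proof -
      have "exp (ln 2 - R) \<le> exp (ln \<mu>)" using R by (subst exp_le_cancel_iff) linarith
      then show ?thesis using \<mu> by (simp add: exp_diff exp_minus field_simps)
    qed
    have vert: "norm (f w) \<le> B R" if w: "w \<in> strip" "Re w = R \<or> Re w = - R" for w
      using w(2)
    proof
      assume Re: "Re w = R"
      have "norm (g w) \<le> C * exp (- k * R) * (2 * exp R)"
        using b[OF w(1)] mult_left_mono[of "1 + exp R" "2 * exp R" "C * exp (- k * R)"] Re lnR C
        by simp
      moreover have "exp R / 2 \<le> norm (of_real \<mu> - exp w)"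
        using norm_triangle_ineq3[of "of_real \<mu>" "exp w"] eR Re \<mu> by simp
      ultimately have "norm (f w) \<le> C * exp (- k * R) * (2 * exp R) / (exp R / 2)"
        unfolding f_def norm_divide using C by (intro frac_le) auto
      also have "\<dots> = 4 * C * 1 * exp (- k * R)" by simp
      also have "\<dots> \<le> B R"
        unfolding B_def using C \<mu> by (intro mult_right_mono mult_left_mono) auto
      finally show ?thesis .
    next
      assume Re: "Re w = - R"
      have "norm (g w) \<le> C * exp (- k * R) * 2"
        using b[OF w(1)] mult_left_mono[of "1 + exp (- R)" "2" "C * exp (- k * R)"] Re lnR C
        by simp
      moreover have "\<mu> / 2 \<le> norm (of_real \<mu> - exp w)"
        using norm_triangle_ineq2[of "of_real \<mu>" "exp w"] emR Re \<mu> by simp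
      ultimately have "norm (f w) \<le> C * exp (- k * R) * 2 / (\<mu> / 2)"
        unfolding f_def norm_divide using C \<mu> by (intro frac_le) auto
      also have "\<dots> = 4 * C * (1 / \<mu>) * exp (- k * R)" by simp
      also have "\<dots> \<le> B R"
        unfolding B_def using C \<mu> by (intro mult_right_mono mult_left_mono) auto
      finally show ?thesis .
    qed
    have horiz: "closed_segment (Complex a y) (Complex c y) \<subseteq> strip - {of_real (ln \<mu>)}"
      if "y = \<theta> \<or> y = - \<theta>" for a c y
      using that \<theta> by (auto simp: closed_segment_same_Im strip_def)
    have verts: "closed_segment (Complex x (- \<theta>)) (Complex x \<theta>) \<subseteq> strip - {of_real (ln \<mu>)}"
      "closed_segment (Complex x \<theta>) (Complex x (- \<theta>)) \<subseteq> strip - {of_real (ln \<mu>)}"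
      if "x = R \<or> x = - R" for x
      using that \<theta> lnR by (auto simp: closed_segment_same_Re strip_def closed_segment_eq_real_ivl)
    note ci = contour_integrable_continuous_linepath[OF continuous_on_subset[OF contf]]
    have hz: "contour_integral (linepath (Complex (- R) y) (Complex R y)) f
        = integral {- R..R} (\<lambda>x. f (Complex x y))" if y: "y = \<theta> \<or> y = - \<theta>" for y
    proof -
      have "(f has_contour_integral contour_integral (linepath (Complex (- R) y) (Complex R y)) f)
          (linepath (Complex (- R) y) (Complex R y))"
        by (rule has_contour_integral_integral[OF ci[OF horiz[OF y]]])
      then show ?thesis
        using has_contour_integral_horizontal[of "- R" R f _ y] lnR by (simp add: integral_unique)
    qed
    have bottom: "contour_integral (linepath (Complex (- R) (- \<theta>)) (Complex R (- \<theta>))) f = cnj (H R)"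
    proof -
      have "contour_integral (linepath (Complex (- R) (- \<theta>)) (Complex R (- \<theta>))) f
          = integral {- R..R} (\<lambda>x. f (Complex x (- \<theta>)))"
        by (rule hz) simp
      also have "\<dots> = integral {- R..R} (\<lambda>x. cnj (f (ray x)))"
      proof (rule integral_cong)
        fix x
        have "Complex x (- \<theta>) = cnj (ray x)" by (simp add: ray_def complex_eq_iff)
        then show "f (Complex x (- \<theta>)) = cnj (f (ray x))"
          using sym[of "ray x"] by (simp add: f_def exp_cnj)
      qed
      finally show ?thesis by (simp add: H_def integral_cnj)
    qed
    have top: "contour_integral (linepath (Complex R \<theta>) (Complex (- R) \<theta>)) f = - H R"
    proof -
      have "contour_integral (linepath (Complex (- R) \<theta>) (Complex R \<theta>)) f = H R"
        using hz[of \<theta>] by (simp add: H_def ray_def)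
      moreover have "contour_integral (linepath (Complex R \<theta>) (Complex (- R) \<theta>)) f
          = - contour_integral (linepath (Complex (- R) \<theta>) (Complex R \<theta>)) f"
        by (rule contour_integral_reverse_linepath, rule continuous_on_subset[OF contf horiz]) simp
      ultimately show ?thesis by simp
    qed
    define V where "V = contour_integral (linepath (Complex R (- \<theta>)) (Complex R \<theta>)) f
       + contour_integral (linepath (Complex (- R) \<theta>) (Complex (- R) (- \<theta>))) f"
    \<comment> \<open>The first two terms amount to -2 i Im (H R); comparing imaginary parts with
      the residue therefore leaves an error of half the vertical contribution V.\<close>
    have total: "contour_integral (rectpath (Complex (- R) (- \<theta>)) (Complex R \<theta>)) f = cnj (H R) - H R + V"
      using bottom top ci[OF horiz] ci[OF verts(1)] ci[OF verts(2)]
      by (simp add: rectpath_def Let_def V_def)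
    have V: "norm V \<le> 4 * \<theta> * B R"
    proof -
      have "norm (contour_integral (linepath (Complex R (- \<theta>)) (Complex R \<theta>)) f)
          \<le> B R * norm (Complex R \<theta> - Complex R (- \<theta>))"
        using ci[OF verts(1)] B0
      proof (rule contour_integral_bound_linepath)
        show "norm (f w) \<le> B R" if "w \<in> closed_segment (Complex R (- \<theta>)) (Complex R \<theta>)" for w
          using that verts(1)[of R] by (intro vert) (auto simp: closed_segment_same_Re)
      qed auto
      moreover have "norm (contour_integral (linepath (Complex (- R) \<theta>) (Complex (- R) (- \<theta>))) f)
          \<le> B R * norm (Complex (- R) (- \<theta>) - Complex (- R) \<theta>)"
        using ci[OF verts(2)] B0
      proof (rule contour_integral_bound_linepath)
        show "norm (f w) \<le> B R" if "w \<in> closed_segment (Complex (- R) \<theta>) (Complex (- R) (- \<theta>))" for w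
          using that verts(2)[of "- R"] by (intro vert) (auto simp: closed_segment_same_Re)
      qed auto
      moreover have "Complex R \<theta> - Complex R (- \<theta>) = 2 * \<theta> * \<i>" "Complex (- R) (- \<theta>) - Complex (- R) \<theta> = - (2 * \<theta> * \<i>)"
        by (simp_all add: complex_eq_iff)
      ultimately show ?thesis
        using \<theta> norm_triangle_ineq[of "contour_integral (linepath (Complex R (- \<theta>)) (Complex R \<theta>)) f"
          "contour_integral (linepath (Complex (- R) \<theta>) (Complex (- R) (- \<theta>))) f"]
        by (simp add: V_def norm_mult mult.commute)
    qed
    have "cnj (H R) - H R + V = - 2 * pi * \<i> * g (of_real (ln \<mu>)) / of_real \<mu>"
      using strip_residue[OF hol \<mu> lnR(1)] total by (simp add: f_def)
    then have "Im (cnj (H R) - H R + V) = Im (- 2 * pi * \<i> * g (of_real (ln \<mu>)) / of_real \<mu>)"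
      by simp
    then have "Im (H R) - pi * Re (g (of_real (ln \<mu>))) / \<mu> = Im V / 2"
      by (simp add: Im_divide_of_real field_simps)
    moreover have "\<bar>Im V\<bar> \<le> 4 * \<theta> * B R"
      using abs_Im_le_cmod V by (rule order_trans)
    ultimately show ?thesis by linarith
  qed
  have int: "integrable lborel (\<lambda>u. f (ray u))"
    using kernel_integrable[OF adm \<mu>] by (simp add: f_def)
  have Hn: "H R = (\<integral>u. indicator {- R..R} u *\<^sub>R f (ray u) \<partial>lborel)" for R
    using set_borel_integral_eq_integral(2)[of "{- R..R}" "\<lambda>u. f (ray u)"] int
    by (simp add: H_def set_lebesgue_integral_def set_integrable_def integrable_mult_indicator)
  have "(\<lambda>n. H (real n)) \<longlonglongrightarrow> (\<integral>u. f (ray u) \<partial>lborel)"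
    unfolding Hn
  proof (rule integral_dominated_convergence[OF _ _ integrable_norm[OF int]])
    show "AE u in lborel. (\<lambda>n. indicat_real {- real n..real n} u *\<^sub>R f (ray u)) \<longlonglongrightarrow> f (ray u)"
    proof (rule AE_I2)
      fix u :: real
      obtain N :: nat where N: "\<bar>u\<bar> < real N" using reals_Archimedean2 by blast
      have "eventually (\<lambda>n. indicat_real {- real n..real n} u *\<^sub>R f (ray u) = f (ray u)) sequentially"
        using eventually_ge_at_top[of N] by eventually_elim (use N in \<open>auto simp: indicator_def\<close>)
      then show "(\<lambda>n. indicat_real {- real n..real n} u *\<^sub>R f (ray u)) \<longlonglongrightarrow> f (ray u)"
        by (rule tendsto_eventually)
    qed
  qed (use int in \<open>auto simp: indicator_def\<close>)
  then have 1: "(\<lambda>n. Im (H (real n)) - pi * Re (g (of_real (ln \<mu>))) / \<mu>)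
      \<longlonglongrightarrow> Im (\<integral>u. f (ray u) \<partial>lborel) - pi * Re (g (of_real (ln \<mu>))) / \<mu>"
    by (intro tendsto_intros)
  have 2: "(\<lambda>n. Im (H (real n)) - pi * Re (g (of_real (ln \<mu>))) / \<mu>) \<longlonglongrightarrow> 0"
  proof (rule Lim_null_comparison)
    show "eventually (\<lambda>n. norm (Im (H (real n)) - pi * Re (g (of_real (ln \<mu>))) / \<mu>) \<le> 2 * \<theta> * B (real n)) sequentially"
    proof -
      obtain N :: nat where N: "\<bar>ln \<mu>\<bar> + ln 2 < real N" using reals_Archimedean2 by blast
      show ?thesis
        using eventually_ge_at_top[of N]
      proof eventually_elim
        fix n assume "N \<le> n"
        then have "\<bar>ln \<mu>\<bar> + ln 2 < real n" using N by linarith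
        then show "norm (Im (H (real n)) - pi * Re (g (of_real (ln \<mu>))) / \<mu>) \<le> 2 * \<theta> * B (real n)"
          using main by simp
      qed
    qed
    have "filterlim (\<lambda>n. - (k * real n)) at_bot sequentially"
      using k by (intro filterlim_compose[OF filterlim_uminus_at_bot_at_top]
            filterlim_tendsto_pos_mult_at_top[OF tendsto_const] filterlim_real_sequentially)
    then have "(\<lambda>n. exp (- (k * real n))) \<longlonglongrightarrow> 0"
      by (rule filterlim_compose[OF exp_at_bot])
    then have "(\<lambda>n. 2 * \<theta> * (4 * C * (1 + 1 / \<mu>)) * exp (- (k * real n))) \<longlonglongrightarrow> 2 * \<theta> * (4 * C * (1 + 1 / \<mu>)) * 0"
      by (intro tendsto_intros)
    then show "(\<lambda>n. 2 * \<theta> * B (real n)) \<longlonglongrightarrow> 0"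
      by (simp add: B_def mult.assoc)
  qed
  have "Im (\<integral>u. f (ray u) \<partial>lborel) = pi * Re (g (of_real (ln \<mu>))) / \<mu>"
    using LIMSEQ_unique[OF 1 2] by simp
  then show ?thesis
    using integral_Im[OF int] by (simp add: f_def del: integral_Im)
qed

end

text \<open>The mean value inequality for exp on the closed left half-plane, a convex set on which
  its derivative has modulus at most 1.\<close>

lemma norm_exp_diff_le:
  fixes z :: complex
  assumes "0 \<le> Re z" "0 \<le> x" "0 \<le> y"
  shows "norm (exp (- of_real y * z) - exp (- of_real x * z)) \<le> \<bar>y - x\<bar> * norm z"
proof -
  have "norm (exp (- of_real y * z) - exp (- of_real x * z)) \<le> 1 * norm (- of_real y * z - (- of_real x * z))"
  proof (rule field_differentiable_bound[where S = "{w. Re w \<le> 0}"])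
    show "convex {w. Re w \<le> 0}" by (rule convex_halfspace_Re_le)
    show "(exp has_field_derivative exp w) (at w within {w. Re w \<le> 0})" for w :: complex
      by (rule DERIV_subset[OF DERIV_exp]) simp
  qed (use assms in auto)
  also have "- of_real y * z - (- of_real x * z) = of_real (x - y) * z"
    by (simp add: algebra_simps)
  also have "1 * norm (of_real (x - y) * z) = \<bar>y - x\<bar> * norm z"
    by (simp add: norm_mult abs_minus_commute del: of_real_diff)
  finally show ?thesis .
qed

section \<open>The Laplace transform of a Hankel integral\<close>

context hankel_strip
begin

text \<open>Integrating over t first turns \<open>exp (- (\<mu> - z) t)\<close> into 1 / (\<mu> -
  z), and \<open>kernel_bound\<close> supplies the absolute integrability for this order. The
  residue evaluates g at z = \<mu>; the factor 1 / \<mu> appears because the Bromwich integrand is g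
  z / z.\<close>

lemma hankel_laplace:
  assumes adm: "admissible g" and \<mu>: "\<mu> > 0"
  shows "has_bochner_integral lborel (\<lambda>t. indicator {0<..} t * (exp (- \<mu> * t) * hankel g t))
           (Re (g (of_real (ln \<mu>))) / \<mu>)"
proof -
  define E where "E = (\<lambda>u t. indicator {0<..} t *\<^sub>R exp (- (of_real \<mu> - exp (ray u)) * of_real t) * g (ray u))"
  note [measurable] = tame_measurable[OF admissible_tame[OF adm]]
  have [measurable]: "case_prod E \<in> borel_measurable (lborel \<Otimes>\<^sub>M lborel)"
    unfolding E_def by measurable
  have Re_pos: "0 < \<mu> - exp u * cos \<theta>" for u
    using \<mu> cos_neg by (simp add: mult_pos_neg order_less_trans[of _ 0])
  have E: "has_bochner_integral lborel (E u) (g (ray u) / (of_real \<mu> - exp (ray u)))" for u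
  proof -
    have "0 < Re (of_real \<mu> - exp (ray u))" using Re_pos[of u] by (simp add: Re_exp_ray)
    from has_bochner_integral_mult_left[OF exp_complex_integral[OF this], of "g (ray u)"]
    show ?thesis by (simp add: E_def)
  qed
  have nE: "norm (E u t) = indicator {0<..} t * exp (- (\<mu> - exp u * cos \<theta>) * t) * norm (g (ray u))" for u t
    by (simp add: E_def norm_mult Re_exp_ray)
  have nEint: "has_bochner_integral lborel (\<lambda>t. norm (E u t)) (norm (g (ray u)) / (\<mu> - exp u * cos \<theta>))" for u
    using has_bochner_integral_mult_left[OF exp_integral[OF Re_pos[of u]], of "norm (g (ray u))"]
    unfolding nE by simp
  have ImE: "integrable lborel (\<lambda>t. Im (E u t))" for u
    using E[of u] by (intro integrable_Im) (simp add: has_bochner_integral_iff)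
  have prod: "integrable (lborel \<Otimes>\<^sub>M lborel) (\<lambda>(u, t). Im (E u t))"
  proof (rule lborel_pair.Fubini_integrable)
    show "(\<lambda>(u, t). Im (E u t)) \<in> borel_measurable (lborel \<Otimes>\<^sub>M lborel)" by measurable
    show "AE u in lborel. integrable lborel (\<lambda>t. case (u, t) of (u, t) \<Rightarrow> Im (E u t))"
      using ImE by simp
    show "integrable lborel (\<lambda>u. \<integral>t. norm (case (u, t) of (u, t) \<Rightarrow> Im (E u t)) \<partial>lborel)"
    proof (rule integrable_dominated[OF kernel_bound[OF adm \<mu>]])
      fix u
      have "norm (\<integral>t. norm (case (u, t) of (u, t) \<Rightarrow> Im (E u t)) \<partial>lborel) = (\<integral>t. \<bar>Im (E u t)\<bar> \<partial>lborel)"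
        by simp
      also have "\<dots> \<le> (\<integral>t. norm (E u t) \<partial>lborel)"
        using ImE nEint by (intro integral_mono abs_Im_le_cmod) (auto simp: has_bochner_integral_iff)
      also have "\<dots> = norm (g (ray u)) / (\<mu> - exp u * cos \<theta>)"
        using nEint by (simp add: has_bochner_integral_iff)
      finally show "norm (\<integral>t. norm (case (u, t) of (u, t) \<Rightarrow> Im (E u t)) \<partial>lborel)
          \<le> norm (g (ray u)) / (\<mu> - exp u * cos \<theta>)" .
    qed measurable
  qed
  have inner: "(\<integral>u. Im (E u t) \<partial>lborel) = pi * (indicator {0<..} t * (exp (- \<mu> * t) * hankel g t))" for t
  proof -
    have "Im (E u t) = indicator {0<..} t * exp (- \<mu> * t) * Im (exp (of_real t * exp (ray u)) * g (ray u))" for u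
    proof -
      have "exp (- (of_real \<mu> - exp (ray u)) * of_real t) = of_real (exp (- \<mu> * t)) * exp (of_real t * exp (ray u))"
        by (simp add: exp_of_real[symmetric] exp_add[symmetric] algebra_simps)
      then have "E u t = (indicator {0<..} t * exp (- \<mu> * t)) *\<^sub>R (exp (of_real t * exp (ray u)) * g (ray u))"
        by (simp add: E_def scaleR_conv_of_real)
      then show ?thesis by (simp only: scaleR_complex.simps)
    qed
    then show ?thesis by (simp add: hankel_def del: times_complex.simps)
  qed
  have "integrable lborel (\<lambda>t. \<integral>u. Im (E u t) \<partial>lborel)"
    using lborel_pair.integrable_snd[OF prod] .
  then have int: "integrable lborel (\<lambda>t. indicator {0<..} t * (exp (- \<mu> * t) * hankel g t))"
    unfolding inner by simp
  have "(\<integral>t. \<integral>u. Im (E u t) \<partial>lborel \<partial>lborel) = (\<integral>u. \<integral>t. Im (E u t) \<partial>lborel \<partial>lborel)"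
    using lborel_pair.Fubini_integral[OF prod] .
  also have "\<dots> = (\<integral>u. Im (g (ray u) / (of_real \<mu> - exp (ray u))) \<partial>lborel)"
  proof (rule Bochner_Integration.integral_cong[OF refl])
    fix u
    show "(\<integral>t. Im (E u t) \<partial>lborel) = Im (g (ray u) / (of_real \<mu> - exp (ray u)))"
      using has_bochner_integral_Im[OF E[of u]] by (simp only: has_bochner_integral_iff)
  qed
  also have "\<dots> = pi * Re (g (of_real (ln \<mu>))) / \<mu>"
    by (rule hankel_residue[OF adm \<mu>])
  finally have "pi * (\<integral>t. indicator {0<..} t * (exp (- \<mu> * t) * hankel g t) \<partial>lborel)
      = pi * (Re (g (of_real (ln \<mu>))) / \<mu>)"
    unfolding inner by simp
  then have "(\<integral>t. indicator {0<..} t * (exp (- \<mu> * t) * hankel g t) \<partial>lborel) = Re (g (of_real (ln \<mu>))) / \<mu>"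
    by (rule mult_left_cancel[OF pi_neq_zero, THEN iffD1])
  with int show ?thesis by (simp add: has_bochner_integral_iff)
qed

end

section \<open>The Laplace exponent on the strip and its growth\<close>

locale telegraph_strip = hankel_strip +
  fixes \<nu> lam :: real
  assumes \<nu>: "0 < \<nu>" and \<nu>\<omega>: "2 * \<nu> * \<omega> \<le> pi / 2" and lam: "lam > 0"
begin

definition Phi :: "complex \<Rightarrow> complex" where
  "Phi w = exp (of_real (2 * \<nu>) * w) + of_real (2 * lam) * exp (of_real \<nu> * w)"

definition phi :: "real \<Rightarrow> real" where
  "phi \<mu> = \<mu> powr (2 * \<nu>) + 2 * lam * \<mu> powr \<nu>"

text \<open>Both exponents \<nu> and 2\<nu> lie in the interval from \<kappa> to 1 - \<kappa>, so
  \<kappa> is a decay rate for either power of exp w, at both ends of the strip, relative to 1 + exp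
  (Re w).\<close>

definition \<kappa> :: real where
  "\<kappa> = min \<nu> (1 - 2 * \<nu>)"

lemma \<nu>_half: "\<nu> < 1 / 2"
proof -
  have "\<nu> * (pi / 2) < \<nu> * \<omega>" using \<nu> angles by (intro mult_strict_left_mono) auto
  then have "\<nu> * pi < 1 / 2 * pi" using \<nu>\<omega> by linarith
  then show ?thesis by (simp only: mult_less_cancel_right_pos[OF pi_gt_zero])
qed

lemma \<kappa>: "\<kappa> > 0" "\<kappa> \<le> \<nu>" "\<kappa> \<le> 1 - 2 * \<nu>"
  using \<nu> \<nu>_half by (auto simp: \<kappa>_def)

lemma phi_pos: "\<mu> > 0 \<Longrightarrow> phi \<mu> > 0"
  using lam by (simp add: phi_def add_pos_pos)

lemma Phi_holomorphic [holomorphic_intros]: "Phi holomorphic_on A"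
  unfolding Phi_def[abs_def] by (intro holomorphic_intros)

lemma Phi_continuous: "continuous_on A Phi"
  by (rule holomorphic_on_imp_continuous_on[OF Phi_holomorphic])

lemma Phi_cnj: "Phi (cnj w) = cnj (Phi w)"
proof -
  have "exp (of_real c * cnj w) = cnj (exp (of_real c * w))" for c :: real
    by (simp add: exp_cnj)
  then show ?thesis by (simp add: Phi_def del: of_real_mult)
qed

lemma exp_of_real_mult_ln: "\<mu> > 0 \<Longrightarrow> exp (of_real c * complex_of_real (ln \<mu>)) = of_real (\<mu> powr c)"
  by (simp add: powr_def exp_of_real[symmetric])

lemma Phi_ln: "\<mu> > 0 \<Longrightarrow> Phi (of_real (ln \<mu>)) = of_real (phi \<mu>)"
  unfolding Phi_def phi_def exp_of_real_mult_ln by simp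

text \<open>In the strip the argument 2\<nu> Im w stays within pi/2, so the leading term has
  nonnegative real part and the lower-order term gives the bound. Its argument is at most pi/4,
  below pi/3, so its cosine is at least 1/2; this halves the coefficient 2
  \<open>lam\<close>.\<close>

lemma Re_Phi_ge:
  assumes "w \<in> strip"
  shows "lam * exp (\<nu> * Re w) \<le> Re (Phi w)"
proof -
  have Im: "\<bar>Im w\<bar> < \<omega>" using assms by (simp add: strip_def)
  have 1: "\<bar>2 * \<nu> * Im w\<bar> \<le> pi / 2"
  proof -
    have "2 * \<nu> * \<bar>Im w\<bar> \<le> 2 * \<nu> * \<omega>" using Im \<nu> by (intro mult_left_mono) auto
    moreover have "\<bar>2 * \<nu> * Im w\<bar> = 2 * \<nu> * \<bar>Im w\<bar>" using \<nu> by (simp add: abs_mult)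
    ultimately show ?thesis using \<nu>\<omega> by linarith
  qed
  then have c2: "0 \<le> cos (2 * \<nu> * Im w)" by (intro cos_ge_zero) auto
  have c1: "1 / 2 \<le> cos (\<nu> * Im w)"
  proof -
    have "cos (pi / 3) \<le> cos \<bar>\<nu> * Im w\<bar>"
    proof (rule cos_monotone_0_pi_le)
      have "\<bar>2 * \<nu> * Im w\<bar> = 2 * \<bar>\<nu> * Im w\<bar>" by (simp add: abs_mult)
      then show "\<bar>\<nu> * Im w\<bar> \<le> pi / 3" using 1 pi_gt_zero by linarith
    qed auto
    then show ?thesis by (simp add: cos_60)
  qed
  have "Re (Phi w) = exp (2 * \<nu> * Re w) * cos (2 * \<nu> * Im w) + 2 * lam * (exp (\<nu> * Re w) * cos (\<nu> * Im w))"
    by (simp add: Phi_def Re_exp)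
  moreover have "0 \<le> exp (2 * \<nu> * Re w) * cos (2 * \<nu> * Im w)" using c2 by simp
  moreover have "2 * lam * (exp (\<nu> * Re w) * (1 / 2)) \<le> 2 * lam * (exp (\<nu> * Re w) * cos (\<nu> * Im w))"
    using c1 lam by (intro mult_left_mono) auto
  ultimately show ?thesis by simp
qed

lemma Re_Phi_pos: "w \<in> strip \<Longrightarrow> 0 < Re (Phi w)"
  by (rule less_le_trans[OF _ Re_Phi_ge]) (use lam in simp_all)

lemma norm_Phi_le_exp: "norm (Phi w) \<le> exp (2 * \<nu> * Re w) + 2 * lam * exp (\<nu> * Re w)"
  unfolding Phi_def
  by (rule order_trans[OF norm_triangle_ineq]) (use lam in \<open>simp add: norm_mult\<close>)

lemma norm_Phi_le: "norm (Phi w) \<le> (1 + 2 * lam) * exp (- \<kappa> * \<bar>Re w\<bar>) * (1 + exp (Re w))"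
proof -
  have gen: "exp (a * u) \<le> exp (- \<kappa> * \<bar>u\<bar>) * (1 + exp u)" if "\<kappa> \<le> a" "a \<le> 1 - \<kappa>" for a u
  proof (cases "u \<ge> 0")
    case True
    have "a * u \<le> (1 - \<kappa>) * u" using that True by (intro mult_right_mono) auto
    then have "exp (a * u) \<le> exp (- \<kappa> * \<bar>u\<bar>) * exp u"
      using True by (simp add: exp_add[symmetric] algebra_simps)
    also have "\<dots> \<le> exp (- \<kappa> * \<bar>u\<bar>) * (1 + exp u)" by (intro mult_left_mono) auto
    finally show ?thesis .
  next
    case False
    have "a * u \<le> \<kappa> * u" using that False by (intro mult_right_mono_neg) auto
    then have "exp (a * u) \<le> exp (- \<kappa> * \<bar>u\<bar>) * 1"
      using False by simp
    also have "\<dots> \<le> exp (- \<kappa> * \<bar>u\<bar>) * (1 + exp u)" by (intro mult_left_mono) auto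
    finally show ?thesis .
  qed
  have g: "exp (2 * \<nu> * Re w) \<le> exp (- \<kappa> * \<bar>Re w\<bar>) * (1 + exp (Re w))"
    "exp (\<nu> * Re w) \<le> exp (- \<kappa> * \<bar>Re w\<bar>) * (1 + exp (Re w))"
    by (rule gen; use \<kappa> \<nu> in linarith)+
  have "norm (Phi w) \<le> exp (2 * \<nu> * Re w) + 2 * lam * exp (\<nu> * Re w)"
    by (rule norm_Phi_le_exp)
  also have "\<dots> \<le> exp (- \<kappa> * \<bar>Re w\<bar>) * (1 + exp (Re w)) + 2 * lam * (exp (- \<kappa> * \<bar>Re w\<bar>) * (1 + exp (Re w)))"
    using lam g by (intro add_mono mult_left_mono) simp_all
  finally show ?thesis by (simp add: algebra_simps)
qed

text \<open>Comparison with \<open>Phi\<close> suffices because \<open>Phi\<close> itself has the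
  growth of an admissible function; the density at x \<ge> 0, the distribution function and the
  resolvent are all treated this way.\<close>

lemma admissibleI_Phi:
  assumes "g holomorphic_on strip" "\<And>w. w \<in> strip \<Longrightarrow> g (cnj w) = cnj (g w)"
    and "\<And>w. w \<in> strip \<Longrightarrow> norm (g w) \<le> c * norm (Phi w)" and "c \<ge> 0"
  shows "admissible g"
  unfolding admissible_def
proof (intro conjI ballI exI)
  show "\<kappa> > 0" by (rule \<kappa>)
  fix w assume w: "w \<in> strip"
  have "norm (g w) \<le> c * ((1 + 2 * lam) * exp (- \<kappa> * \<bar>Re w\<bar>) * (1 + exp (Re w)))"
    by (rule order_trans[OF assms(3)[OF w] mult_left_mono[OF norm_Phi_le assms(4)]])
  then show "norm (g w) \<le> (c * (1 + 2 * lam)) * exp (- \<kappa> * \<bar>Re w\<bar>) * (1 + exp (Re w))"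
    by (simp only: mult.assoc)
qed (use assms(1,2) in blast)+

lemma cnj_exp_Phi: "exp (- of_real x * cnj (Phi w)) = cnj (exp (- of_real x * Phi w))"
  by (simp add: exp_cnj)

lemma norm_exp_Phi_le: "x \<ge> 0 \<Longrightarrow> w \<in> strip \<Longrightarrow> norm (exp (- of_real x * Phi w)) \<le> 1"
  using Re_Phi_pos[of w] by (simp add: mult_nonneg_nonneg)

lemma admissible_dens:
  assumes "x \<ge> 0"
  shows "admissible (\<lambda>w. Phi w * exp (- of_real x * Phi w))"
proof (rule admissibleI_Phi[where c = 1])
  show "(\<lambda>w. Phi w * exp (- of_real x * Phi w)) holomorphic_on strip" by (intro holomorphic_intros)
  show "norm (Phi w * exp (- of_real x * Phi w)) \<le> 1 * norm (Phi w)" if "w \<in> strip" for w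
    using mult_left_mono[OF norm_exp_Phi_le[OF assms that], of "norm (Phi w)"] by (simp add: norm_mult)
qed (simp_all add: Phi_cnj exp_cnj)

text \<open>Subtracting from 1 matters: \<open>exp (- x * Phi w)\<close> tends to 1 as Re w tends to
  minus infinity and has no decay there, whereas the difference is of the order of
  \<open>Phi\<close>.\<close>

lemma admissible_cdf:
  assumes "x \<ge> 0"
  shows "admissible (\<lambda>w. 1 - exp (- of_real x * Phi w))"
proof (rule admissibleI_Phi[where c = x])
  show "(\<lambda>w. 1 - exp (- of_real x * Phi w)) holomorphic_on strip" by (intro holomorphic_intros)
  show "norm (1 - exp (- of_real x * Phi w)) \<le> x * norm (Phi w)" if "w \<in> strip" for w
    using norm_exp_diff_le[of "Phi w" x 0] Re_Phi_pos[OF that] assms by simp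
qed (use assms in \<open>simp_all add: Phi_cnj exp_cnj\<close>)

lemma norm_add_Phi_ge:
  assumes "\<gamma> > 0" "w \<in> strip"
  shows "\<gamma> \<le> norm (of_real \<gamma> + Phi w)"
  using complex_Re_le_cmod[of "of_real \<gamma> + Phi w"] Re_Phi_pos[OF assms(2)] by simp

lemma admissible_resolvent:
  assumes "\<gamma> > 0"
  shows "admissible (\<lambda>w. Phi w / (of_real \<gamma> + Phi w))"
proof (rule admissibleI_Phi[where c = "1 / \<gamma>"])
  have nz: "of_real \<gamma> + Phi w \<noteq> 0" if "w \<in> strip" for w
    using norm_add_Phi_ge[OF assms that] assms by auto
  show "(\<lambda>w. Phi w / (of_real \<gamma> + Phi w)) holomorphic_on strip"
    using nz by (intro holomorphic_intros) auto
  show "norm (Phi w / (of_real \<gamma> + Phi w)) \<le> 1 / \<gamma> * norm (Phi w)" if "w \<in> strip" for w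
    using frac_le[OF norm_ge_zero order_refl assms norm_add_Phi_ge[OF assms that]] 
    by (simp add: norm_divide)
qed (use assms in \<open>simp_all add: Phi_cnj\<close>)

lemma tame_Phi: "tame Phi"
  using admissible_tame[OF admissible_dens[of 0]] by simp

text \<open>The square grows like exp (4 \<nu> Re w), and 4\<nu> can exceed 1, so an admissible
  bound may fail. This is the reason for the square of 1 + exp u in \<open>tame\<close>.\<close>

lemma tame_Phi_sq: "tame (\<lambda>w. (Phi w)\<^sup>2)"
  unfolding tame_def
proof (intro conjI exI allI)
  show "continuous_on strip (\<lambda>w. (Phi w)\<^sup>2)"
    by (intro continuous_intros Phi_continuous)
  show "2 * \<kappa> > 0" using \<kappa> by simp
  fix u
  have "norm ((Phi (ray u))\<^sup>2) \<le> ((1 + 2 * lam) * exp (- \<kappa> * \<bar>u\<bar>) * (1 + exp u))\<^sup>2"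
    unfolding norm_power using norm_Phi_le[of "ray u"] by (intro power_mono) auto
  also have "\<dots> = (1 + 2 * lam)\<^sup>2 * exp (- (2 * \<kappa>) * \<bar>u\<bar>) * (1 + exp u)\<^sup>2"
    by (simp add: power_mult_distrib exp_double[symmetric] mult.assoc)
  finally show "norm ((Phi (ray u))\<^sup>2) \<le> (1 + 2 * lam)\<^sup>2 * exp (- (2 * \<kappa>) * \<bar>u\<bar>) * (1 + exp u)\<^sup>2" .
qed

text \<open>For Re w \<ge> 0 the real part of \<open>Phi\<close> grows exponentially, and with x > 0
  the last factor beats every power of exp w; for Re w < 0 the factor \<open>Phi\<close> gives the
  decay.\<close>

lemma exp_Phi_decay:
  assumes "x > 0" "0 \<le> a" "a \<le> 1"
  shows "\<exists>C. \<forall>w\<in>strip. norm (exp (of_real a * w) * Phi w * exp (- of_real x * Phi w)) \<le> C * exp (- \<nu> * \<bar>Re w\<bar>)"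
proof -
  \<comment> \<open>With n \<nu> \<ge> 3 the exponent 2 u - n \<nu> u is at most - u, and so at most
    - \<nu> u.\<close>
  obtain n :: nat where n: "3 / \<nu> < real n" using reals_Archimedean2[of "3 / \<nu>"] by blast
  then have n3: "3 \<le> real n * \<nu>" using \<nu> by (simp add: field_simps)
  have n0: "n > 0" using n3 by (cases n) auto
  define c where "c = (real n / (x * lam)) ^ n"
  have c: "c > 0" using assms lam n0 by (simp add: c_def)
  have big: "exp (2 * u) * exp (- (x * lam) * exp (\<nu> * u)) \<le> c * exp (- \<nu> * u)" if "u \<ge> 0" for u
  proof -
    define s where "s = x * lam * exp (\<nu> * u)"
    have s: "s > 0" using assms lam by (simp add: s_def)
    \<comment> \<open>Polynomial lower bound for exp s, from (1 + s / n) ^ n \<le> exp s; inverted,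
      it bounds exp (- s) by a power of 1 / s.\<close>
    have "(s / real n) ^ n \<le> (1 + s / real n) ^ n"
      using s by (intro power_mono) auto
    also have "\<dots> \<le> exp s"
      using s n0 by (intro exp_ge_one_plus_x_over_n_power_n) auto
    finally have "inverse (exp s) \<le> inverse ((s / real n) ^ n)"
      using s n0 by (intro le_imp_inverse_le) auto
    then have "exp (- s) \<le> (real n / s) ^ n"
      by (simp only: exp_minus power_inverse[symmetric] inverse_divide)
    also have "(real n / s) ^ n = c * exp (- (real n * \<nu> * u))"
    proof -
      have 1: "real n / s = real n / (x * lam) * exp (- (\<nu> * u))"
        by (simp add: s_def exp_minus divide_inverse)
      have "exp (- (\<nu> * u)) ^ n = exp (real n * (- (\<nu> * u)))"
        by (rule exp_of_nat_mult[symmetric])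
      then show ?thesis
        unfolding 1 power_mult_distrib c_def by (simp add: mult.assoc)
    qed
    finally have "exp (- s) \<le> c * exp (- (real n * \<nu> * u))" .
    then have "exp (2 * u) * exp (- s) \<le> exp (2 * u) * (c * exp (- (real n * \<nu> * u)))"
      by (intro mult_left_mono) auto
    also have "\<dots> = c * exp (2 * u - real n * \<nu> * u)"
      by (simp add: mult.left_commute exp_add[symmetric])
    also have "\<dots> \<le> c * exp (- \<nu> * u)"
    proof (intro mult_left_mono)
      have "2 * u - real n * \<nu> * u \<le> 2 * u - 3 * u"
        using mult_right_mono[OF n3 that] by simp
      also have "\<dots> \<le> - \<nu> * u" using mult_right_mono[of \<nu> 1 u] \<nu>_half that by simp
      finally show "exp (2 * u - real n * \<nu> * u) \<le> exp (- \<nu> * u)" by simp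
    qed (use c in simp)
    finally show ?thesis by (simp add: s_def mult.assoc)
  qed
  show ?thesis
  proof (intro exI ballI)
    fix w assume w: "w \<in> strip"
    define u where "u = Re w"
    have e: "norm (exp (- of_real x * Phi w)) \<le> exp (- (x * lam) * exp (\<nu> * u))"
      using mult_left_mono[OF Re_Phi_ge[OF w], of x] assms by (simp add: u_def mult.assoc)
    have "norm (exp (of_real a * w) * Phi w * exp (- of_real x * Phi w)) \<le>
        exp (a * u) * (exp (2 * \<nu> * u) + 2 * lam * exp (\<nu> * u)) * exp (- (x * lam) * exp (\<nu> * u))"
      unfolding norm_mult using norm_Phi_le_exp[of w] e lam
      by (intro mult_mono) (auto simp: u_def)
    also have "\<dots> \<le> (1 + 2 * lam) * (1 + c) * exp (- \<nu> * \<bar>u\<bar>)"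
    proof (cases "u \<ge> 0")
      case True
      have le: "exp (b * u) \<le> exp u" if "b \<le> 1" for b
        using mult_right_mono[OF that True] by simp
      have "exp (a * u) * (exp (2 * \<nu> * u) + 2 * lam * exp (\<nu> * u)) \<le> exp u * (exp u + 2 * lam * exp u)"
        using assms \<nu>_half \<nu> lam by (intro mult_mono add_mono mult_left_mono le) auto
      also have "\<dots> = (1 + 2 * lam) * exp (2 * u)"
        unfolding exp_double power2_eq_square by (simp add: algebra_simps)
      finally have "exp (a * u) * (exp (2 * \<nu> * u) + 2 * lam * exp (\<nu> * u)) * exp (- (x * lam) * exp (\<nu> * u))
          \<le> (1 + 2 * lam) * exp (2 * u) * exp (- (x * lam) * exp (\<nu> * u))"
        by (intro mult_right_mono) auto
      also have "\<dots> \<le> (1 + 2 * lam) * (c * exp (- \<nu> * u))"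
        using mult_left_mono[OF big[OF True], of "1 + 2 * lam"] lam by (simp add: mult.assoc)
      also have "\<dots> \<le> (1 + 2 * lam) * ((1 + c) * exp (- \<nu> * u))"
        using lam by (intro mult_left_mono mult_right_mono) auto
      finally show ?thesis using True by (simp add: mult.assoc)
    next
      case False
      have "exp (a * u) * (exp (2 * \<nu> * u) + 2 * lam * exp (\<nu> * u)) * exp (- (x * lam) * exp (\<nu> * u))
          \<le> 1 * (exp (\<nu> * u) + 2 * lam * exp (\<nu> * u)) * 1"
      proof (intro mult_mono add_mono mult_left_mono)
        show "exp (a * u) \<le> 1" using False assms by (simp add: mult_nonneg_nonpos)
        show "exp (2 * \<nu> * u) \<le> exp (\<nu> * u)" using False \<nu> by (simp add: mult_le_cancel_right)
        show "exp (- (x * lam) * exp (\<nu> * u)) \<le> 1" using assms lam by simp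
      qed (use lam in auto)
      also have "\<dots> = (1 + 2 * lam) * 1 * exp (- \<nu> * \<bar>u\<bar>)"
        using False by (simp add: algebra_simps)
      also have "\<dots> \<le> (1 + 2 * lam) * (1 + c) * exp (- \<nu> * \<bar>u\<bar>)"
        using lam c by (intro mult_right_mono mult_left_mono) auto
      finally show ?thesis .
    qed
    finally show "norm (exp (of_real a * w) * Phi w * exp (- of_real x * Phi w))
       \<le> (1 + 2 * lam) * (1 + c) * exp (- \<nu> * \<bar>Re w\<bar>)" by (simp add: u_def)
  qed
qed

lemma admissible_fractional:
  assumes "x > 0" "0 \<le> a" "a \<le> 1"
  shows "admissible (\<lambda>w. exp (of_real a * w) * Phi w * exp (- of_real x * Phi w))"
  unfolding admissible_def
proof (intro conjI ballI)
  show "(\<lambda>w. exp (of_real a * w) * Phi w * exp (- of_real x * Phi w)) holomorphic_on strip"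
    by (intro holomorphic_intros)
  fix w assume "w \<in> strip"
  have "exp (of_real a * cnj w) = cnj (exp (of_real a * w))" by (simp add: exp_cnj)
  then show "exp (of_real a * cnj w) * Phi (cnj w) * exp (- of_real x * Phi (cnj w)) =
     cnj (exp (of_real a * w) * Phi w * exp (- of_real x * Phi w))"
    by (simp only: cnj_exp_Phi Phi_cnj complex_cnj_mult)
next
  obtain C where C: "\<And>w. w \<in> strip \<Longrightarrow>
      norm (exp (of_real a * w) * Phi w * exp (- of_real x * Phi w)) \<le> C * exp (- \<nu> * \<bar>Re w\<bar>)"
    using exp_Phi_decay[OF assms] by blast
  have C0: "0 \<le> C" using order_trans[OF norm_ge_zero C[of "ray 0"]] by simp
  have "norm (exp (of_real a * w) * Phi w * exp (- of_real x * Phi w)) \<le> C * exp (- \<nu> * \<bar>Re w\<bar>) * (1 + exp (Re w))"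
    if "w \<in> strip" for w
  proof -
    have "C * exp (- \<nu> * \<bar>Re w\<bar>) * 1 \<le> C * exp (- \<nu> * \<bar>Re w\<bar>) * (1 + exp (Re w))"
      using C0 by (intro mult_left_mono) auto
    with C[OF that] show ?thesis by simp
  qed
  with \<nu> show "\<exists>C k. k > 0 \<and> (\<forall>w\<in>strip. norm (exp (of_real a * w) * Phi w * exp (- of_real x * Phi w))
      \<le> C * exp (- k * \<bar>Re w\<bar>) * (1 + exp (Re w)))"
    by blast
qed

text \<open>For x > 0 the integrand decays at both ends without help from \<open>exp (t z)\<close>,
  so the estimate is uniform in t. The values a = 0, \<nu>, 2\<nu> are the ones used: the density
  and its two fractional derivatives.\<close>

lemma hankel_fractional_bounded:
  assumes "x > 0" "0 \<le> a" "a \<le> 1"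
  shows "\<exists>B. \<forall>t\<ge>0. \<bar>hankel (\<lambda>w. exp (of_real a * w) * Phi w * exp (- of_real x * Phi w)) t\<bar> \<le> B"
proof -
  obtain C where C: "\<And>w. w \<in> strip \<Longrightarrow>
      norm (exp (of_real a * w) * Phi w * exp (- of_real x * Phi w)) \<le> C * exp (- \<nu> * \<bar>Re w\<bar>)"
    using exp_Phi_decay[OF assms] by blast
  show ?thesis
    by (rule hankel_bounded[OF _ \<nu>, where C = C])
       (use C[of "ray _"] in \<open>auto intro!: continuous_intros Phi_continuous\<close>)
qed

end

section \<open>Abel integrals\<close>

text \<open>For 0 \<le> a < 1 this is Gamma (1 - a) times the Riemann-Liouville integral of order 1
  - a. The case a = 0 is the ordinary primitive, which puts both sides of the later comparison under
  the same lemmas.\<close>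

definition abel_integral :: "real \<Rightarrow> (real \<Rightarrow> real) \<Rightarrow> real \<Rightarrow> real" where
  "abel_integral a f t = (\<integral>s. indicator {0<..<t} s * (f s / (t - s) powr a) \<partial>lborel)"

lemma integrable_powr_singularity:
  fixes a T :: real
  assumes "a < 1"
  shows "integrable lborel (\<lambda>r. indicator {0<..<T} r * (1 / r powr a))"
proof (rule integrable_dominated)
  show "integrable lborel (\<lambda>r. exp T * (indicator {0<..} r * (exp (- 1 * r) * r powr (- a))))"
    using exp_powr_integral[of "- a" 1] assms by (simp add: has_bochner_integral_iff)
  fix r :: real
  have "1 / r powr a \<le> exp T * (exp (- r) * r powr (- a))" if "0 < r" "r < T"
  proof -
    have "1 * r powr (- a) \<le> exp (T - r) * r powr (- a)"
      using that by (intro mult_right_mono) auto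
    then show ?thesis by (simp add: exp_diff exp_minus powr_minus field_simps)
  qed
  then show "norm (indicator {0<..<T} r * (1 / r powr a))
      \<le> exp T * (indicator {0<..} r * (exp (- 1 * r) * r powr (- a)))"
    by (auto simp: indicator_def)
qed measurable

lemma borel_measurable_indicator_cont:
  fixes f :: "real \<Rightarrow> real"
  assumes "continuous_on {0<..} f"
  shows "(\<lambda>s. indicator {0<..} s * f s) \<in> borel_measurable borel"
  using borel_measurable_continuous_on_indicator[OF _ assms] by simp

context
  fixes f :: "real \<Rightarrow> real" and B a :: real
  assumes cont: "continuous_on {0<..} f" and bound: "\<And>t. t > 0 \<Longrightarrow> \<bar>f t\<bar> \<le> B"
    and a: "0 \<le> a" "a < 1"
begin

lemma abel_bound_nonneg: "0 \<le> B"
  using bound[of 1] by simp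

lemma abel_measurable:
  "(\<lambda>(s, t). indicator {0<..<t} s * (f s / (t - s) powr a)) \<in> borel_measurable (borel \<Otimes>\<^sub>M borel)"
proof -
  note [measurable] = borel_measurable_indicator_cont[OF cont]
  have "(\<lambda>(s, t). indicator {0<..<t} s * (f s / (t - s) powr a))
      = (\<lambda>(s, t). indicator {0<..} (t - s) * ((indicator {0<..} s * f s) / (t - s) powr a))"
    by (auto simp: indicator_def fun_eq_iff)
  also have "\<dots> \<in> borel_measurable (borel \<Otimes>\<^sub>M borel)"
    by measurable
  finally show ?thesis .
qed

text \<open>Moves the singularity from the moving end point s = t to the fixed point r = 0, so that
  one majorant serves all t near a given time.\<close>

lemma abel_reflect:
  "abel_integral a f t = (\<integral>r. indicator {0<..<t} r * (f (t - r) / r powr a) \<partial>lborel)"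
proof -
  have "indicator {0<..<t} (t - r) = (indicator {0<..<t} r :: real)" for r
    by (auto simp: indicator_def)
  then show ?thesis
    unfolding abel_integral_def by (subst lborel_integral_real_affine[of "-1" _ t]) simp_all
qed

lemma abel_integrable:
  "integrable lborel (\<lambda>s. indicator {0<..<t} s * (f s / (t - s) powr a))"
proof -
  have "integrable lborel (\<lambda>s. indicator {0<..<t} (t + (-1) * s) * (1 / (t + (-1) * s) powr a))"
    using lborel_integrable_real_affine[OF integrable_powr_singularity[OF a(2), of t], of "-1" t] by simp
  then have i: "integrable lborel (\<lambda>s. B * (indicator {0<..<t} (t + (-1) * s) * (1 / (t + (-1) * s) powr a)))"
    by (rule integrable_mult_right)
  show ?thesis
  proof (rule integrable_dominated[OF i])
    show "(\<lambda>s. indicator {0<..<t} s * (f s / (t - s) powr a)) \<in> borel_measurable lborel"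
      using measurable_compose[OF _ abel_measurable, of "\<lambda>s. (s, t)" lborel] by simp
    show "norm (indicator {0<..<t} s * (f s / (t - s) powr a))
        \<le> B * (indicator {0<..<t} (t + (-1) * s) * (1 / (t + (-1) * s) powr a))" for s
      using bound[of s] by (auto simp: indicator_def divide_right_mono)
  qed
qed

lemma abel_continuous: "continuous_on {0<..} (abel_integral a f)"
proof -
  have "isCont (abel_integral a f) t0" if t0: "t0 > 0" for t0
  proof -
    have m: "(\<lambda>r. indicator {0<..<t} r * (f (t - r) / r powr a)) \<in> borel_measurable lborel" for t
    proof -
      note [measurable] = borel_measurable_indicator_cont[OF cont]
      have "(\<lambda>r. indicator {0<..<t} r * (f (t - r) / r powr a))
          = (\<lambda>r. indicator {0<..} r * ((indicator {0<..} (t - r) * f (t - r)) / r powr a))"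
        by (auto simp: indicator_def fun_eq_iff)
      also have "\<dots> \<in> borel_measurable lborel" by measurable
      finally show ?thesis .
    qed
    have "((\<lambda>t. \<integral>r. indicator {0<..<t} r * (f (t - r) / r powr a) \<partial>lborel) \<longlongrightarrow>
        (\<integral>r. indicator {0<..<t0} r * (f (t0 - r) / r powr a) \<partial>lborel)) (at t0 within {0<..<2 * t0})"
    proof (rule tendsto_lebesgue_at_within)
      show "(\<lambda>r. indicator {0<..<t} r * (f (t - r) / r powr a)) \<in> borel_measurable lborel" for t
        by (rule m)
      show "(\<lambda>r. indicator {0<..<t0} r * (f (t0 - r) / r powr a)) \<in> borel_measurable lborel"
        by (rule m)
      show "integrable lborel (\<lambda>r. B * (indicator {0<..<2 * t0} r * (1 / r powr a)))"
        by (intro integrable_mult_right integrable_powr_singularity a)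
      show "norm (indicator {0<..<t} r * (f (t - r) / r powr a)) \<le> B * (indicator {0<..<2 * t0} r * (1 / r powr a))"
        if "t \<in> {0<..<2 * t0}" for t r
        using bound[of "t - r"] that abel_bound_nonneg by (auto simp: indicator_def divide_right_mono)
      show "AE r in lborel. ((\<lambda>t. indicator {0<..<t} r * (f (t - r) / r powr a)) \<longlongrightarrow>
          indicator {0<..<t0} r * (f (t0 - r) / r powr a)) (at t0 within {0<..<2 * t0})"
        \<comment> \<open>Pointwise convergence of the integrand can fail at r = t0, where the
          indicator jumps; that single point is a null set.\<close>
        using AE_lborel_singleton[of t0]
      proof eventually_elim
        fix r assume "r \<noteq> t0"
        then consider "r \<le> 0" | "0 < r" "r < t0" | "t0 < r" by linarith
        then show "((\<lambda>t. indicator {0<..<t} r * (f (t - r) / r powr a)) \<longlongrightarrow>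
          indicator {0<..<t0} r * (f (t0 - r) / r powr a)) (at t0 within {0<..<2 * t0})"
        proof cases
          case 2
          have "isCont f (t0 - r)"
            using cont 2 by (simp add: continuous_on_eq_continuous_at)
          moreover have "((\<lambda>t. t - r) \<longlongrightarrow> t0 - r) (at t0 within {0<..<2 * t0})"
            by (intro tendsto_intros)
          ultimately have "((\<lambda>t. f (t - r) / r powr a) \<longlongrightarrow> f (t0 - r) / r powr a) (at t0 within {0<..<2 * t0})"
            using 2 by (intro tendsto_divide tendsto_const isCont_tendsto_compose[of _ f]) auto
          moreover have "\<forall>\<^sub>F t in at t0 within {0<..<2 * t0}. f (t - r) / r powr a = indicator {0<..<t} r * (f (t - r) / r powr a)"
            using order_tendstoD(1)[OF tendsto_ident_at 2(2)] by eventually_elim (use 2 in simp)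
          ultimately have "((\<lambda>t. indicator {0<..<t} r * (f (t - r) / r powr a)) \<longlongrightarrow> f (t0 - r) / r powr a) (at t0 within {0<..<2 * t0})"
            by (rule Lim_transform_eventually)
          then show ?thesis using 2 by simp
        next
          case 3
          have "\<forall>\<^sub>F t in at t0 within {0<..<2 * t0}. indicator {0<..<t} r * (f (t - r) / r powr a) = 0"
            using order_tendstoD(2)[OF tendsto_ident_at 3] by eventually_elim simp
          then show ?thesis using 3 by (simp add: tendsto_eventually)
        qed simp
      qed
    qed
    then have "(abel_integral a f \<longlongrightarrow> abel_integral a f t0) (at t0 within {0<..<2 * t0})"
      unfolding abel_reflect[symmetric] .
    moreover have "at t0 within {0<..<2 * t0} = at t0"
      using t0 by (intro at_within_open) auto
    ultimately show ?thesis by (simp only: isCont_def)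
  qed
  then show ?thesis
    by (intro continuous_at_imp_continuous_on ballI) (simp only: greaterThan_iff)
qed

text \<open>A convolution with r powr (- a): Fubini and a shift in t separate the two factors, and
  the absolute integrability of the weighted f makes the double integral absolutely
  convergent.\<close>

lemma abel_laplace:
  assumes F: "has_bochner_integral lborel (\<lambda>t. indicator {0<..} t * (exp (- \<mu> * t) * f t)) F" and \<mu>: "\<mu> > 0"
  shows "has_bochner_integral lborel (\<lambda>t. indicator {0<..} t * (exp (- \<mu> * t) * abel_integral a f t))
           (F * (Gamma (1 - a) / \<mu> powr (1 - a)))"
proof -
  define G where "G = Gamma (1 - a) / \<mu> powr (1 - a)"
  define E where "E = (\<lambda>s t. exp (- \<mu> * t) * (indicator {0<..<t} s * (f s / (t - s) powr a)))"
  note [measurable] = abel_measurable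
  have [measurable]: "case_prod E \<in> borel_measurable (lborel \<Otimes>\<^sub>M lborel)"
  proof -
    have "(\<lambda>p. exp (- \<mu> * snd p) * (case p of (s, t) \<Rightarrow> indicator {0<..<t} s * (f s / (t - s) powr a)))
        \<in> borel_measurable (borel \<Otimes>\<^sub>M borel)"
      by measurable
    then show ?thesis
      by (simp add: E_def case_prod_unfold cong: measurable_cong_sets)
  qed
  have G: "G > 0" using a \<mu> by (simp add: G_def Gamma_real_pos)
  have K: "has_bochner_integral lborel (\<lambda>t. exp (- \<mu> * t) * (indicator {s<..} t * (1 / (t - s) powr a)))
      (exp (- \<mu> * s) * G)" for s
  proof -
    let ?h = "\<lambda>r. indicator {0<..} r * (exp (- \<mu> * r) * r powr (- a))"
    have "has_bochner_integral lborel ?h G"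
      using exp_powr_integral[of "- a" \<mu>] a \<mu> by (simp add: G_def add.commute)
    then have "has_bochner_integral lborel (\<lambda>t. ?h (- s + 1 * t)) (G /\<^sub>R \<bar>1\<bar>)"
      using lborel_has_bochner_integral_real_affine_iff[of 1 ?h G "- s"] by simp
    then have "has_bochner_integral lborel (\<lambda>t. exp (- \<mu> * s) * ?h (- s + 1 * t)) (exp (- \<mu> * s) * G)"
      by (intro has_bochner_integral_mult_right) simp
    moreover have "exp (- \<mu> * s) * ?h (- s + 1 * t) = exp (- \<mu> * t) * (indicator {s<..} t * (1 / (t - s) powr a))" for t
    proof -
      have "exp (- \<mu> * t) = exp (- \<mu> * s) * exp (- \<mu> * (t - s))"
        by (simp add: exp_add[symmetric] algebra_simps)
      then show ?thesis
        by (simp add: indicator_def powr_minus divide_inverse)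
    qed
    ultimately show ?thesis by simp
  qed
  have E: "E s t = (indicator {0<..} s * f s) * (exp (- \<mu> * t) * (indicator {s<..} t * (1 / (t - s) powr a)))" for s t
    by (auto simp: E_def indicator_def)
  have Eint: "has_bochner_integral lborel (E s) ((indicator {0<..} s * f s) * (exp (- \<mu> * s) * G))" for s
    unfolding E by (intro has_bochner_integral_mult_right K)
  have Enorm: "has_bochner_integral lborel (\<lambda>t. norm (E s t)) (\<bar>indicator {0<..} s * f s\<bar> * (exp (- \<mu> * s) * G))" for s
  proof -
    have "norm (E s t) = \<bar>indicator {0<..} s * f s\<bar> * (exp (- \<mu> * t) * (indicator {s<..} t * (1 / (t - s) powr a)))" for t
      unfolding E by (simp add: abs_mult)
    then show ?thesis by (simp only:) (intro has_bochner_integral_mult_right K)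
  qed
  have prod: "integrable (lborel \<Otimes>\<^sub>M lborel) (case_prod E)"
  proof (rule lborel_pair.Fubini_integrable)
    show "AE s in lborel. integrable lborel (\<lambda>t. case (s, t) of (s, t) \<Rightarrow> E s t)"
      using Eint by (auto simp: has_bochner_integral_iff)
    have "(\<integral>t. norm (case (s, t) of (s, t) \<Rightarrow> E s t) \<partial>lborel)
        = G * \<bar>indicator {0<..} s * (exp (- \<mu> * s) * f s)\<bar>" for s
      using Enorm[of s] by (simp add: has_bochner_integral_iff abs_mult mult_ac)
    moreover have "integrable lborel (\<lambda>s. G * \<bar>indicator {0<..} s * (exp (- \<mu> * s) * f s)\<bar>)"
      using F by (intro integrable_mult_right integrable_abs) (simp add: has_bochner_integral_iff)
    ultimately show "integrable lborel (\<lambda>s. \<integral>t. norm (case (s, t) of (s, t) \<Rightarrow> E s t) \<partial>lborel)"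
      by simp
  qed measurable
  have inner: "(\<integral>s. E s t \<partial>lborel) = indicator {0<..} t * (exp (- \<mu> * t) * abel_integral a f t)" for t
  proof (cases "t > 0")
    case False
    then have "E s t = 0" for s by (auto simp: E_def indicator_def)
    with False show ?thesis by simp
  next
    case True
    have "(\<integral>s. E s t \<partial>lborel) = exp (- \<mu> * t) * abel_integral a f t"
      unfolding E_def abel_integral_def by (rule integral_mult_right_zero)
    with True show ?thesis by simp
  qed
  have "integrable lborel (\<lambda>t. \<integral>s. E s t \<partial>lborel)"
    using lborel_pair.integrable_snd[OF prod] .
  moreover have "(\<integral>t. \<integral>s. E s t \<partial>lborel \<partial>lborel) = (\<integral>s. \<integral>t. E s t \<partial>lborel \<partial>lborel)"
    using lborel_pair.Fubini_integral[OF prod] .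
  moreover have "(\<integral>t. E s t \<partial>lborel) = G * (indicator {0<..} s * (exp (- \<mu> * s) * f s))" for s
    using Eint[of s] by (simp add: has_bochner_integral_iff mult_ac)
  moreover have "(\<integral>s. G * (indicator {0<..} s * (exp (- \<mu> * s) * f s)) \<partial>lborel) = G * F"
    using F by (simp add: has_bochner_integral_iff)
  ultimately show ?thesis
    unfolding inner by (simp add: has_bochner_integral_iff G_def mult.commute)
qed

end

text \<open>Near 0 the function f is known to be bounded, not continuous, so the primitive is split
  at t / 2: the first piece is constant in the upper limit and the second falls under the
  fundamental theorem on a compact interval.\<close>

lemma abel_integral_0_has_derivative:
  assumes cont: "continuous_on {0<..} f" and bound: "\<And>t. t > 0 \<Longrightarrow> \<bar>f t\<bar> \<le> B" and t: "t > 0"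
  shows "(abel_integral 0 f has_real_derivative f t) (at t)"
proof -
  define c where "c = t / 2"
  have c: "0 < c" "c < t" using t by (auto simp: c_def)
  have contc: "continuous_on {c..2 * t} f"
    by (rule continuous_on_subset[OF cont]) (use c in auto)
  have split: "abel_integral 0 f u = abel_integral 0 f c + integral {c..u} f" if u: "u \<in> {c<..<2 * t}" for u
  proof -
    have "continuous_on {c..u} f" using contc u by (auto intro: continuous_on_subset)
    then have si: "set_integrable lborel {c..u} f" by (rule borel_integrable_atLeastAtMost')
    \<comment> \<open>The closed interval from c to u contains the end point u, which the kernel
      omits; the last term removes it.\<close>
    have "indicator {0<..<u} s * (f s / (u - s) powr 0) =
        indicator {0<..<c} s * (f s / (c - s) powr 0) + indicator {c..u} s *\<^sub>R f s - indicator {u} s * f s" for s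
      using u c by (cases "s = u") (auto simp: indicator_def)
    then have "abel_integral 0 f u =
        (\<integral>s. indicator {0<..<c} s * (f s / (c - s) powr 0) + indicator {c..u} s *\<^sub>R f s - indicator {u} s * f s \<partial>lborel)"
      unfolding abel_integral_def by simp
    also have "\<dots> = (\<integral>s. indicator {0<..<c} s * (f s / (c - s) powr 0) + indicator {c..u} s *\<^sub>R f s \<partial>lborel)"
    proof (rule integral_cong_AE)
      show "AE s in lborel. indicator {0<..<c} s * (f s / (c - s) powr 0) + indicator {c..u} s *\<^sub>R f s - indicator {u} s * f s
         = indicator {0<..<c} s * (f s / (c - s) powr 0) + indicator {c..u} s *\<^sub>R f s"
        using AE_lborel_singleton[of u] by eventually_elim simp
    next
      have [measurable]: "(\<lambda>s. indicator {u} s * f s) \<in> borel_measurable lborel"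
      proof -
        have "(\<lambda>s. indicator {u} s * f s) = (\<lambda>s. indicator {u} s * f u)" by (auto simp: indicator_def)
        then show ?thesis by simp
      qed
      have [measurable]: "(\<lambda>s. indicator {0<..<c} s * (f s / (c - s) powr 0)) \<in> borel_measurable lborel"
        "(\<lambda>s. indicator {c..u} s *\<^sub>R f s) \<in> borel_measurable lborel"
        using abel_integrable[OF cont bound, of 0 c] si by (auto simp: set_integrable_def)
      show "(\<lambda>s. indicator {0<..<c} s * (f s / (c - s) powr 0) + indicator {c..u} s *\<^sub>R f s - indicator {u} s * f s) \<in> borel_measurable lborel"
        "(\<lambda>s. indicator {0<..<c} s * (f s / (c - s) powr 0) + indicator {c..u} s *\<^sub>R f s) \<in> borel_measurable lborel"
        by measurable
    qed
    also have "\<dots> = abel_integral 0 f c + (LBINT s:{c..u}. f s)"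
      unfolding abel_integral_def set_lebesgue_integral_def
      using abel_integrable[OF cont bound, of 0 c] si
      by (intro Bochner_Integration.integral_add) (auto simp: set_integrable_def)
    also have "(LBINT s:{c..u}. f s) = integral {c..u} f"
      using set_borel_integral_eq_integral(2)[OF si] by simp
    finally show ?thesis .
  qed
  have "((\<lambda>u. integral {c..u} f) has_real_derivative f t) (at t within {c..2 * t})"
    by (rule integral_has_real_derivative[OF contc]) (use c in auto)
  then have "((\<lambda>u. abel_integral 0 f c + integral {c..u} f) has_real_derivative 0 + f t) (at t within {c..2 * t})"
    by (rule DERIV_add[OF DERIV_const])
  moreover have "{c<..<2 * t} \<subseteq> {c..2 * t}" by auto
  ultimately have "((\<lambda>u. abel_integral 0 f c + integral {c..u} f) has_real_derivative 0 + f t) (at t within {c<..<2 * t})"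
    by (rule DERIV_subset)
  then have "((\<lambda>u. abel_integral 0 f c + integral {c..u} f) has_real_derivative f t) (at t)"
    using c by (subst (asm) at_within_open) simp_all
  then show ?thesis
    by (rule has_field_derivative_transform_within_open[of _ _ _ "{c<..<2 * t}"]) (use split c in auto)
qed

section \<open>The density and its equations\<close>

context telegraph_strip
begin

definition dens :: "real \<Rightarrow> real \<Rightarrow> real" where
  "dens x = hankel (\<lambda>w. Phi w * exp (- of_real x * Phi w))"

text \<open>Candidate for P(H(x) \<ge> t), which is also P(L(t) \<le> x): as a function of x for
  fixed t it is the distribution function of the inverse process.\<close>

definition cdf_fun :: "real \<Rightarrow> real \<Rightarrow> real" where
  "cdf_fun x = hankel (\<lambda>w. 1 - exp (- of_real x * Phi w))"

text \<open>The inserted factor is z^a at z = exp w; for 0 < a < 1 and x > 0 this turns out to be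
  the Riemann-Liouville derivative of order a in t of \<open>dens x\<close>.\<close>

definition fractional :: "real \<Rightarrow> real \<Rightarrow> real \<Rightarrow> real" where
  "fractional a x = hankel (\<lambda>w. exp (of_real a * w) * Phi w * exp (- of_real x * Phi w))"

lemma hankel_lincomb:
  assumes "tame f" "tame g" "t > 0"
  shows "hankel (\<lambda>w. - (f w + of_real c * g w)) t = - (hankel f t + c * hankel g t)"
proof -
  have "Im (exp (of_real t * exp (ray u)) * (- (f (ray u) + of_real c * g (ray u))))
      = - (Im (exp (of_real t * exp (ray u)) * f (ray u)) + c * Im (exp (of_real t * exp (ray u)) * g (ray u)))" for u
  proof -
    have "exp (of_real t * exp (ray u)) * (- (f (ray u) + of_real c * g (ray u)))
        = - (exp (of_real t * exp (ray u)) * f (ray u) + c *\<^sub>R (exp (of_real t * exp (ray u)) * g (ray u)))"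
      by (simp add: scaleR_conv_of_real algebra_simps)
    then show ?thesis by (simp only: scaleR_complex.simps plus_complex.simps uminus_complex.simps)
  qed
  then have "hankel (\<lambda>w. - (f w + of_real c * g w)) t
      = (\<integral>u. - (Im (exp (of_real t * exp (ray u)) * f (ray u)) + c * Im (exp (of_real t * exp (ray u)) * g (ray u))) \<partial>lborel) / pi"
    by (simp only: hankel_def)
  also have "\<dots> = - ((\<integral>u. Im (exp (of_real t * exp (ray u)) * f (ray u)) \<partial>lborel)
      + c * (\<integral>u. Im (exp (of_real t * exp (ray u)) * g (ray u)) \<partial>lborel)) / pi"
    by (simp only: integral_minus integral_mult_right_zero Bochner_Integration.integral_add
        integrable_Im[OF tame_integrable[OF assms(1,3)]]
        integrable_mult_right[OF integrable_Im[OF tame_integrable[OF assms(2,3)]]])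
  also have "\<dots> = - (hankel f t + c * hankel g t)"
    by (simp only: hankel_def add_divide_distrib divide_minus_left times_divide_eq_right)
  finally show ?thesis .
qed

lemma hankel_cmult: "hankel (\<lambda>w. of_real c * g w) t = c * hankel g t"
proof -
  have "Im (exp (of_real t * exp (ray u)) * (of_real c * g (ray u)))
      = c * Im (exp (of_real t * exp (ray u)) * g (ray u))" for u
  proof -
    have "exp (of_real t * exp (ray u)) * (of_real c * g (ray u)) = c *\<^sub>R (exp (of_real t * exp (ray u)) * g (ray u))"
      by (simp add: scaleR_conv_of_real)
    then show ?thesis by (simp only: scaleR_complex.simps)
  qed
  then show ?thesis
    by (simp only: hankel_def integral_mult_right_zero times_divide_eq_right)
qed

lemma cdf_has_derivative:
  assumes "t > 0" "x \<ge> 0"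
  shows "((\<lambda>y. cdf_fun y t) has_real_derivative dens x t) (at x within {0..})"
  unfolding cdf_fun_def dens_def
proof (rule hankel_has_derivative[OF assms(1) _ _ _ tame_Phi])
  show "x \<in> {0..}" using assms by simp
  show "tame (\<lambda>w. 1 - exp (- of_real y * Phi w))" if "y \<in> {0..}" for y
    using that by (intro admissible_tame admissible_cdf) simp
  show "continuous_on strip (\<lambda>w. Phi w * exp (- of_real x * Phi w))"
    by (intro continuous_intros Phi_continuous)
  show "((\<lambda>y. 1 - exp (- of_real y * Phi (ray u))) has_vector_derivative
      Phi (ray u) * exp (- of_real x * Phi (ray u))) (at x within {0..})" for u
    by (rule has_vector_derivative_real_field) (auto intro!: derivative_eq_intros)
  fix y u assume y: "y \<in> {0::real..}"
  have "norm (1 - exp (- of_real y * Phi (ray u)) - (1 - exp (- of_real x * Phi (ray u))))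
      = norm (exp (- of_real y * Phi (ray u)) - exp (- of_real x * Phi (ray u)))"
    by (simp add: norm_minus_commute)
  also have "\<dots> \<le> \<bar>y - x\<bar> * norm (Phi (ray u))"
    using y assms Re_Phi_pos[of "ray u"] by (intro norm_exp_diff_le) auto
  finally show "norm (1 - exp (- of_real y * Phi (ray u)) - (1 - exp (- of_real x * Phi (ray u))))
      \<le> \<bar>y - x\<bar> * norm (Phi (ray u))" .
qed

text \<open>The integrand is Lipschitz in x with constant |Phi|^2, so tameness of the square of
  \<open>Phi\<close> decides; x = 0 is included as a one-sided derivative and gives continuity up to
  the boundary.\<close>

lemma dens_has_derivative:
  assumes "t > 0" "x \<ge> 0"
  shows "((\<lambda>y. dens y t) has_real_derivative
      hankel (\<lambda>w. - (Phi w * Phi w * exp (- of_real x * Phi w))) t) (at x within {0..})"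
  unfolding dens_def
proof (rule hankel_has_derivative[OF assms(1) _ _ _ tame_Phi_sq])
  show "x \<in> {0..}" using assms by simp
  show "tame (\<lambda>w. Phi w * exp (- of_real y * Phi w))" if "y \<in> {0..}" for y
    using that by (intro admissible_tame admissible_dens) simp
  show "continuous_on strip (\<lambda>w. - (Phi w * Phi w * exp (- of_real x * Phi w)))"
    by (intro continuous_intros Phi_continuous)
  show "((\<lambda>y. Phi (ray u) * exp (- of_real y * Phi (ray u))) has_vector_derivative
      - (Phi (ray u) * Phi (ray u) * exp (- of_real x * Phi (ray u)))) (at x within {0..})" for u
    by (rule has_vector_derivative_real_field) (auto intro!: derivative_eq_intros)
  fix y u assume y: "y \<in> {0::real..}"
  have "norm (Phi (ray u) * exp (- of_real y * Phi (ray u)) - Phi (ray u) * exp (- of_real x * Phi (ray u)))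
      = norm (Phi (ray u)) * norm (exp (- of_real y * Phi (ray u)) - exp (- of_real x * Phi (ray u)))"
    by (simp only: right_diff_distrib[symmetric] norm_mult)
  also have "\<dots> \<le> norm (Phi (ray u)) * (\<bar>y - x\<bar> * norm (Phi (ray u)))"
    using y assms Re_Phi_pos[of "ray u"] by (intro mult_left_mono norm_exp_diff_le) auto
  also have "\<dots> = \<bar>y - x\<bar> * norm ((Phi (ray u))\<^sup>2)"
    by (simp add: norm_mult power2_eq_square)
  finally show "norm (Phi (ray u) * exp (- of_real y * Phi (ray u)) - Phi (ray u) * exp (- of_real x * Phi (ray u)))
      \<le> \<bar>y - x\<bar> * norm ((Phi (ray u))\<^sup>2)" .
qed

lemma dens_continuous_on: "t > 0 \<Longrightarrow> continuous_on {0..} (\<lambda>x. dens x t)"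
  by (rule DERIV_continuous_on[OF dens_has_derivative]) auto

lemma dens_continuous_time: "x \<ge> 0 \<Longrightarrow> continuous_on {0<..} (dens x)"
  unfolding dens_def by (intro hankel_continuous admissible_tame admissible_dens)

lemma cdf_continuous_time: "x \<ge> 0 \<Longrightarrow> continuous_on {0<..} (cdf_fun x)"
  unfolding cdf_fun_def by (intro hankel_continuous admissible_tame admissible_cdf)

lemma cdf_0: "cdf_fun 0 t = 0"
  by (simp add: cdf_fun_def hankel_def)

lemma dens_laplace:
  assumes "x \<ge> 0" "\<mu> > 0"
  shows "has_bochner_integral lborel (\<lambda>t. indicator {0<..} t * (exp (- \<mu> * t) * dens x t))
           (phi \<mu> * exp (- x * phi \<mu>) / \<mu>)"
proof -
  have "exp (- of_real x * complex_of_real (phi \<mu>)) = of_real (exp (- x * phi \<mu>))"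
    by (simp add: exp_of_real[symmetric])
  then show ?thesis
    using hankel_laplace[OF admissible_dens[OF assms(1)] assms(2)] assms(2)
    by (simp add: dens_def Phi_ln del: of_real_exp)
qed

lemma cdf_laplace:
  assumes "x \<ge> 0" "\<mu> > 0"
  shows "has_bochner_integral lborel (\<lambda>t. indicator {0<..} t * (exp (- \<mu> * t) * cdf_fun x t))
           ((1 - exp (- x * phi \<mu>)) / \<mu>)"
proof -
  have "exp (- of_real x * complex_of_real (phi \<mu>)) = of_real (exp (- x * phi \<mu>))"
    by (simp add: exp_of_real[symmetric])
  then show ?thesis
    using hankel_laplace[OF admissible_cdf[OF assms(1)] assms(2)] assms(2)
    by (simp add: cdf_fun_def Phi_ln del: of_real_exp)
qed

lemma fractional_laplace:
  assumes "x > 0" "0 \<le> a" "a \<le> 1" "\<mu> > 0"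
  shows "has_bochner_integral lborel (\<lambda>t. indicator {0<..} t * (exp (- \<mu> * t) * fractional a x t))
           (\<mu> powr a * phi \<mu> * exp (- x * phi \<mu>) / \<mu>)"
proof -
  have "exp (- of_real x * complex_of_real (phi \<mu>)) = of_real (exp (- x * phi \<mu>))"
    by (simp add: exp_of_real[symmetric])
  then show ?thesis
    using hankel_laplace[OF admissible_fractional[OF assms(1-3)] assms(4)] assms(4)
    by (simp add: fractional_def Phi_ln exp_of_real_mult_ln del: of_real_exp)
qed

lemma resolvent_laplace:
  assumes "\<gamma> > 0" "\<mu> > 0"
  shows "has_bochner_integral lborel (\<lambda>t. indicator {0<..} t * (exp (- \<mu> * t) * hankel (\<lambda>w. Phi w / (of_real \<gamma> + Phi w)) t))
           (phi \<mu> / (\<gamma> + phi \<mu>) / \<mu>)"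
  using hankel_laplace[OF admissible_resolvent[OF assms(1)] assms(2)] assms(2)
  by (simp add: Phi_ln flip: of_real_add of_real_divide)

text \<open>At x = 0 the transform is phi \<mu> / \<mu>, a sum of the powers 2\<nu> - 1 and \<nu> -
  1 of \<mu>, and each of them is a Gamma integral of a power of t.\<close>

lemma dens_boundary:
  assumes "t > 0"
  shows "dens 0 t = t powr (- 2 * \<nu>) / Gamma (1 - 2 * \<nu>) + 2 * lam * (t powr (- \<nu>) / Gamma (1 - \<nu>))"
proof (rule laplace_unique_continuous[where N = 1 and t = t])
  have G: "Gamma (1 - 2 * \<nu>) > 0" "Gamma (1 - \<nu>) > 0" using \<nu> \<nu>_half by (auto intro: Gamma_real_pos)
  let ?R = "\<lambda>t. t powr (- 2 * \<nu>) / Gamma (1 - 2 * \<nu>) + 2 * lam * (t powr (- \<nu>) / Gamma (1 - \<nu>))"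
  show "has_bochner_integral lborel (\<lambda>t. indicator {0<..} t * (exp (- real n * t) * dens 0 t)) (phi (real n) / real n)"
    if "1 \<le> n" for n
    using dens_laplace[of 0 "real n"] that by simp
  show "has_bochner_integral lborel (\<lambda>t. indicator {0<..} t * (exp (- real n * t) * ?R t)) (phi (real n) / real n)"
    if "1 \<le> n" for n
  proof -
    have n: "real n > 0" using that by simp
    have 1: "has_bochner_integral lborel (\<lambda>t. 1 / Gamma (1 - 2 * \<nu>) * (indicator {0<..} t * (exp (- real n * t) * t powr (- 2 * \<nu>))))
        (1 / Gamma (1 - 2 * \<nu>) * (Gamma (- 2 * \<nu> + 1) / real n powr (- 2 * \<nu> + 1)))"
      using n \<nu>_half by (intro has_bochner_integral_mult_right exp_powr_integral) auto
    have 2: "has_bochner_integral lborel (\<lambda>t. 2 * lam / Gamma (1 - \<nu>) * (indicator {0<..} t * (exp (- real n * t) * t powr (- \<nu>))))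
        (2 * lam / Gamma (1 - \<nu>) * (Gamma (- \<nu> + 1) / real n powr (- \<nu> + 1)))"
      using n \<nu>_half by (intro has_bochner_integral_mult_right exp_powr_integral) auto
    have v: "1 / Gamma (1 - 2 * \<nu>) * (Gamma (- 2 * \<nu> + 1) / real n powr (- 2 * \<nu> + 1))
      + 2 * lam / Gamma (1 - \<nu>) * (Gamma (- \<nu> + 1) / real n powr (- \<nu> + 1)) = phi (real n) / real n"
    proof -
      have "- 2 * \<nu> + 1 = 1 - 2 * \<nu>" "- \<nu> + 1 = 1 - \<nu>" by simp_all
      then show ?thesis
        using G n by (simp add: powr_diff phi_def add_divide_distrib)
    qed
    have "indicator {0<..} t * (exp (- real n * t) * ?R t)
       = 1 / Gamma (1 - 2 * \<nu>) * (indicator {0<..} t * (exp (- real n * t) * t powr (- 2 * \<nu>)))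
       + 2 * lam / Gamma (1 - \<nu>) * (indicator {0<..} t * (exp (- real n * t) * t powr (- \<nu>)))" for t
      by (simp add: algebra_simps)
    then show ?thesis
      using has_bochner_integral_add[OF 1 2] v by simp
  qed
  show "continuous_on {0<..} ?R"
    using G by (intro continuous_intros) auto
  show "continuous_on {0<..} (dens 0) \<or> mono_on {0<..} (dens 0)"
    using dens_continuous_time[of 0] by simp
qed (rule assms)

lemma fractional_continuous_time:
  "x > 0 \<Longrightarrow> 0 \<le> a \<Longrightarrow> a \<le> 1 \<Longrightarrow> continuous_on {0<..} (fractional a x)"
  unfolding fractional_def by (intro hankel_continuous admissible_tame admissible_fractional)

lemma fractional_bounded:
  assumes "x > 0" "0 \<le> a" "a \<le> 1"
  obtains B where "\<And>t. t > 0 \<Longrightarrow> \<bar>fractional a x t\<bar> \<le> B"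
  using hankel_fractional_bounded[OF assms] unfolding fractional_def by (meson less_imp_le)

lemma fractional_0: "fractional 0 x = dens x"
  by (simp add: fractional_def dens_def)

text \<open>Both sides have transform Gamma (1 - a) \<mu>^(a - 1) phi \<mu> exp (- x phi \<mu>) /
  \<mu>: the Abel kernel contributes \<mu>^(a - 1) on the left, while on the right \<mu>^a sits in
  \<open>fractional\<close> and the primitive divides by \<mu>.\<close>

lemma abel_dens:
  assumes x: "x > 0" and a: "0 < a" "a < 1" and t: "t > 0"
  shows "abel_integral a (dens x) t = Gamma (1 - a) * abel_integral 0 (fractional a x) t"
proof (rule laplace_unique_continuous[where N = 1 and t = t])
  obtain B where B: "\<And>t. t > 0 \<Longrightarrow> \<bar>dens x t\<bar> \<le> B"
    using fractional_bounded[OF x, of 0] unfolding fractional_0 by auto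
  obtain B' where B': "\<And>t. t > 0 \<Longrightarrow> \<bar>fractional a x t\<bar> \<le> B'"
    using fractional_bounded[OF x, of a] a by auto
  have c: "continuous_on {0<..} (dens x)" using dens_continuous_time x by simp
  have c': "continuous_on {0<..} (fractional a x)" using fractional_continuous_time x a by simp
  let ?F = "\<lambda>n. phi (real n) * exp (- x * phi (real n)) / real n * (Gamma (1 - a) / real n powr (1 - a))"
  show "has_bochner_integral lborel (\<lambda>t. indicator {0<..} t * (exp (- real n * t) * abel_integral a (dens x) t)) (?F n)"
    if "1 \<le> n" for n
    using that x a by (intro abel_laplace[OF c B] dens_laplace) auto
  show "has_bochner_integral lborel (\<lambda>t. indicator {0<..} t * (exp (- real n * t) *
      (Gamma (1 - a) * abel_integral 0 (fractional a x) t))) (?F n)" if "1 \<le> n" for n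
  proof -
    have n: "real n > 0" using that by simp
    have "has_bochner_integral lborel (\<lambda>t. indicator {0<..} t * (exp (- real n * t) * abel_integral 0 (fractional a x) t))
        (real n powr a * phi (real n) * exp (- x * phi (real n)) / real n * (Gamma (1 - 0) / real n powr (1 - 0)))"
      using n x a by (intro abel_laplace[OF c' B'] fractional_laplace) auto
    then have "has_bochner_integral lborel (\<lambda>t. Gamma (1 - a) * (indicator {0<..} t * (exp (- real n * t) * abel_integral 0 (fractional a x) t)))
        (Gamma (1 - a) * (real n powr a * phi (real n) * exp (- x * phi (real n)) / real n * (Gamma (1 - 0) / real n powr (1 - 0))))"
      by (rule has_bochner_integral_mult_right)
    moreover have "Gamma (1 - a) * (real n powr a * phi (real n) * exp (- x * phi (real n)) / real n * (Gamma (1 - 0) / real n powr (1 - 0))) = ?F n"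
      using n by (simp add: powr_diff field_simps)
    moreover have "Gamma (1 - a) * (indicator {0<..} t * (exp (- real n * t) * abel_integral 0 (fractional a x) t))
       = indicator {0<..} t * (exp (- real n * t) * (Gamma (1 - a) * abel_integral 0 (fractional a x) t))" for t
      by simp
    ultimately show ?thesis by (simp only:)
  qed
  show "continuous_on {0<..} (\<lambda>t. Gamma (1 - a) * abel_integral 0 (fractional a x) t)"
    using abel_continuous[OF c' B', of 0] by (intro continuous_intros) auto
  show "continuous_on {0<..} (abel_integral a (dens x)) \<or> mono_on {0<..} (abel_integral a (dens x))"
    using abel_continuous[OF c B, of a] a by simp
qed (rule t)

lemma abel_dens_integrable:
  assumes "x > 0" "0 \<le> a" "a < 1"
  shows "integrable lborel (\<lambda>s. indicator {0<..<t} s * (dens x s / (t - s) powr a))"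
proof -
  obtain B where B: "\<And>t. t > 0 \<Longrightarrow> \<bar>dens x t\<bar> \<le> B"
    using fractional_bounded[OF assms(1), of 0] unfolding fractional_0 by auto
  show ?thesis
    using assms by (intro abel_integrable[OF dens_continuous_time B]) auto
qed

lemma abel_dens_has_derivative:
  assumes x: "x > 0" and a: "0 < a" "a < 1" and t: "t > 0"
  shows "(abel_integral a (dens x) has_real_derivative Gamma (1 - a) * fractional a x t) (at t)"
proof -
  obtain B' where B': "\<And>t. t > 0 \<Longrightarrow> \<bar>fractional a x t\<bar> \<le> B'"
    using fractional_bounded[OF x, of a] a by auto
  have "(abel_integral 0 (fractional a x) has_real_derivative fractional a x t) (at t)"
    using fractional_continuous_time[of x a] x a t by (intro abel_integral_0_has_derivative[OF _ B']) auto
  then have "((\<lambda>t. Gamma (1 - a) * abel_integral 0 (fractional a x) t) has_real_derivative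
      Gamma (1 - a) * fractional a x t) (at t)"
    by (rule DERIV_cmult)
  then show ?thesis
    by (rule has_field_derivative_transform_within_open[of _ _ _ "{0<..}"])
       (use abel_dens[OF x a] t in auto)
qed

text \<open>Differentiating in x brings down - \<open>Phi\<close>, and expanding that factor into
  its two exponentials produces exactly the two fractional integrands.\<close>

lemma fractional_equation:
  assumes "x > 0" "t > 0"
  shows "((\<lambda>y. dens y t) has_real_derivative
      - (fractional (2 * \<nu>) x t + 2 * lam * fractional \<nu> x t)) (at x)"
proof -
  let ?g = "\<lambda>a w. exp (of_real a * w) * Phi w * exp (- of_real x * Phi w)"
  have tm: "tame (?g (2 * \<nu>))" "tame (?g \<nu>)"
    by (rule admissible_tame, rule admissible_fractional; use \<nu> \<nu>_half assms in linarith)+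
  have "(\<lambda>w. - (Phi w * Phi w * exp (- of_real x * Phi w)))
      = (\<lambda>w. - (?g (2 * \<nu>) w + of_real (2 * lam) * ?g \<nu> w))"
  proof
    fix w
    have "Phi w * (Phi w * exp (- of_real x * Phi w))
       = (exp (of_real (2 * \<nu>) * w) + of_real (2 * lam) * exp (of_real \<nu> * w)) * (Phi w * exp (- of_real x * Phi w))"
      by (simp only: Phi_def)
    then show "- (Phi w * Phi w * exp (- of_real x * Phi w)) = - (?g (2 * \<nu>) w + of_real (2 * lam) * ?g \<nu> w)"
      by (simp only: distrib_right mult.assoc)
  qed
  then have "hankel (\<lambda>w. - (Phi w * Phi w * exp (- of_real x * Phi w))) t
      = hankel (\<lambda>w. - (?g (2 * \<nu>) w + of_real (2 * lam) * ?g \<nu> w)) t"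
    by (simp only:)
  also have "\<dots> = - (fractional (2 * \<nu>) x t + 2 * lam * fractional \<nu> x t)"
    by (simp only: fractional_def hankel_lincomb[OF tm assms(2)])
  finally have "hankel (\<lambda>w. - (Phi w * Phi w * exp (- of_real x * Phi w))) t
      = - (fractional (2 * \<nu>) x t + 2 * lam * fractional \<nu> x t)" .
  moreover have "at x within {0..} = at x"
    by (rule at_within_interior) (use assms in \<open>simp add: interior_real_atLeast\<close>)
  ultimately show ?thesis
    using dens_has_derivative[of t x] assms by simp
qed

text \<open>An explicit primitive in x of \<open>exp (- \<gamma> * x) * dens x t\<close>. At x = 0
  it is minus the Hankel integral of the resolvent, so its increment over the half-line is the
  x-Laplace transform.\<close>

lemma resolvent_has_derivative:
  assumes t: "t > 0" and x: "x \<ge> 0" and \<gamma>: "\<gamma> > 0"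
  shows "((\<lambda>y. hankel (\<lambda>w. - (Phi w / (of_real \<gamma> + Phi w) * exp (- of_real y * (of_real \<gamma> + Phi w)))) t)
      has_real_derivative exp (- \<gamma> * x) * dens x t) (at x within {0..})"
proof -
  have nz: "of_real \<gamma> + Phi w \<noteq> 0" if "w \<in> strip" for w
    using norm_add_Phi_ge[OF \<gamma> that] \<gamma> by auto
  have Re: "0 \<le> Re (of_real \<gamma> + Phi w)" if "w \<in> strip" for w
    using Re_Phi_pos[OF that] \<gamma> by simp
  have "((\<lambda>y. hankel (\<lambda>w. - (Phi w / (of_real \<gamma> + Phi w) * exp (- of_real y * (of_real \<gamma> + Phi w)))) t)
      has_real_derivative hankel (\<lambda>w. Phi w * exp (- of_real x * (of_real \<gamma> + Phi w))) t) (at x within {0..})"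
  proof (rule hankel_has_derivative[OF t _ _ _ tame_Phi])
    show "x \<in> {0..}" using x by simp
    show "tame (\<lambda>w. - (Phi w / (of_real \<gamma> + Phi w) * exp (- of_real y * (of_real \<gamma> + Phi w))))" if "y \<in> {0..}" for y
    proof (intro admissible_tame admissibleI_Phi[where c = "1 / \<gamma>"])
      show "(\<lambda>w. - (Phi w / (of_real \<gamma> + Phi w) * exp (- of_real y * (of_real \<gamma> + Phi w)))) holomorphic_on strip"
        using nz by (intro holomorphic_intros) auto
      fix w assume w: "w \<in> strip"
      have "norm (Phi w / (of_real \<gamma> + Phi w)) \<le> 1 / \<gamma> * norm (Phi w)"
        using frac_le[OF norm_ge_zero order_refl \<gamma> norm_add_Phi_ge[OF \<gamma> w]] by (simp add: norm_divide)
      moreover have "norm (exp (- of_real y * (of_real \<gamma> + Phi w))) \<le> 1"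
        using mult_nonneg_nonneg[of y "Re (of_real \<gamma> + Phi w)"] that Re[OF w] by simp
      ultimately have "norm (Phi w / (of_real \<gamma> + Phi w)) * norm (exp (- of_real y * (of_real \<gamma> + Phi w)))
          \<le> 1 / \<gamma> * norm (Phi w) * 1"
        using \<gamma> by (intro mult_mono) auto
      then show "norm (- (Phi w / (of_real \<gamma> + Phi w) * exp (- of_real y * (of_real \<gamma> + Phi w)))) \<le> 1 / \<gamma> * norm (Phi w)"
        by (simp only: norm_minus_cancel norm_mult mult_1_right)
    qed (use \<gamma> in \<open>simp_all add: Phi_cnj exp_cnj\<close>)
    show "continuous_on strip (\<lambda>w. Phi w * exp (- of_real x * (of_real \<gamma> + Phi w)))"
      by (intro continuous_intros Phi_continuous)
    have der: "((\<lambda>y. - (p / z * exp (- of_real y * z))) has_vector_derivative p * exp (- of_real x * z)) (at x within A)"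
      if "z \<noteq> 0" for p z :: complex and A
      by (rule has_vector_derivative_real_field) (use that in \<open>auto intro!: derivative_eq_intros\<close>)
    show "((\<lambda>y. - (Phi (ray u) / (of_real \<gamma> + Phi (ray u)) * exp (- of_real y * (of_real \<gamma> + Phi (ray u)))))
        has_vector_derivative Phi (ray u) * exp (- of_real x * (of_real \<gamma> + Phi (ray u)))) (at x within {0..})" for u
      by (rule der) (rule nz, simp)
    fix y u assume y: "y \<in> {0::real..}"
    let ?z = "of_real \<gamma> + Phi (ray u)"
    have "norm (- (Phi (ray u) / ?z * exp (- of_real y * ?z)) - - (Phi (ray u) / ?z * exp (- of_real x * ?z)))
        = norm (Phi (ray u) / ?z) * norm (exp (- of_real y * ?z) - exp (- of_real x * ?z))"
    proof -
      have "- (Phi (ray u) / ?z * exp (- of_real y * ?z)) - - (Phi (ray u) / ?z * exp (- of_real x * ?z))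
          = - (Phi (ray u) / ?z * (exp (- of_real y * ?z) - exp (- of_real x * ?z)))"
        by (simp only: right_diff_distrib) simp
      then show ?thesis by (simp only: norm_minus_cancel norm_mult)
    qed
    also have "\<dots> \<le> norm (Phi (ray u) / ?z) * (\<bar>y - x\<bar> * norm ?z)"
      using y x Re[of "ray u"] by (intro mult_left_mono norm_exp_diff_le) auto
    also have "\<dots> = \<bar>y - x\<bar> * norm (Phi (ray u))"
      using nz[of "ray u"] by (simp add: norm_divide)
    finally show "norm (- (Phi (ray u) / ?z * exp (- of_real y * ?z)) - - (Phi (ray u) / ?z * exp (- of_real x * ?z)))
        \<le> \<bar>y - x\<bar> * norm (Phi (ray u))" .
  qed
  moreover have "(\<lambda>w. Phi w * exp (- of_real x * (of_real \<gamma> + Phi w)))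
      = (\<lambda>w. of_real (exp (- \<gamma> * x)) * (Phi w * exp (- of_real x * Phi w)))"
    by (simp add: fun_eq_iff exp_of_real[symmetric] exp_add[symmetric] algebra_simps)
  ultimately show ?thesis
    by (simp only: hankel_cmult dens_def)
qed

text \<open>Since Re \<open>Phi\<close> > 0 on the ray, the exponential contributes exp (- \<gamma>
  y) uniformly in u, and what remains is a fixed integral of a tame function.\<close>

lemma resolvent_tendsto_0:
  assumes t: "t > 0" and \<gamma>: "\<gamma> > 0"
  shows "((\<lambda>y. hankel (\<lambda>w. - (Phi w / (of_real \<gamma> + Phi w) * exp (- of_real y * (of_real \<gamma> + Phi w)))) t) \<longlongrightarrow> 0) at_top"
proof (rule Lim_null_comparison)
  define K where "K = (\<integral>u. norm (exp (of_real t * exp (ray u)) * Phi (ray u)) \<partial>lborel)"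
  have nz: "of_real \<gamma> + Phi w \<noteq> 0" if "w \<in> strip" for w
    using norm_add_Phi_ge[OF \<gamma> that] \<gamma> by auto
  show "\<forall>\<^sub>F y in at_top. norm (hankel (\<lambda>w. - (Phi w / (of_real \<gamma> + Phi w) * exp (- of_real y * (of_real \<gamma> + Phi w)))) t)
      \<le> exp (- (\<gamma> * y)) / \<gamma> * K / pi"
    using eventually_ge_at_top[of 0]
  proof eventually_elim
    fix y :: real assume y: "0 \<le> y"
    show "norm (hankel (\<lambda>w. - (Phi w / (of_real \<gamma> + Phi w) * exp (- of_real y * (of_real \<gamma> + Phi w)))) t)
        \<le> exp (- (\<gamma> * y)) / \<gamma> * K / pi"
      unfolding K_def real_norm_def
    proof (rule hankel_le[OF tame_Phi _ t])
      show "continuous_on strip (\<lambda>w. - (Phi w / (of_real \<gamma> + Phi w) * exp (- of_real y * (of_real \<gamma> + Phi w))))"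
        using nz by (intro continuous_intros Phi_continuous) auto
      fix u
      have "norm (Phi (ray u) / (of_real \<gamma> + Phi (ray u))) \<le> norm (Phi (ray u)) / \<gamma>"
        using frac_le[OF norm_ge_zero order_refl \<gamma> norm_add_Phi_ge[OF \<gamma>, of "ray u"]] by (simp add: norm_divide)
      moreover have "norm (exp (- of_real y * (of_real \<gamma> + Phi (ray u)))) \<le> exp (- (\<gamma> * y))"
        using y Re_Phi_pos[of "ray u"] by (simp add: algebra_simps mult_nonneg_nonneg)
      ultimately have "norm (Phi (ray u) / (of_real \<gamma> + Phi (ray u))) * norm (exp (- of_real y * (of_real \<gamma> + Phi (ray u))))
          \<le> norm (Phi (ray u)) / \<gamma> * exp (- (\<gamma> * y))"
        using \<gamma> by (intro mult_mono) auto
      then show "norm (- (Phi (ray u) / (of_real \<gamma> + Phi (ray u)) * exp (- of_real y * (of_real \<gamma> + Phi (ray u)))))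
          \<le> exp (- (\<gamma> * y)) / \<gamma> * norm (Phi (ray u))"
        by (simp only: norm_minus_cancel norm_mult) (simp add: mult.commute)
    qed
  qed
  have "filterlim (\<lambda>y. - (\<gamma> * y)) at_bot at_top"
    using \<gamma> by (intro filterlim_compose[OF filterlim_uminus_at_bot_at_top]
          filterlim_tendsto_pos_mult_at_top[OF tendsto_const] filterlim_ident)
  then have "((\<lambda>y. exp (- (\<gamma> * y))) \<longlongrightarrow> 0) at_top"
    by (rule filterlim_compose[OF exp_at_bot])
  then have "((\<lambda>y. exp (- (\<gamma> * y)) / \<gamma> * K / pi) \<longlongrightarrow> 0 / \<gamma> * K / pi) at_top"
    using \<gamma> by (intro tendsto_intros) auto
  then show "((\<lambda>y. exp (- (\<gamma> * y)) / \<gamma> * K / pi) \<longlongrightarrow> 0) at_top" by simp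
qed

end

section \<open>Mittag-Leffler functions\<close>

text \<open>Truncating Euler's integral to r > R and bounding r powr s below by R powr s gives Gamma
  (s + 1) \<ge> exp (- R) * R powr s. The free parameter R then makes the series geometric with any
  desired ratio.\<close>

lemma mittag_leffler_term_bound:
  assumes "\<nu> > 0" "R > 0"
  shows "\<bar>x ^ k / Gamma (\<nu> * real k + 1)\<bar> \<le> exp R * (\<bar>x\<bar> / R powr \<nu>) ^ k"
proof -
  define s where "s = \<nu> * real k"
  have s: "s \<ge> 0" using assms by (simp add: s_def)
  let ?h = "\<lambda>r. indicator {0<..} r * exp (- 1 * r)"
  have "has_bochner_integral lborel (\<lambda>r. ?h (- R + 1 * r)) (1 / 1 /\<^sub>R \<bar>1\<bar>)"
    using lborel_has_bochner_integral_real_affine_iff[of 1 ?h "1 / 1" "- R"] exp_integral[of 1] by simp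
  then have 1: "has_bochner_integral lborel (\<lambda>r. exp (- R) * R powr s * ?h (- R + 1 * r)) (exp (- R) * R powr s * (1 / 1 /\<^sub>R \<bar>1\<bar>))"
    by (rule has_bochner_integral_mult_right)
  have 2: "has_bochner_integral lborel (\<lambda>r. indicator {0<..} r * (exp (- 1 * r) * r powr s)) (Gamma (s + 1) / 1 powr (s + 1))"
    using s by (intro exp_powr_integral) auto
  have "(\<integral>r. exp (- R) * R powr s * ?h (- R + 1 * r) \<partial>lborel)
      \<le> (\<integral>r. indicator {0<..} r * (exp (- 1 * r) * r powr s) \<partial>lborel)"
  proof (rule integral_mono[OF integrable.intros[OF 1] integrable.intros[OF 2]])
    fix r :: real
    have "exp (- R) * R powr s * exp (- (r - R)) \<le> exp (- r) * r powr s" if "r > R"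
    proof -
      have "exp (- R) * R powr s * exp (- (r - R)) = (exp (- R) * exp (- (r - R))) * R powr s"
        by (simp only: mult_ac)
      also have "\<dots> = exp (- r) * R powr s" by (simp add: exp_add[symmetric])
      also have "\<dots> \<le> exp (- r) * r powr s"
        using that assms s by (intro mult_left_mono powr_mono2) auto
      finally show ?thesis .
    qed
    then show "exp (- R) * R powr s * ?h (- R + 1 * r) \<le> indicator {0<..} r * (exp (- 1 * r) * r powr s)"
      using assms by (auto simp: indicator_def)
  qed
  then have G: "exp (- R) * R powr s \<le> Gamma (s + 1)"
    unfolding has_bochner_integral_integral_eq[OF 1] has_bochner_integral_integral_eq[OF 2] by simp
  have Rp: "0 < exp (- R) * R powr s" using assms by simp
  have "\<bar>x ^ k / Gamma (\<nu> * real k + 1)\<bar> = \<bar>x\<bar> ^ k / Gamma (s + 1)"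
    using G Rp by (simp add: s_def abs_divide power_abs)
  also have "\<dots> \<le> \<bar>x\<bar> ^ k / (exp (- R) * R powr s)"
    using G Rp by (intro divide_left_mono mult_pos_pos) auto
  also have "R powr s = (R powr \<nu>) ^ k"
    using assms by (simp add: s_def powr_powr[symmetric] powr_realpow)
  also have "\<bar>x\<bar> ^ k / (exp (- R) * (R powr \<nu>) ^ k) = exp R * (\<bar>x\<bar> / R powr \<nu>) ^ k"
    by (simp add: exp_minus power_mult_distrib power_inverse divide_inverse)
  finally show ?thesis .
qed

lemma mittag_leffler_summable:
  fixes x :: real
  assumes "\<nu> > 0"
  shows "summable (\<lambda>k. norm (x ^ k / Gamma (\<nu> * real k + 1)))"
proof -
  \<comment> \<open>Chosen so that R powr \<nu> = 2 (|x| + 1), which puts the ratio of the geometric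
    majorant below 1/2.\<close>
  define R where "R = (2 * (\<bar>x\<bar> + 1)) powr (1 / \<nu>)"
  have R: "R > 0" "R powr \<nu> = 2 * (\<bar>x\<bar> + 1)"
    using assms by (auto simp: R_def powr_powr)
  have "norm (\<bar>x\<bar> / R powr \<nu>) < 1" by (simp add: R(2))
  then have "summable (\<lambda>k. exp R * (\<bar>x\<bar> / R powr \<nu>) ^ k)"
    by (intro summable_mult summable_geometric)
  then show ?thesis
  proof (rule summable_comparison_test'[where N = 0])
    show "norm (norm (x ^ k / Gamma (\<nu> * real k + 1))) \<le> exp R * (\<bar>x\<bar> / R powr \<nu>) ^ k" for k
      using mittag_leffler_term_bound[OF assms R(1), of x k] by simp
  qed
qed

lemma mittag_leffler_isCont:
  assumes "\<nu> > 0"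
  shows "isCont (mittag_leffler \<nu> 1) x"
proof -
  have "isCont (\<lambda>x. \<Sum>k. (1 / Gamma (\<nu> * real k + 1)) * x ^ k) x"
  proof (rule isCont_powser_converges_everywhere)
    show "summable (\<lambda>k. (1 / Gamma (\<nu> * real k + 1)) * y ^ k)" for y
      using summable_norm_cancel[OF mittag_leffler_summable[OF assms, of y]] by simp
  qed
  then show ?thesis by (simp add: mittag_leffler_def[abs_def])
qed

text \<open>Termwise integration: each term has a Gamma integral that cancels its coefficient,
  leaving a geometric series in r / \<mu> powr \<nu>. The bound on |r| makes the series of norms
  converge and so justifies the interchange.\<close>

lemma mittag_leffler_laplace:
  fixes r \<mu> :: real
  assumes \<nu>: "\<nu> > 0" and \<mu>: "\<mu> > 0" and r: "\<bar>r\<bar> < \<mu> powr \<nu>"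
  shows "has_bochner_integral lborel
           (\<lambda>t. indicator {0<..} t * (exp (- \<mu> * t) * mittag_leffler \<nu> 1 (r * t powr \<nu>)))
           (\<mu> powr \<nu> / (\<mu> powr \<nu> - r) / \<mu>)"
proof -
  define f where "f = (\<lambda>r k t. r ^ k / Gamma (\<nu> * real k + 1) *
      (indicator {0<..} t * (exp (- \<mu> * t) * t powr (\<nu> * real k))))"
  have f: "has_bochner_integral lborel (f r k) ((r / \<mu> powr \<nu>) ^ k / \<mu>)" for r :: real and k
  proof -
    have "has_bochner_integral lborel (f r k)
        (r ^ k / Gamma (\<nu> * real k + 1) * (Gamma (\<nu> * real k + 1) / \<mu> powr (\<nu> * real k + 1)))"
      unfolding f_def using \<nu> \<mu>
      by (intro has_bochner_integral_mult_right exp_powr_integral) (auto simp: less_le_trans[of "-1" 0])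
    also have "r ^ k / Gamma (\<nu> * real k + 1) * (Gamma (\<nu> * real k + 1) / \<mu> powr (\<nu> * real k + 1)) = (r / \<mu> powr \<nu>) ^ k / \<mu>"
    proof -
      have "Gamma (\<nu> * real k + 1) > 0" using \<nu> by (intro Gamma_real_pos) (simp add: add_nonneg_pos)
      moreover have "\<mu> powr (\<nu> * real k + 1) = (\<mu> powr \<nu>) ^ k * \<mu>"
        using \<mu> by (simp add: powr_add powr_powr[symmetric] powr_realpow)
      ultimately show ?thesis by (simp add: power_divide)
    qed
    finally show ?thesis .
  qed
  have fnorm: "norm (f r k t) = f \<bar>r\<bar> k t" for r k t
  proof -
    have "Gamma (\<nu> * real k + 1) > 0" using \<nu> by (intro Gamma_real_pos) (simp add: add_nonneg_pos)
    then show ?thesis by (simp add: f_def abs_mult power_abs)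
  qed
  have q: "norm (r / \<mu> powr \<nu>) < 1" "norm (\<bar>r\<bar> / \<mu> powr \<nu>) < 1" using r \<mu> by auto
  have pt: "f r k t = indicator {0<..} t * exp (- \<mu> * t) * ((r * t powr \<nu>) ^ k / Gamma (\<nu> * real k + 1))" for r k t
    by (cases "t > 0") (auto simp: f_def power_mult_distrib powr_powr[symmetric] powr_realpow)
  have sm: "summable (\<lambda>k. norm (f r k t))" for t
    unfolding pt norm_mult[of "_ * _" "_ / _"] by (intro summable_mult mittag_leffler_summable \<nu>)
  have fi: "integrable lborel (f r k)" for k
    using f by (simp add: has_bochner_integral_iff)
  have AEs: "AE t in lborel. summable (\<lambda>k. norm (f r k t))" using sm by simp
  have "(\<integral>t. norm (f r k t) \<partial>lborel) = (\<bar>r\<bar> / \<mu> powr \<nu>) ^ k / \<mu>" for k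
    unfolding fnorm using f[of "\<bar>r\<bar>" k] by (simp only: has_bochner_integral_iff)
  then have s2: "summable (\<lambda>k. \<integral>t. norm (f r k t) \<partial>lborel)"
    using q(2) by (simp only:) (intro summable_divide summable_geometric)
  have suminf: "(\<Sum>k. f r k t) = indicator {0<..} t * (exp (- \<mu> * t) * mittag_leffler \<nu> 1 (r * t powr \<nu>))" for t
    unfolding pt mittag_leffler_def
    by (subst suminf_mult[OF summable_norm_cancel[OF mittag_leffler_summable[OF \<nu>]]]) (simp only: mult.assoc)
  have "(\<lambda>k. (r / \<mu> powr \<nu>) ^ k / \<mu>) sums (1 / (1 - r / \<mu> powr \<nu>) / \<mu>)"
    using q(1) by (intro sums_divide geometric_sums)
  moreover have "(\<integral>t. f r k t \<partial>lborel) = (r / \<mu> powr \<nu>) ^ k / \<mu>" for k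
    using f[of r k] by (simp only: has_bochner_integral_iff)
  ultimately have "(\<integral>t. (\<Sum>k. f r k t) \<partial>lborel) = 1 / (1 - r / \<mu> powr \<nu>) / \<mu>"
    using sums_integral[OF fi AEs s2] by (simp only: sums_unique2)
  also have "1 / (1 - r / \<mu> powr \<nu>) / \<mu> = \<mu> powr \<nu> / (\<mu> powr \<nu> - r) / \<mu>"
    using r \<mu> by (simp add: divide_simps)
  finally show ?thesis
    using integrable_suminf[OF fi AEs s2] unfolding suminf by (simp only: has_bochner_integral_iff)
qed

text \<open>The coincidence set is closed and has full measure in the open half-line, hence contains
  it; the end point 0 is recovered as a limit.\<close>

lemma continuous_AE_eq_atLeast_0:
  fixes f g :: "real \<Rightarrow> real"
  assumes f: "continuous_on {0..} f" and g: "continuous_on {0..} g"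
    and ae: "AE x in lborel. x \<ge> 0 \<longrightarrow> f x = g x" and x: "x \<ge> 0"
  shows "f x = g x"
proof -
  define C where "C = {x \<in> {0..}. f x = g x}"
  have "closed C"
    unfolding C_def using f g by (intro continuous_closed_preimage_constant[of _ "\<lambda>x. f x - g x" 0, simplified] continuous_intros)
  have "AE x \<in> {0<..} in lebesgue. x \<in> C"
    using AE_completion[OF ae] by eventually_elim (auto simp: C_def)
  with \<open>closed C\<close> have pos: "y \<in> C" if "y > 0" for y
    using mem_closed_if_AE_lebesgue_open[of "{0<..}" C y] that by simp
  have "x \<in> C"
  proof (cases "x = 0")
    case True
    have "(\<lambda>n. 1 / real (Suc n)) \<longlonglongrightarrow> 0" by (rule lim_1_over_n[THEN LIMSEQ_Suc])
    then have "0 \<in> C"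
      using closed_sequentially[OF \<open>closed C\<close>, of "\<lambda>n. 1 / real (Suc n)" 0] pos by simp
    with True show ?thesis by simp
  qed (use pos x in auto)
  then show ?thesis by (simp add: C_def)
qed

section \<open>The x-Laplace transform of the density\<close>

context telegraph_strip
begin

lemma resolvent_mittag_leffler:
  assumes \<gamma>: "0 < \<gamma>" "\<gamma> < lam\<^sup>2" and t: "t > 0"
  defines "s \<equiv> sqrt (lam\<^sup>2 - \<gamma>)"
  shows "hankel (\<lambda>w. Phi w / (of_real \<gamma> + Phi w)) t =
     1 / 2 * ((1 + lam / s) * mittag_leffler \<nu> 1 ((- lam + s) * t powr \<nu>)
            + (1 - lam / s) * mittag_leffler \<nu> 1 ((- lam - s) * t powr \<nu>))"
proof -
  \<comment> \<open>Both roots - \<open>lam\<close> + s and - \<open>lam\<close> - s have modulus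
    below 2 \<open>lam\<close>; from N0 on, n powr \<nu> exceeds that, as the Mittag-Leffler
    transform requires.\<close>
  obtain N0 :: nat where N0: "(2 * lam) powr (1 / \<nu>) < real N0" using reals_Archimedean2 by blast
  define N where "N = max 1 N0"
  have s: "0 < s" "s < lam" "s * s = lam\<^sup>2 - \<gamma>"
  proof -
    show "0 < s" using \<gamma> by (simp add: s_def)
    have "s < sqrt (lam\<^sup>2)" unfolding s_def using \<gamma> by (subst real_sqrt_less_iff) simp
    then show "s < lam" using lam by simp
    show "s * s = lam\<^sup>2 - \<gamma>" using \<gamma> by (simp add: s_def)
  qed
  let ?E = "\<lambda>r t. mittag_leffler \<nu> 1 (r * t powr \<nu>)"
  let ?R = "\<lambda>t. 1 / 2 * ((1 + lam / s) * ?E (- lam + s) t + (1 - lam / s) * ?E (- lam - s) t)"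
  let ?F = "\<lambda>n. phi (real n) / (\<gamma> + phi (real n)) / real n"
  show ?thesis
  proof (rule laplace_unique_continuous[where N = N and t = t])
    show "has_bochner_integral lborel (\<lambda>t. indicator {0<..} t *
        (exp (- real n * t) * hankel (\<lambda>w. Phi w / (of_real \<gamma> + Phi w)) t)) (?F n)" if "N \<le> n" for n
      using that \<gamma> by (intro resolvent_laplace) (auto simp: N_def)
    show "has_bochner_integral lborel (\<lambda>t. indicator {0<..} t * (exp (- real n * t) * ?R t)) (?F n)"
      if "N \<le> n" for n
    proof -
      have n: "real n > 0" using that by (simp add: N_def)
      define m where "m = real n powr \<nu>"
      have m: "2 * lam < m"
      proof -
        have "((2 * lam) powr (1 / \<nu>)) powr \<nu> < real n powr \<nu>"
          using N0 that \<nu> lam by (intro powr_less_mono2) (auto simp: N_def)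
        then show ?thesis using \<nu> lam by (simp add: m_def powr_powr)
      qed
      have 1: "has_bochner_integral lborel (\<lambda>t. indicator {0<..} t * (exp (- real n * t) * ?E (- lam + s) t))
          (m / (m - (- lam + s)) / real n)"
        unfolding m_def using s m lam n by (intro mittag_leffler_laplace \<nu>) (auto simp: m_def)
      have 2: "has_bochner_integral lborel (\<lambda>t. indicator {0<..} t * (exp (- real n * t) * ?E (- lam - s) t))
          (m / (m - (- lam - s)) / real n)"
        unfolding m_def using s m lam n by (intro mittag_leffler_laplace \<nu>) (auto simp: m_def)
      have phi_m: "phi (real n) = m * (m + 2 * lam)"
        using n by (simp add: phi_def m_def algebra_simps powr_add[symmetric])
      \<comment> \<open>In m = n powr \<nu> the denominator is the quadratic m * (m + 2 lam) +
        \<gamma>, whose roots are r1 and r2; this is where the square root in the formula comes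
        from.\<close>
      have prod: "\<gamma> + phi (real n) = (m + lam - s) * (m + lam + s)"
        using s(3) by (simp add: phi_m power2_eq_square algebra_simps)
      have v: "1 / 2 * (1 + lam / s) * (m / (m - (- lam + s)) / real n)
         + 1 / 2 * (1 - lam / s) * (m / (m - (- lam - s)) / real n) = ?F n"
      proof -
        have nz: "m + lam - s \<noteq> 0" "m + lam + s \<noteq> 0" using s m lam by auto
        have e: "m - (- lam + s) = m + lam - s" "m - (- lam - s) = m + lam + s" by simp_all
        have "1 / 2 * (1 + lam / s) * (m / (m + lam - s)) + 1 / 2 * (1 - lam / s) * (m / (m + lam + s))
            = m * (m + 2 * lam) / ((m + lam - s) * (m + lam + s))"
          using nz s(1) by (simp add: divide_simps) (simp add: algebra_simps)
        then have "(1 / 2 * (1 + lam / s) * (m / (m + lam - s)) + 1 / 2 * (1 - lam / s) * (m / (m + lam + s))) / real n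
            = m * (m + 2 * lam) / ((m + lam - s) * (m + lam + s)) / real n"
          by (simp only:)
        then show ?thesis
          unfolding e prod unfolding phi_m by (simp only: add_divide_distrib times_divide_eq_right)
      qed
      have gen: "i * (e * (1 / 2 * (a * A + b * B))) = 1 / 2 * a * (i * (e * A)) + 1 / 2 * b * (i * (e * B))"
        for i e a b A B :: real
        by (simp add: algebra_simps)
      have "indicator {0<..} t * (exp (- real n * t) * ?R t)
         = 1 / 2 * (1 + lam / s) * (indicator {0<..} t * (exp (- real n * t) * ?E (- lam + s) t))
         + 1 / 2 * (1 - lam / s) * (indicator {0<..} t * (exp (- real n * t) * ?E (- lam - s) t))" for t
        by (rule gen)
      then show ?thesis
        using has_bochner_integral_add[OF has_bochner_integral_mult_right[OF 1, of "1 / 2 * (1 + lam / s)"]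
            has_bochner_integral_mult_right[OF 2, of "1 / 2 * (1 - lam / s)"]] v
        by (simp only:)
    qed
    have E: "continuous_on {0<..} (?E r)" for r
      by (intro continuous_on_compose2[OF continuous_at_imp_continuous_on[of UNIV "mittag_leffler \<nu> 1"]]
          continuous_intros) (auto intro: mittag_leffler_isCont \<nu>)
    then show "continuous_on {0<..} ?R"
      by (intro continuous_intros)
    show "continuous_on {0<..} (hankel (\<lambda>w. Phi w / (of_real \<gamma> + Phi w)))
        \<or> mono_on {0<..} (hankel (\<lambda>w. Phi w / (of_real \<gamma> + Phi w)))"
      using \<gamma> by (intro disjI1 hankel_continuous admissible_tame admissible_resolvent)
  qed (rule t)
qed

text \<open>The fundamental theorem on {0..n}, then monotone convergence, which delivers the
  integral over the half-line without prior integrability. Nonnegativity is a hypothesis here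
  because it is supplied later by the process.\<close>

lemma dens_space_laplace:
  assumes t: "t > 0" and \<gamma>: "\<gamma> > 0" and nonneg: "\<And>x. x \<ge> 0 \<Longrightarrow> dens x t \<ge> 0"
  shows "(LBINT x:{0..}. exp (- \<gamma> * x) * dens x t) = hankel (\<lambda>w. Phi w / (of_real \<gamma> + Phi w)) t"
proof -
  define F where "F = (\<lambda>y. hankel (\<lambda>w. - (Phi w / (of_real \<gamma> + Phi w) * exp (- of_real y * (of_real \<gamma> + Phi w)))) t)"
  define f where "f = (\<lambda>x. exp (- \<gamma> * x) * dens x t)"
  have fc: "continuous_on {0..} f"
    unfolding f_def by (intro continuous_intros dens_continuous_on t)
  have f0: "f x \<ge> 0" if "x \<ge> 0" for x using nonneg[OF that] by (simp add: f_def)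
  have Fd: "(F has_vector_derivative f x) (at x within {0..real n})" if "0 \<le> x" for x n
  proof -
    have "(F has_real_derivative f x) (at x within {0..})"
      unfolding F_def f_def by (rule resolvent_has_derivative[OF t that \<gamma>])
    then have "(F has_real_derivative f x) (at x within {0..real n})"
      by (rule DERIV_subset) auto
    then show ?thesis by (simp add: has_real_derivative_iff_has_vector_derivative)
  qed
  have Icc: "has_bochner_integral lborel (\<lambda>x. indicator {0..real n} x *\<^sub>R f x) (F (real n) - F 0)" for n
    by (rule has_bochner_integral_FTC_Icc) (use Fd continuous_on_subset[OF fc] in auto)
  have "F 0 = hankel (\<lambda>w. of_real (- 1) * (Phi w / (of_real \<gamma> + Phi w))) t"
    by (simp add: F_def)
  then have F0: "F 0 = - hankel (\<lambda>w. Phi w / (of_real \<gamma> + Phi w)) t"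
    by (simp only: hankel_cmult)
  have "(\<lambda>n. F (real n)) \<longlonglongrightarrow> 0"
    unfolding F_def by (rule filterlim_compose[OF resolvent_tendsto_0[OF t \<gamma>] filterlim_real_sequentially])
  then have lim: "(\<lambda>n. F (real n) - F 0) \<longlonglongrightarrow> 0 - F 0" by (intro tendsto_intros)
  have "integral\<^sup>L lborel (\<lambda>x. indicator {0..} x *\<^sub>R f x) = 0 - F 0"
  proof (rule integral_monotone_convergence[where f = "\<lambda>n x. indicator {0..real n} x *\<^sub>R f x"])
    show "integrable lborel (\<lambda>x. indicator {0..real n} x *\<^sub>R f x)" for n
      using Icc[of n] by (simp only: has_bochner_integral_iff)
    show "AE x in lborel. mono (\<lambda>n. indicator {0..real n} x *\<^sub>R f x)"
      using f0 by (intro AE_I2 monoI) (auto simp: indicator_def)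
    show "AE x in lborel. (\<lambda>n. indicator {0..real n} x *\<^sub>R f x) \<longlonglongrightarrow> indicator {0..} x *\<^sub>R f x"
    proof (intro AE_I2 tendsto_eventually)
      fix x :: real
      obtain N :: nat where N: "x < real N" using reals_Archimedean2 by blast
      show "\<forall>\<^sub>F n in sequentially. indicator {0..real n} x *\<^sub>R f x = indicator {0..} x *\<^sub>R f x"
        using eventually_ge_at_top[of N] by eventually_elim (use N in \<open>auto simp: indicator_def\<close>)
    qed
    have "(\<integral>x. indicator {0..real n} x *\<^sub>R f x \<partial>lborel) = F (real n) - F 0" for n
      using Icc[of n] by (simp only: has_bochner_integral_iff)
    then show "(\<lambda>n. \<integral>x. indicator {0..real n} x *\<^sub>R f x \<partial>lborel) \<longlonglongrightarrow> 0 - F 0"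
      using lim by (simp only:)
    show "(\<lambda>x. indicator {0..} x *\<^sub>R f x) \<in> borel_measurable lborel"
      using borel_measurable_continuous_on_indicator[OF _ fc] by simp
  qed
  then show ?thesis
    unfolding set_lebesgue_integral_def f_def[symmetric] F0 by simp
qed

section \<open>Riemann-Liouville derivatives of the density\<close>

lemma dens_rl_integral:
  assumes "0 < a" "a < 1"
  shows "rl_integral a (dens x) = abel_integral a (dens x)"
proof -
  have "rl_order a = 1" using assms by (simp add: rl_order_def ceiling_unique[of 1, simplified])
  then show ?thesis
    by (simp add: fun_eq_iff rl_integral_def rl_kernel_def abel_integral_def set_lebesgue_integral_def)
qed

text \<open>For an order in (0,1) the ceiling is 1, so the kernel exponent is a and one derivative
  is taken; the factor Gamma (1 - a) produced by the Abel integral cancels the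
  normalisation.\<close>

lemma dens_rl:
  assumes x: "x > 0" and a: "0 < a" "a < 1" and t: "t > 0"
  shows "rl_differentiable a (dens x) t" and "rl_deriv a (dens x) t = fractional a x t"
proof -
  have o: "rl_order a = 1" using a by (simp add: rl_order_def ceiling_unique[of 1, simplified])
  have "\<forall>\<^sub>F u in nhds t. u > 0" using t by (intro order_tendstoD(1)[OF filterlim_ident])
  then show "rl_differentiable a (dens x) t"
    unfolding rl_differentiable_def
  proof eventually_elim
    fix u :: real assume u: "u > 0"
    have "set_integrable lborel {0<..<u} (rl_kernel a (dens x) u)"
      using abel_dens_integrable[OF x, of a u] a by (simp add: set_integrable_def rl_kernel_def o)
    moreover have "rl_integral a (dens x) differentiable (at u)"
      unfolding dens_rl_integral[OF a]
      using abel_dens_has_derivative[OF x a u] real_differentiable_def by blast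
    ultimately show "set_integrable lborel {0<..<u} (rl_kernel a (dens x) u) \<and>
        (\<forall>j<rl_order a. (deriv ^^ j) (rl_integral a (dens x)) differentiable (at u))"
      by (simp add: o)
  qed
  have "Gamma (1 - a) > 0" using a by (intro Gamma_real_pos) simp
  then show "rl_deriv a (dens x) t = fractional a x t"
    using DERIV_imp_deriv[OF abel_dens_has_derivative[OF x a t]]
    by (simp add: rl_deriv_def o dens_rl_integral[OF a])
qed

end

section \<open>The inverse process\<close>

lemma (in stable_subordinator) nonneg:
  assumes "\<omega> \<in> space M" "t \<ge> 0"
  shows "0 \<le> H t \<omega>"
  using mono_onD[OF nondecreasing[OF assms(1)], of 0 t] start[OF assms(1)] assms(2) by simp

locale stable_sum = telegraph_strip \<theta> \<omega> \<nu> lam + H1: stable_subordinator M "2 * \<nu>" H1 + H2: stable_subordinator M \<nu> H2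
  for \<theta> \<omega> \<nu> lam :: real and M :: "'a measure" and H1 H2 +
  assumes independent: "independent_processes M H1 H2"
begin

definition H :: "real \<Rightarrow> 'a \<Rightarrow> real" where
  "H t x = H1 t x + (2 * lam) powr (1 / \<nu>) * H2 t x"

text \<open>Off this set the infimum in \<^const>\<open>inverse_process\<close> is the junk value \<open>Inf {}\<close>.\<close>

definition escaping :: "real \<Rightarrow> 'a set" where
  "escaping t = {x \<in> space M. \<exists>n::nat. t \<le> H (real n) x}"

lemma c_pos: "(2 * lam) powr (1 / \<nu>) > 0"
  using lam by simp

lemma H_measurable [measurable]: "t \<ge> 0 \<Longrightarrow> H t \<in> borel_measurable M"
  unfolding H_def[abs_def] using H1.measurable[of t] H2.measurable[of t] by measurable

lemma H_start: "x \<in> space M \<Longrightarrow> H 0 x = 0"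
  by (simp add: H_def H1.start H2.start)

lemma H_mono:
  assumes "x \<in> space M" "0 \<le> s" "s \<le> t"
  shows "H s x \<le> H t x"
  unfolding H_def
  using mono_onD[OF H1.nondecreasing[OF assms(1)], of s t] mono_onD[OF H2.nondecreasing[OF assms(1)], of s t] assms c_pos
  by (intro add_mono mult_left_mono) auto

lemma H_nonneg: "x \<in> space M \<Longrightarrow> 0 \<le> t \<Longrightarrow> 0 \<le> H t x"
  using H_mono[of x 0 t] H_start by simp

lemma H_right_continuous:
  assumes "x \<in> space M" "0 \<le> t"
  shows "continuous (at_right t) (\<lambda>s. H s x)"
  unfolding H_def using H1.right_continuous[OF assms] H2.right_continuous[OF assms]
  by (intro continuous_intros)

text \<open>Independence of the processes passes to their coordinates at the single time x. The
  weight (2 lam) powr (1 / \<nu>) on H2 is the one whose \<nu>-th power is 2 lam, which makes the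
  exponents add up to \<open>phi\<close>.\<close>

lemma H_laplace:
  assumes x: "x > 0" and \<mu>: "\<mu> > 0"
  shows "H1.expectation (\<lambda>y. exp (- \<mu> * H x y)) = exp (- x * phi \<mu>)"
proof -
  let ?c = "(2 * lam) powr (1 / \<nu>)"
  let ?X = "\<lambda>y. exp (- \<mu> * H1 x y)" and ?Y = "\<lambda>y. exp (- (\<mu> * ?c) * H2 x y)"
  have ev: "(\<lambda>f. f x) \<in> measurable (PiM {0..} (\<lambda>_. borel)) (borel :: real measure)"
    using x by (intro measurable_component_singleton) simp
  have "H1.indep_var borel ((\<lambda>f. exp (- \<mu> * f x)) \<circ> (\<lambda>y. \<lambda>t\<in>{0..}. H1 t y))
      borel ((\<lambda>f. exp (- (\<mu> * ?c) * f x)) \<circ> (\<lambda>y. \<lambda>t\<in>{0..}. H2 t y))"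
    by (rule H1.indep_var_compose[OF independent[unfolded independent_processes_def]
        measurable_compose[OF ev, of "\<lambda>z. exp (- \<mu> * z)" borel]
        measurable_compose[OF ev, of "\<lambda>z. exp (- (\<mu> * ?c) * z)" borel]]) measurable
  moreover have "(\<lambda>f. exp (- \<mu> * f x)) \<circ> (\<lambda>y. \<lambda>t\<in>{0..}. H1 t y) = ?X"
    "(\<lambda>f. exp (- (\<mu> * ?c) * f x)) \<circ> (\<lambda>y. \<lambda>t\<in>{0..}. H2 t y) = ?Y"
    using x by (auto simp: fun_eq_iff)
  ultimately have indep: "H1.indep_var borel ?X borel ?Y" by (simp only:)
  have "integrable M ?X"
    using H1.measurable[of x] x \<mu> H1.nonneg[of _ x]
    by (intro H1.integrable_const_bound[of _ 1] AE_I2) (auto simp: mult_nonneg_nonneg)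
  moreover have "integrable M ?Y"
    using H2.measurable[of x] x \<mu> c_pos H2.nonneg[of _ x]
    by (intro H1.integrable_const_bound[of _ 1] AE_I2) (auto simp: mult_nonneg_nonneg)
  ultimately have 1: "H1.expectation (\<lambda>y. ?X y * ?Y y) = H1.expectation ?X * H1.expectation ?Y"
    using H1.indep_var_lebesgue_integral[OF indep] by blast
  have 2: "H1.expectation ?X = exp (- x * \<mu> powr (2 * \<nu>))"
    by (rule H1.laplace[OF x \<mu>])
  have 3: "H1.expectation ?Y = exp (- x * (\<mu> * ?c) powr \<nu>)"
    by (rule H2.laplace[OF x]) (use \<mu> c_pos in simp)
  have 4: "(\<mu> * ?c) powr \<nu> = 2 * lam * \<mu> powr \<nu>"
    using \<mu> lam \<nu> by (simp add: powr_mult powr_powr)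
  have 5: "exp (- x * \<mu> powr (2 * \<nu>)) * exp (- x * (2 * lam * \<mu> powr \<nu>)) = exp (- x * phi \<mu>)"
    by (simp add: phi_def exp_add[symmetric] algebra_simps)
  have 6: "?X y * ?Y y = exp (- \<mu> * H x y)" for y
    by (simp add: H_def exp_add[symmetric] algebra_simps)
  show ?thesis using 1 by (simp only: 2 3 4 5 6)
qed

lemma H_exp_integrable:
  assumes "x \<ge> 0" "\<mu> \<ge> 0"
  shows "integrable M (\<lambda>y. exp (- \<mu> * H x y))"
  using H_nonneg[of _ x] assms
  by (intro H1.integrable_const_bound[of _ 1] AE_I2) (auto simp: mult_nonneg_nonneg)

text \<open>Chernoff's bound with parameter 1 / t, for which the prefactor is the constant exp 1. It
  serves twice: for large x to show that paths reach level t, and for small t to concentrate the law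
  at 0.\<close>

lemma prob_less_le:
  assumes "x > 0" "t > 0"
  shows "H1.prob {y \<in> space M. H x y < t} \<le> exp 1 * exp (- x * phi (1 / t))"
proof -
  have "H1.prob {y \<in> space M. H x y < t} = (\<integral>y. indicator {y \<in> space M. H x y < t} y \<partial>M)"
    using assms by simp
  also have "\<dots> \<le> (\<integral>y. exp 1 * exp (- (1 / t) * H x y) \<partial>M)"
  proof (rule integral_mono)
    show "integrable M (indicator {y \<in> space M. H x y < t} :: 'a \<Rightarrow> real)"
      using assms by (intro integrable_real_indicator) (auto simp: H1.emeasure_eq_measure)
    show "integrable M (\<lambda>y. exp 1 * exp (- (1 / t) * H x y))"
      using assms by (intro integrable_mult_right H_exp_integrable) auto
    fix y assume y: "y \<in> space M"
    have "1 \<le> exp 1 * exp (- (1 / t) * H x y)" if "H x y < t"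
    proof -
      have "0 \<le> 1 - (1 / t) * H x y" using that assms by (simp add: field_simps)
      then have "1 \<le> exp (1 - (1 / t) * H x y)" by simp
      then show ?thesis by (simp add: exp_add[symmetric])
    qed
    then show "indicator {y \<in> space M. H x y < t} y \<le> exp 1 * exp (- (1 / t) * H x y)"
      by (auto simp: indicator_def)
  qed
  also have "\<dots> = exp 1 * exp (- x * phi (1 / t))"
    using H_laplace[of x "1 / t"] assms by simp
  finally show ?thesis .
qed

text \<open>For a fixed path the integral of exp (- \<mu> t) over t > H x is exp (- \<mu> H x) /
  \<mu>; Fubini then reduces the claim to the Laplace transform of H x.\<close>

lemma prob_less_laplace:
  assumes x: "x > 0" and \<mu>: "\<mu> > 0"
  shows "has_bochner_integral lborel
           (\<lambda>t. indicator {0<..} t * (exp (- \<mu> * t) * H1.prob {y \<in> space M. H x y < t})) (exp (- x * phi \<mu>) / \<mu>)"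
proof -
  interpret P: pair_sigma_finite M "lborel :: real measure"
    by (intro pair_sigma_finite.intro H1.sigma_finite_measure_axioms sigma_finite_lborel)
  define E where "E = (\<lambda>y t. exp (- \<mu> * t) * indicator {t. H x y < t} t :: real)"
  have [measurable]: "H x \<in> borel_measurable M" using x by simp
  have Em [measurable]: "case_prod E \<in> borel_measurable (M \<Otimes>\<^sub>M lborel)"
    unfolding E_def indicator_def of_bool_def by measurable
  have E: "has_bochner_integral lborel (E y) (exp (- \<mu> * H x y) / \<mu>)" for y
  proof -
    let ?h = "\<lambda>r. indicator {0<..} r * exp (- \<mu> * r)"
    have "has_bochner_integral lborel (\<lambda>t. ?h (- H x y + 1 * t)) (1 / \<mu> /\<^sub>R \<bar>1\<bar>)"
      using lborel_has_bochner_integral_real_affine_iff[of 1 ?h "1 / \<mu>" "- H x y"] exp_integral[OF \<mu>] by simp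
    then have "has_bochner_integral lborel (\<lambda>t. exp (- \<mu> * H x y) * ?h (- H x y + 1 * t))
        (exp (- \<mu> * H x y) * (1 / \<mu> /\<^sub>R \<bar>1\<bar>))"
      by (rule has_bochner_integral_mult_right)
    moreover have "exp (- \<mu> * H x y) * ?h (- H x y + 1 * t) = E y t" for t
      by (auto simp: E_def indicator_def exp_add[symmetric] algebra_simps)
    ultimately show ?thesis by simp
  qed
  have Epos: "norm (E y t) = E y t" for y t by (simp add: E_def)
  have prod: "integrable (M \<Otimes>\<^sub>M lborel) (case_prod E)"
  proof (rule P.Fubini_integrable[OF Em])
    show "AE y in M. integrable lborel (\<lambda>t. case (y, t) of (y, t) \<Rightarrow> E y t)"
      using E by (auto simp: has_bochner_integral_iff)
    have "(\<integral>t. norm (case (y, t) of (y, t) \<Rightarrow> E y t) \<partial>lborel) = exp (- \<mu> * H x y) / \<mu>" for y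
      unfolding prod.case Epos using E[of y] by (simp only: has_bochner_integral_iff)
    then show "integrable M (\<lambda>y. \<integral>t. norm (case (y, t) of (y, t) \<Rightarrow> E y t) \<partial>lborel)"
      using H_exp_integrable[of x \<mu>] x \<mu> by simp
  qed
  have inner: "(\<integral>y. E y t \<partial>M) = indicator {0<..} t * (exp (- \<mu> * t) * H1.prob {y \<in> space M. H x y < t})" for t
  proof (cases "t > 0")
    case True
    have "(\<integral>y. E y t \<partial>M) = (\<integral>y. exp (- \<mu> * t) * indicator {y \<in> space M. H x y < t} y \<partial>M)"
      by (intro Bochner_Integration.integral_cong) (auto simp: E_def indicator_def)
    also have "\<dots> = exp (- \<mu> * t) * H1.prob {y \<in> space M. H x y < t}"
      by simp
    finally show ?thesis using True by simp
  next
    case False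
    have "(\<integral>y. E y t \<partial>M) = (\<integral>y. 0 \<partial>M)"
    proof (intro Bochner_Integration.integral_cong refl)
      show "E y t = 0" if "y \<in> space M" for y
        using H_nonneg[OF that, of x] x False by (auto simp: E_def indicator_def)
    qed
    with False show ?thesis by simp
  qed
  have "integrable lborel (\<lambda>t. \<integral>y. E y t \<partial>M)"
    using P.integrable_snd[OF prod] .
  moreover have "(\<integral>t. \<integral>y. E y t \<partial>M \<partial>lborel) = (\<integral>y. \<integral>t. E y t \<partial>lborel \<partial>M)"
    using P.Fubini_integral[OF prod] .
  moreover have "(\<integral>t. E y t \<partial>lborel) = exp (- \<mu> * H x y) / \<mu>" for y
    using E[of y] by (simp only: has_bochner_integral_iff)
  moreover have "(\<integral>y. exp (- \<mu> * H x y) / \<mu> \<partial>M) = exp (- x * phi \<mu>) / \<mu>"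
    using H_laplace[OF x \<mu>] by simp
  ultimately show ?thesis
    unfolding inner by (simp only: has_bochner_integral_iff)
qed

text \<open>The probability of the complementary event is monotone in t, so uniqueness of transforms
  gives equality at every t > 0, with no exceptional null set. At x = 0 both sides vanish since the
  path starts at 0 < t.\<close>

lemma prob_ge:
  assumes "x \<ge> 0" "t > 0"
  shows "H1.prob {y \<in> space M. t \<le> H x y} = cdf_fun x t"
proof (cases "x = 0")
  case True
  have "{y \<in> space M. t \<le> H x y} = {}"
    using assms True by (auto simp: H_start)
  then show ?thesis by (simp only: measure_empty) (simp add: True cdf_0)
next
  case False
  with assms have x: "x > 0" by simp
  have "H1.prob {y \<in> space M. H x y < t} = 1 - cdf_fun x t"
  proof (rule laplace_unique_continuous[where N = 1 and t = t])
    show "has_bochner_integral lborel (\<lambda>t. indicator {0<..} t * (exp (- real n * t) * H1.prob {y \<in> space M. H x y < t}))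
        (exp (- x * phi (real n)) / real n)" if "1 \<le> n" for n
      using that x by (intro prob_less_laplace) auto
    show "has_bochner_integral lborel (\<lambda>t. indicator {0<..} t * (exp (- real n * t) * (1 - cdf_fun x t)))
        (exp (- x * phi (real n)) / real n)" if "1 \<le> n" for n
    proof -
      have n: "real n > 0" using that by simp
      have "has_bochner_integral lborel (\<lambda>t. indicator {0<..} t * exp (- real n * t)
          - indicator {0<..} t * (exp (- real n * t) * cdf_fun x t)) (1 / real n - (1 - exp (- x * phi (real n))) / real n)"
        using x n by (intro has_bochner_integral_diff exp_integral cdf_laplace) auto
      moreover have "1 / real n - (1 - exp (- x * phi (real n))) / real n = exp (- x * phi (real n)) / real n"
        by (simp add: diff_divide_distrib)
      moreover have "indicator {0<..} t * exp (- real n * t) - indicator {0<..} t * (exp (- real n * t) * cdf_fun x t)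
          = indicator {0<..} t * (exp (- real n * t) * (1 - cdf_fun x t))" for t
        by (simp add: right_diff_distrib)
      ultimately show ?thesis by (simp only:)
    qed
    show "continuous_on {0<..} (\<lambda>t. 1 - cdf_fun x t)"
      using x by (intro continuous_intros cdf_continuous_time) auto
    have "mono_on {0<..} (\<lambda>t. H1.prob {y \<in> space M. H x y < t})"
      using x by (intro mono_onI H1.finite_measure_mono) auto
    then show "continuous_on {0<..} (\<lambda>t. H1.prob {y \<in> space M. H x y < t})
        \<or> mono_on {0<..} (\<lambda>t. H1.prob {y \<in> space M. H x y < t})" by simp
  qed (rule assms)
  moreover have "H1.prob {y \<in> space M. t \<le> H x y} = 1 - H1.prob {y \<in> space M. H x y < t}"
  proof -
    have "space M - {y \<in> space M. H x y < t} = {y \<in> space M. t \<le> H x y}" by auto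
    then show ?thesis using H1.prob_compl[of "{y \<in> space M. H x y < t}"] x by simp
  qed
  ultimately show ?thesis by simp
qed

lemma cdf_mono:
  assumes "t > 0" "0 \<le> x" "x \<le> y"
  shows "cdf_fun x t \<le> cdf_fun y t"
proof -
  have "H1.prob {z \<in> space M. t \<le> H x z} \<le> H1.prob {z \<in> space M. t \<le> H y z}"
    using assms H_mono[of _ x y] by (intro H1.finite_measure_mono) (auto intro: order_trans)
  with assms show ?thesis by (simp add: prob_ge)
qed

text \<open>Paths increase in time, so the probabilities behind \<open>cdf_fun\<close> increase in
  x, and \<open>dens\<close> is a limit of their nonnegative right difference quotients.\<close>

lemma dens_nonneg:
  assumes t: "t > 0" and x: "x \<ge> 0"
  shows "dens x t \<ge> 0"
proof (rule tendsto_lowerbound)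
  show "((\<lambda>y. (cdf_fun y t - cdf_fun x t) / (y - x)) \<longlongrightarrow> dens x t) (at_right x)"
  proof -
    have "((\<lambda>y. cdf_fun y t) has_real_derivative dens x t) (at x within {x<..})"
      by (rule DERIV_subset[OF cdf_has_derivative[OF t x]]) (use x in auto)
    then show ?thesis by (simp only: has_field_derivative_iff)
  qed
  show "\<forall>\<^sub>F y in at_right x. 0 \<le> (cdf_fun y t - cdf_fun x t) / (y - x)"
    using eventually_at_right_less[of x] by eventually_elim (use cdf_mono[OF t x] in simp)
qed simp

text \<open>Right-continuity makes the infimum attained: if H x < t, the path stays below t on some
  interval to the right of x, which pushes the infimum strictly beyond x. Events of the inverse
  process thus become events at one fixed time.\<close>

lemma inverse_le_iff:
  assumes y: "y \<in> escaping t" and t: "t > 0"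
  shows "inverse_process H t y \<le> x \<longleftrightarrow> 0 \<le> x \<and> t \<le> H x y"
proof -
  define S where "S = {s. s > 0 \<and> H s y \<ge> t}"
  have sp: "y \<in> space M" using y by (simp add: escaping_def)
  have L: "inverse_process H t y = Inf S" by (simp add: inverse_process_def S_def)
  \<comment> \<open>The infimum runs over strictly positive times; time 0 is excluded automatically,
    as the path starts at 0 < t.\<close>
  have pos: "s > 0" if "0 \<le> s" "t \<le> H s y" for s
    using that H_start[OF sp] t by (cases "s = 0") auto
  obtain n :: nat where n: "t \<le> H (real n) y" using y by (auto simp: escaping_def)
  have "real n \<in> S" using n pos[of "real n"] by (simp add: S_def)
  then have ne: "S \<noteq> {}" by blast
  have bdd: "bdd_below S" by (rule bdd_belowI[of _ 0]) (simp add: S_def)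
  have L0: "0 \<le> Inf S" using ne by (intro cInf_greatest) (auto simp: S_def)
  show ?thesis
  proof
    assume "0 \<le> x \<and> t \<le> H x y"
    then have "x \<in> S" using pos by (auto simp: S_def)
    then show "inverse_process H t y \<le> x" unfolding L by (rule cInf_lower[OF _ bdd])
  next
    assume le: "inverse_process H t y \<le> x"
    then have x0: "0 \<le> x" using L0 L by simp
    have "t \<le> H x y"
    proof (rule ccontr)
      assume "\<not> t \<le> H x y"
      then have less: "H x y < t" by simp
      have "((\<lambda>s. H s y) \<longlongrightarrow> H x y) (at_right x)"
        using H_right_continuous[OF sp x0] by (simp add: continuous_within)
      then have "\<forall>\<^sub>F s in at_right x. H s y < t" using less by (rule order_tendstoD(2))
      then obtain b where b: "b > x" "\<And>s. x < s \<Longrightarrow> s < b \<Longrightarrow> H s y < t"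
        by (auto simp: eventually_at_right_field)
      have "b \<le> Inf S"
      proof (rule cInf_greatest[OF ne])
        fix s assume s: "s \<in> S"
        show "b \<le> s"
        proof (rule ccontr)
          assume "\<not> b \<le> s"
          then have "H s y < t"
            using b(2)[of s] H_mono[OF sp, of s x] less s by (cases "s \<le> x") (auto simp: S_def)
          then show False using s by (simp add: S_def)
        qed
      qed
      with le b(1) L show False by simp
    qed
    with x0 show "0 \<le> x \<and> t \<le> H x y" by simp
  qed
qed

lemma escaping_sets [measurable]: "escaping t \<in> sets M"
proof -
  have "{x \<in> space M. t \<le> H (real n) x} \<in> sets M" for n :: nat by simp
  then have "(\<Union>n::nat. {x \<in> space M. t \<le> H (real n) x}) \<in> sets M" by blast
  also have "(\<Union>n::nat. {x \<in> space M. t \<le> H (real n) x}) = escaping t"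
    by (auto simp: escaping_def)
  finally show ?thesis .
qed

text \<open>A path that never reaches t lies below t at each of the times n + 1, an event whose
  Chernoff bound tends to 0.\<close>

lemma AE_escaping:
  assumes t: "t > 0"
  shows "AE y in M. y \<in> escaping t"
proof -
  have le: "H1.prob (space M - escaping t) \<le> exp 1 * exp (- (real (Suc n) * phi (1 / t)))" for n
  proof -
    have "H1.prob (space M - escaping t) \<le> H1.prob {y \<in> space M. H (real (Suc n)) y < t}"
      by (intro H1.finite_measure_mono) (auto simp: escaping_def not_le simp del: of_nat_Suc)
    also have "\<dots> \<le> exp 1 * exp (- real (Suc n) * phi (1 / t))"
      using t by (intro prob_less_le) auto
    finally show ?thesis by (simp only: minus_mult_left)
  qed
  have "filterlim (\<lambda>n. - (phi (1 / t) * real n)) at_bot sequentially"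
    using t phi_pos[of "1 / t"] by (intro filterlim_compose[OF filterlim_uminus_at_bot_at_top]
        filterlim_tendsto_pos_mult_at_top[OF tendsto_const] filterlim_real_sequentially) auto
  then have "(\<lambda>n. exp (- (phi (1 / t) * real n))) \<longlonglongrightarrow> 0"
    by (rule filterlim_compose[OF exp_at_bot])
  then have "(\<lambda>n. exp 1 * exp (- (phi (1 / t) * real (Suc n)))) \<longlonglongrightarrow> exp 1 * 0"
    by (intro tendsto_intros LIMSEQ_Suc)
  then have "(\<lambda>n. exp 1 * exp (- (real (Suc n) * phi (1 / t)))) \<longlonglongrightarrow> 0"
    by (simp only: mult.commute[of "phi (1 / t)"] mult_zero_right)
  then have "H1.prob (space M - escaping t) \<le> 0"
    by (rule LIMSEQ_le_const) (use le in blast)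
  then have "H1.prob (space M - escaping t) = 0"
    using measure_nonneg[of M "space M - escaping t"] by linarith
  then have "H1.prob (escaping t) = 1"
    using H1.prob_compl[OF escaping_sets, of t] by simp
  then show ?thesis using H1.prob_eq_1[OF escaping_sets] by simp
qed

text \<open>Measurability must hold on the whole space, including paths that never reach t. There
  the process is the constant \<open>Inf {}\<close>, so a sublevel set contains either all or none
  of them.\<close>

lemma inverse_measurable:
  assumes t: "t > 0"
  shows "inverse_process H t \<in> borel_measurable M"
proof (rule borel_measurableI_le)
  fix a :: real
  have out: "inverse_process H t y = Inf {}" if "y \<in> space M" "y \<notin> escaping t" for y
  proof -
    have "H s y < t" if "s > 0" for s
    proof -
      obtain n :: nat where "s \<le> real n" using real_arch_simple by blast
      then have "H s y \<le> H (real n) y" using \<open>s > 0\<close> H_mono[OF \<open>y \<in> space M\<close>] by simp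
      also have "\<dots> < t" using \<open>y \<in> space M\<close> \<open>y \<notin> escaping t\<close> by (auto simp: escaping_def not_le)
      finally show ?thesis .
    qed
    then have "{s. s > 0 \<and> t \<le> H s y} = {}" by fastforce
    then show ?thesis by (simp only: inverse_process_def)
  qed
  have "{y \<in> space M. inverse_process H t y \<le> a} =
      (if 0 \<le> a then escaping t \<inter> {y \<in> space M. t \<le> H a y} else {}) \<union>
      (if Inf {} \<le> a then space M - escaping t else {})"
  proof (rule set_eqI)
    fix y
    have "y \<in> space M" if "y \<in> escaping t" using that by (simp add: escaping_def)
    then show "y \<in> {y \<in> space M. inverse_process H t y \<le> a} \<longleftrightarrow>
        y \<in> (if 0 \<le> a then escaping t \<inter> {y \<in> space M. t \<le> H a y} else {}) \<union>
          (if Inf {} \<le> a then space M - escaping t else {})"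
      using out[of y] inverse_le_iff[OF _ t, of y a]
      by (cases "y \<in> space M"; cases "y \<in> escaping t") auto
  qed
  also have "\<dots> \<in> sets M" by auto
  finally show "{y \<in> space M. inverse_process H t y \<le> a} \<in> sets M" .
qed

lemma prob_inverse_le:
  assumes t: "t > 0"
  shows "H1.prob {y \<in> space M. inverse_process H t y \<le> x} = (if 0 \<le> x then cdf_fun x t else 0)"
proof -
  note [measurable] = inverse_measurable[OF t]
  have "H1.prob {y \<in> space M. inverse_process H t y \<le> x} = H1.prob {y \<in> space M. 0 \<le> x \<and> t \<le> H x y}"
  proof (rule H1.finite_measure_eq_AE)
    show "AE y in M. (y \<in> {y \<in> space M. inverse_process H t y \<le> x}) = (y \<in> {y \<in> space M. 0 \<le> x \<and> t \<le> H x y})"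
      using AE_escaping[OF t] by eventually_elim (auto simp: inverse_le_iff[OF _ t])
    show "{y \<in> space M. 0 \<le> x \<and> t \<le> H x y} \<in> sets M" by (cases "0 \<le> x") auto
  qed measurable
  also have "\<dots> = (if 0 \<le> x then cdf_fun x t else 0)"
    using prob_ge[OF _ t, of x] by auto
  finally show ?thesis .
qed

text \<open>The distribution function vanishes at x = 0 and has derivative \<open>dens\<close> on
  the closed half-line, so the fundamental theorem recovers it with no atom at 0.\<close>

lemma inverse_distributed:
  assumes t: "t > 0"
  shows "distributed M lborel (inverse_process H t) (\<lambda>x. ennreal (dens x t * indicator {0..} x))"
proof (rule distributedI_borel_atMost[where g = "\<lambda>a. if 0 \<le> a then cdf_fun a t else 0"])
  show "inverse_process H t \<in> borel_measurable M" by (rule inverse_measurable[OF t])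
  show "(\<lambda>x. dens x t * indicator {0..} x) \<in> borel_measurable borel"
    using borel_measurable_continuous_on_indicator[OF _ dens_continuous_on[OF t]] by (simp add: mult.commute)
  show "AE x in lborel. 0 \<le> dens x t * indicator {0..} x"
    using dens_nonneg[OF t] by (intro AE_I2) (auto simp: indicator_def)
  show "emeasure M {x \<in> space M. inverse_process H t x \<le> a} = ennreal (if 0 \<le> a then cdf_fun a t else 0)" for a
    unfolding prob_inverse_le[OF t, symmetric] by (rule H1.emeasure_eq_measure)
  fix a :: real
  have eq: "ennreal (dens x t * indicator {0..} x * indicator {..a} x) = ennreal (indicator {0..a} x *\<^sub>R dens x t)" for x
    by (auto simp: indicator_def)
  show "(\<integral>\<^sup>+x. ennreal (dens x t * indicator {0..} x * indicator {..a} x) \<partial>lborel) = ennreal (if 0 \<le> a then cdf_fun a t else 0)"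
  proof (cases "0 \<le> a")
    case True
    have "has_bochner_integral lborel (\<lambda>x. indicator {0..a} x *\<^sub>R dens x t) (cdf_fun a t - cdf_fun 0 t)"
    proof (rule has_bochner_integral_FTC_Icc[OF True])
      show "((\<lambda>x. cdf_fun x t) has_vector_derivative dens x t) (at x within {0..a})" if "0 \<le> x" "x \<le> a" for x
        using DERIV_subset[OF cdf_has_derivative[OF t that(1)], of "{0..a}"]
        by (simp add: has_real_derivative_iff_has_vector_derivative subset_iff)
      show "continuous_on {0..a} (\<lambda>x. dens x t)"
        by (rule continuous_on_subset[OF dens_continuous_on[OF t]]) auto
    qed
    then have "(\<integral>\<^sup>+x. ennreal (indicator {0..a} x *\<^sub>R dens x t) \<partial>lborel) = ennreal (cdf_fun a t)"
      using dens_nonneg[OF t]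
      by (subst nn_integral_eq_integral) (auto simp: has_bochner_integral_iff cdf_0 indicator_def intro!: AE_I2)
    with True show ?thesis unfolding eq by simp
  next
    case False
    then have "{0..a} = {}" by simp
    with False show ?thesis unfolding eq by simp
  qed
qed

lemma inverse_has_law: "has_law M (inverse_process H) (\<lambda>x t. dens x t)"
  unfolding has_law_def using dens_nonneg dens_continuous_on inverse_distributed by blast

lemma has_law_eq_dens:
  assumes l: "has_law M (inverse_process H) l" and t: "t > 0" and x: "x \<ge> 0"
  shows "l x t = dens x t"
proof (rule continuous_AE_eq_atLeast_0[OF _ dens_continuous_on[OF t] _ x])
  show "continuous_on {0..} (\<lambda>x. l x t)" using l t by (simp add: has_law_def)
  have "distributed M lborel (inverse_process H t) (\<lambda>x. ennreal (l x t * indicator {0..} x))"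
    using l t by (simp add: has_law_def)
  from H1.distributed_unique[OF this inverse_distributed[OF t]]
  have "AE x in lborel. ennreal (l x t * indicator {0..} x) = ennreal (dens x t * indicator {0..} x)" .
  then show "AE x in lborel. 0 \<le> x \<longrightarrow> l x t = dens x t"
  proof eventually_elim
    fix x assume eq: "ennreal (l x t * indicator {0..} x) = ennreal (dens x t * indicator {0..} x)"
    show "0 \<le> x \<longrightarrow> l x t = dens x t"
    proof
      assume "0 \<le> x"
      moreover have "l x t \<ge> 0" using l t \<open>0 \<le> x\<close> by (simp add: has_law_def)
      ultimately show "l x t = dens x t" using eq dens_nonneg[OF t, of x] by simp
    qed
  qed
qed

text \<open>The integral is the expectation of a test function at L(t). On L(t) \<le> \<delta> the
  test function is within \<epsilon> of its value at 0; otherwise H(\<delta>) < t, an event whose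
  probability vanishes as t tends to 0.\<close>

lemma dens_initially_delta: "initially_delta (\<lambda>x t. dens x t)"
  unfolding initially_delta_def
proof (intro allI impI)
  fix \<phi> :: "real \<Rightarrow> real"
  assume cont: "continuous_on {0..} \<phi>" and bdd: "bounded (\<phi> ` {0..})"
  obtain B where B: "\<And>x. x \<ge> 0 \<Longrightarrow> \<bar>\<phi> x\<bar> \<le> B"
    using bdd by (auto simp: bounded_iff)
  have B0: "B \<ge> 0" using B[of 0] by simp
  define g where "g = (\<lambda>x. indicator {0..} x * \<phi> x)"
  have [measurable]: "g \<in> borel_measurable borel"
    using borel_measurable_continuous_on_indicator[OF _ cont] by (simp add: g_def)
  have gB: "\<bar>g x\<bar> \<le> B" for x using B[of x] B0 by (auto simp: g_def indicator_def)
  have main: "\<bar>(LBINT x:{0..}. \<phi> x * dens x t) - \<phi> 0\<bar> \<le> \<epsilon> + 2 * B * (exp 1 * exp (- \<delta> * phi (1 / t)))"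
    if t: "t > 0" and \<delta>: "\<delta> > 0" and \<epsilon>: "\<epsilon> > 0" "\<And>x. 0 \<le> x \<Longrightarrow> x \<le> \<delta> \<Longrightarrow> \<bar>\<phi> x - \<phi> 0\<bar> \<le> \<epsilon>" for t \<delta> \<epsilon>
  proof -
    let ?L = "inverse_process H t"
    note [measurable] = inverse_measurable[OF t]
    have "(LBINT x:{0..}. \<phi> x * dens x t) = (\<integral>x. (dens x t * indicator {0..} x) * g x \<partial>lborel)"
      unfolding set_lebesgue_integral_def
      by (intro Bochner_Integration.integral_cong) (auto simp: g_def indicator_def)
    also have "\<dots> = (\<integral>y. g (?L y) \<partial>M)"
      using dens_nonneg[OF t] by (intro distributed_integral[OF inverse_distributed[OF t]]) (auto simp: indicator_def)
    finally have I: "(LBINT x:{0..}. \<phi> x * dens x t) = (\<integral>y. g (?L y) \<partial>M)" .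
    have gi: "integrable M (\<lambda>y. g (?L y))"
      by (rule H1.integrable_const_bound[of _ B]) (use gB in auto)
    have Bad: "{y \<in> space M. H \<delta> y < t} \<in> sets M" using \<delta> by simp
    have "\<bar>(\<integral>y. g (?L y) \<partial>M) - \<phi> 0\<bar> = \<bar>\<integral>y. g (?L y) - \<phi> 0 \<partial>M\<bar>"
      using gi by (simp add: H1.prob_space)
    also have "\<dots> \<le> (\<integral>y. \<bar>g (?L y) - \<phi> 0\<bar> \<partial>M)" by (rule integral_abs_bound)
    also have "\<dots> \<le> (\<integral>y. \<epsilon> + 2 * B * indicator {y \<in> space M. H \<delta> y < t} y \<partial>M)"
    proof (rule integral_mono_AE)
      show "integrable M (\<lambda>y. \<bar>g (?L y) - \<phi> 0\<bar>)" using gi by simp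
      show "integrable M (\<lambda>y. \<epsilon> + 2 * B * indicator {y \<in> space M. H \<delta> y < t} y)"
        using Bad by (intro Bochner_Integration.integrable_add integrable_mult_right integrable_real_indicator)
          (auto simp: H1.emeasure_eq_measure)
      show "AE y in M. \<bar>g (?L y) - \<phi> 0\<bar> \<le> \<epsilon> + 2 * B * indicator {y \<in> space M. H \<delta> y < t} y"
        using AE_escaping[OF t]
      proof eventually_elim
        fix y assume y: "y \<in> escaping t"
        then have sp: "y \<in> space M" by (simp add: escaping_def)
        have L0: "0 \<le> ?L y" using inverse_le_iff[OF y t, of "?L y"] by simp
        show "\<bar>g (?L y) - \<phi> 0\<bar> \<le> \<epsilon> + 2 * B * indicator {y \<in> space M. H \<delta> y < t} y"
        proof (cases "?L y \<le> \<delta>")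
          case True
          then have "\<bar>g (?L y) - \<phi> 0\<bar> \<le> \<epsilon>" using \<epsilon>(2)[of "?L y"] L0 by (simp add: g_def)
          moreover have "0 \<le> 2 * B * indicator {y \<in> space M. H \<delta> y < t} y" using B0 by simp
          ultimately show ?thesis by linarith
        next
          case False
          then have "H \<delta> y < t" using inverse_le_iff[OF y t, of \<delta>] \<delta> by simp
          moreover have "\<bar>g (?L y) - \<phi> 0\<bar> \<le> 2 * B"
            using gB[of "?L y"] B[of 0] by (auto simp: abs_le_iff)
          ultimately show ?thesis using sp \<epsilon>(1) by simp
        qed
      qed
    qed
    also have "\<dots> = \<epsilon> + 2 * B * H1.prob {y \<in> space M. H \<delta> y < t}"
      using Bad by (subst Bochner_Integration.integral_add)
        (auto simp: H1.prob_space H1.emeasure_eq_measure intro!: integrable_mult_right integrable_real_indicator)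
    also have "\<dots> \<le> \<epsilon> + 2 * B * (exp 1 * exp (- \<delta> * phi (1 / t)))"
      using prob_less_le[OF \<delta> t] B0 by (intro add_left_mono mult_left_mono) auto
    finally show ?thesis unfolding I .
  qed
  show "((\<lambda>t. LBINT x:{0..}. \<phi> x * dens x t) \<longlongrightarrow> \<phi> 0) (at_right 0)"
  proof (rule tendstoI)
    fix e :: real assume e: "e > 0"
    have "(\<phi> \<longlongrightarrow> \<phi> 0) (at 0 within {0..})"
      using cont by (simp add: continuous_on_def)
    then have "\<forall>\<^sub>F x in at 0 within {0..}. dist (\<phi> x) (\<phi> 0) < e / 2"
      by (rule tendstoD) (use e in simp)
    then obtain d where d: "d > 0" "\<And>x. x \<in> {0..} \<Longrightarrow> x \<noteq> 0 \<Longrightarrow> dist x 0 < d \<Longrightarrow> dist (\<phi> x) (\<phi> 0) < e / 2"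
      unfolding eventually_at by blast
    define \<delta> where "\<delta> = d / 2"
    have \<delta>: "\<delta> > 0" using d by (simp add: \<delta>_def)
    have near: "\<bar>\<phi> x - \<phi> 0\<bar> \<le> e / 2" if "0 \<le> x" "x \<le> \<delta>" for x
      using d(2)[of x] that e d(1) by (cases "x = 0") (auto simp: dist_real_def \<delta>_def)
    \<comment> \<open>The lower-order term 2 lam (1 / t) powr \<nu> of \<open>phi (1 / t)\<close>
      alone already tends to infinity.\<close>
    have "((\<lambda>t. exp 1 * exp (- \<delta> * phi (1 / t))) \<longlongrightarrow> 0) (at_right 0)"
    proof -
      have "filterlim (\<lambda>t::real. 1 / t) at_top (at_right 0)"
        using filterlim_inverse_at_top_right by (simp add: inverse_eq_divide)
      moreover have "filterlim (\<lambda>x::real. x powr \<nu>) at_top at_top"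
      proof (rule filterlim_at_top_mono)
        show "filterlim (\<lambda>x::real. exp (\<nu> * ln x)) at_top at_top"
          by (intro filterlim_compose[OF exp_at_top]
              filterlim_tendsto_pos_mult_at_top[OF tendsto_const \<nu>] ln_at_top)
        show "\<forall>\<^sub>F x::real in at_top. exp (\<nu> * ln x) \<le> x powr \<nu>"
          using eventually_gt_at_top[of 0] by eventually_elim (simp add: powr_def)
      qed
      ultimately have "filterlim (\<lambda>t::real. (1 / t) powr \<nu>) at_top (at_right 0)"
        by (rule filterlim_compose[rotated])
      then have 1: "filterlim (\<lambda>t::real. \<delta> * (2 * lam) * (1 / t) powr \<nu>) at_top (at_right 0)"
        using \<delta> lam by (intro filterlim_tendsto_pos_mult_at_top[OF tendsto_const]) auto
      have "filterlim (\<lambda>t. \<delta> * phi (1 / t)) at_top (at_right 0)"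
      proof (rule filterlim_at_top_mono[OF 1], rule always_eventually, intro allI)
        fix t :: real
        have "\<delta> * (2 * lam * (1 / t) powr \<nu>) \<le> \<delta> * phi (1 / t)"
          using \<delta> by (intro mult_left_mono) (auto simp: phi_def)
        then show "\<delta> * (2 * lam) * (1 / t) powr \<nu> \<le> \<delta> * phi (1 / t)" by (simp only: mult.assoc)
      qed
      then have "filterlim (\<lambda>t. - (\<delta> * phi (1 / t))) at_bot (at_right 0)"
        by (rule filterlim_compose[OF filterlim_uminus_at_bot_at_top])
      then have "((\<lambda>t. exp (- (\<delta> * phi (1 / t)))) \<longlongrightarrow> 0) (at_right 0)"
        by (rule filterlim_compose[OF exp_at_bot])
      then have "((\<lambda>t. exp 1 * exp (- (\<delta> * phi (1 / t)))) \<longlongrightarrow> exp 1 * 0) (at_right 0)"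
        by (intro tendsto_intros)
      then show ?thesis by simp
    qed
    then have "((\<lambda>t. 2 * B * (exp 1 * exp (- \<delta> * phi (1 / t)))) \<longlongrightarrow> 2 * B * 0) (at_right 0)"
      by (intro tendsto_intros)
    then have "\<forall>\<^sub>F t in at_right 0. 2 * B * (exp 1 * exp (- \<delta> * phi (1 / t))) < e / 2"
      using e by (intro order_tendstoD(2)) auto
    moreover have "\<forall>\<^sub>F t::real in at_right 0. 0 < t" by (rule eventually_at_right_less)
    ultimately show "\<forall>\<^sub>F t in at_right 0. dist (LBINT x:{0..}. \<phi> x * dens x t) (\<phi> 0) < e"
    proof eventually_elim
      fix t :: real assume lt: "2 * B * (exp 1 * exp (- \<delta> * phi (1 / t))) < e / 2" and t: "0 < t"
      have "\<bar>(LBINT x:{0..}. \<phi> x * dens x t) - \<phi> 0\<bar> \<le> e / 2 + 2 * B * (exp 1 * exp (- \<delta> * phi (1 / t)))"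
        using e near by (intro main[OF t \<delta>]) auto
      with lt show "dist (LBINT x:{0..}. \<phi> x * dens x t) (\<phi> 0) < e" by (simp only: dist_real_def)
    qed
  qed
qed

end

section \<open>Transfer to an arbitrary continuous version of the law\<close>

lemma rl_integral_cong:
  assumes "\<And>s. s > 0 \<Longrightarrow> f s = g s"
  shows "rl_integral \<alpha> f = rl_integral \<alpha> g"
  unfolding rl_integral_def rl_kernel_def
  by (intro ext set_lebesgue_integral_cong) (auto simp: assms)

text \<open>Agreement at positive times is all that \<open>has_law\<close> can provide, since it
  says nothing about l x t for t \<le> 0; the integrals run over (0,t), so this is enough.\<close>

lemma rl_deriv_cong:
  "(\<And>s. s > 0 \<Longrightarrow> f s = g s) \<Longrightarrow> rl_deriv \<alpha> f = rl_deriv \<alpha> g"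
  by (simp add: rl_deriv_def[abs_def] rl_integral_cong[of f g])

lemma rl_differentiable_cong:
  assumes "\<And>s. s > 0 \<Longrightarrow> f s = g s"
  shows "rl_differentiable \<alpha> f = rl_differentiable \<alpha> g"
proof -
  have "set_integrable lborel {0<..<u} (rl_kernel \<alpha> f u) = set_integrable lborel {0<..<u} (rl_kernel \<alpha> g u)" for u
    by (rule set_integrable_cong) (auto simp: rl_kernel_def assms)
  then show ?thesis
    by (simp add: rl_differentiable_def[abs_def] rl_integral_cong[of f g, OF assms])
qed

theorem theorem2p2:
  fixes M :: "'a measure" and H1 H2 :: "real \<Rightarrow> 'a \<Rightarrow> real" and \<nu> lam :: real
  assumes "0 < \<nu>" and "\<nu> < 1 / 2" and "lam > 0"
    and "stable_subordinator M (2 * \<nu>) H1"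
    and "stable_subordinator M \<nu> H2"
    and "independent_processes M H1 H2"
  defines "H \<equiv> (\<lambda>t \<omega>. H1 t \<omega> + (2 * lam) powr (1 / \<nu>) * H2 t \<omega>)"
  defines "L \<equiv> inverse_process H"
  shows "(\<exists>l. has_law M L l) \<and>
    (\<forall>l. has_law M L l \<longrightarrow>
      (\<forall>x>0. \<forall>t>0.
         rl_differentiable (2 * \<nu>) (\<lambda>t. l x t) t \<and>
         rl_differentiable \<nu> (\<lambda>t. l x t) t \<and>
         (\<lambda>x. l x t) differentiable (at x) \<and>
         rl_deriv (2 * \<nu>) (\<lambda>t. l x t) t + 2 * lam * rl_deriv \<nu> (\<lambda>t. l x t) t
           = - deriv (\<lambda>x. l x t) x) \<and>
      initially_delta l \<and>
      (\<forall>t>0. l 0 t = t powr (- 2 * \<nu>) / Gamma (1 - 2 * \<nu>)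
                   + 2 * lam * (t powr (- \<nu>) / Gamma (1 - \<nu>))) \<and>
      (\<forall>t>0. \<forall>\<gamma>. 0 < \<gamma> \<and> \<gamma> < lam\<^sup>2 \<longrightarrow>
         (let r1 = - lam + sqrt (lam\<^sup>2 - \<gamma>);
              r2 = - lam - sqrt (lam\<^sup>2 - \<gamma>)
          in (LBINT x:{0..}. exp (- \<gamma> * x) * l x t) =
             1 / 2 * ((1 + lam / sqrt (lam\<^sup>2 - \<gamma>)) * mittag_leffler \<nu> 1 (r1 * t powr \<nu>)
                    + (1 - lam / sqrt (lam\<^sup>2 - \<gamma>)) * mittag_leffler \<nu> 1 (r2 * t powr \<nu>)))))"
proof -
  \<comment> \<open>The last condition reads \<omega> \<le> pi / (4 \<nu>), and \<nu> < 1/2 makes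
    this bound larger than pi/2; two intermediate values below the minimum with pi are then
    chosen.\<close>
  obtain \<theta> \<omega> where angles: "pi / 2 < \<theta>" "\<theta> < \<omega>" "\<omega> < pi" "2 * \<nu> * \<omega> \<le> pi / 2"
  proof -
    define m where "m = min pi (pi / (4 * \<nu>))"
    have "pi / 2 < pi / (4 * \<nu>)"
      by (rule divide_strict_left_mono) (use assms(1,2) pi_gt_zero in auto)
    then have m: "pi / 2 < m" using pi_gt_zero by (simp add: m_def)
    obtain w where w: "pi / 2 < w" "w < m" using dense[OF m] by blast
    obtain \<theta> where \<theta>: "pi / 2 < \<theta>" "\<theta> < w" using dense[OF w(1)] by blast
    have "2 * \<nu> * w \<le> 2 * \<nu> * (pi / (4 * \<nu>))"
      using w(2) assms(1) by (intro mult_left_mono) (auto simp: m_def)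
    also have "\<dots> = pi / 2" using assms(1) by simp
    finally show ?thesis using that[of \<theta> w] \<theta> w by (simp add: m_def)
  qed
  interpret S: stable_sum \<theta> \<omega> \<nu> lam M H1 H2
    by (intro stable_sum.intro telegraph_strip.intro hankel_strip.intro telegraph_strip_axioms.intro
        stable_sum_axioms.intro assms angles)
  have H: "H = S.H"
    by (simp add: H_def S.H_def fun_eq_iff)
  have L: "L = inverse_process S.H"
    by (simp only: L_def H)
  have law: "has_law M L (\<lambda>x t. S.dens x t)"
    unfolding L by (rule S.inverse_has_law)
  moreover have "(\<forall>x>0. \<forall>t>0.
         rl_differentiable (2 * \<nu>) (\<lambda>t. l x t) t \<and>
         rl_differentiable \<nu> (\<lambda>t. l x t) t \<and>
         (\<lambda>x. l x t) differentiable (at x) \<and>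
         rl_deriv (2 * \<nu>) (\<lambda>t. l x t) t + 2 * lam * rl_deriv \<nu> (\<lambda>t. l x t) t
           = - deriv (\<lambda>x. l x t) x) \<and>
      initially_delta l \<and>
      (\<forall>t>0. l 0 t = t powr (- 2 * \<nu>) / Gamma (1 - 2 * \<nu>)
                   + 2 * lam * (t powr (- \<nu>) / Gamma (1 - \<nu>))) \<and>
      (\<forall>t>0. \<forall>\<gamma>. 0 < \<gamma> \<and> \<gamma> < lam\<^sup>2 \<longrightarrow>
         (let r1 = - lam + sqrt (lam\<^sup>2 - \<gamma>);
              r2 = - lam - sqrt (lam\<^sup>2 - \<gamma>)
          in (LBINT x:{0..}. exp (- \<gamma> * x) * l x t) =
             1 / 2 * ((1 + lam / sqrt (lam\<^sup>2 - \<gamma>)) * mittag_leffler \<nu> 1 (r1 * t powr \<nu>)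
                    + (1 - lam / sqrt (lam\<^sup>2 - \<gamma>)) * mittag_leffler \<nu> 1 (r2 * t powr \<nu>))))"
    if l: "has_law M L l" for l
  proof (intro conjI allI impI)
    \<comment> \<open>Pointwise equality up to and including x = 0, so the boundary value and the
      derivatives transfer as well as the integrals.\<close>
    have eq: "l x t = S.dens x t" if "x \<ge> 0" "t > 0" for x t
      using l that unfolding L by (intro S.has_law_eq_dens)
    have orders: "0 < 2 * \<nu>" "2 * \<nu> < 1" "0 < \<nu>" "\<nu> < 1" using assms(1,2) by auto
    {
      fix x t :: real assume x: "0 < x" and t: "0 < t"
      have time: "l x s = S.dens x s" if "s > 0" for s using eq that x by simp
      show "rl_differentiable (2 * \<nu>) (\<lambda>t. l x t) t" "rl_differentiable \<nu> (\<lambda>t. l x t) t"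
        using S.dens_rl(1)[OF x orders(1,2) t] S.dens_rl(1)[OF x orders(3,4) t]
        by (simp_all add: rl_differentiable_cong[of "l x" "S.dens x", OF time])
      have der: "((\<lambda>x. l x t) has_real_derivative - (S.fractional (2 * \<nu>) x t + 2 * lam * S.fractional \<nu> x t)) (at x)"
        by (rule has_field_derivative_transform_within_open[OF S.fractional_equation[OF x t], of "{0<..}"])
           (use eq t x in auto)
      then show "(\<lambda>x. l x t) differentiable (at x)"
        by (auto simp: real_differentiable_def)
      show "rl_deriv (2 * \<nu>) (\<lambda>t. l x t) t + 2 * lam * rl_deriv \<nu> (\<lambda>t. l x t) t = - deriv (\<lambda>x. l x t) x"
        using S.dens_rl(2)[OF x orders(1,2) t] S.dens_rl(2)[OF x orders(3,4) t] DERIV_imp_deriv[OF der]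
        by (simp add: rl_deriv_cong[of "l x" "S.dens x", OF time])
    next
      show "initially_delta l"
        unfolding initially_delta_def
      proof (intro allI impI)
        fix \<phi> :: "real \<Rightarrow> real"
        assume \<phi>: "continuous_on {0..} \<phi>" "bounded (\<phi> ` {0..})"
        have "((\<lambda>t. LBINT x:{0..}. \<phi> x * S.dens x t) \<longlongrightarrow> \<phi> 0) (at_right 0)"
          using S.dens_initially_delta \<phi> unfolding initially_delta_def by blast
        moreover have "\<forall>\<^sub>F t in at_right 0. (LBINT x:{0..}. \<phi> x * S.dens x t) = (LBINT x:{0..}. \<phi> x * l x t)"
          using eventually_at_right_less[of "0::real"]
        proof eventually_elim
          fix t :: real assume "0 < t"
          then show "(LBINT x:{0..}. \<phi> x * S.dens x t) = (LBINT x:{0..}. \<phi> x * l x t)"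
            by (intro set_lebesgue_integral_cong) (auto simp: eq)
        qed
        ultimately show "((\<lambda>t. LBINT x:{0..}. \<phi> x * l x t) \<longlongrightarrow> \<phi> 0) (at_right 0)"
          by (rule Lim_transform_eventually)
      qed
    next
      fix t :: real assume t: "0 < t"
      show "l 0 t = t powr (- 2 * \<nu>) / Gamma (1 - 2 * \<nu>) + 2 * lam * (t powr (- \<nu>) / Gamma (1 - \<nu>))"
        unfolding eq[OF order_refl t] by (rule S.dens_boundary[OF t])
    next
      fix t \<gamma> :: real assume t: "0 < t" and \<gamma>: "0 < \<gamma> \<and> \<gamma> < lam\<^sup>2"
      have "(LBINT x:{0..}. exp (- \<gamma> * x) * l x t) = (LBINT x:{0..}. exp (- \<gamma> * x) * S.dens x t)"
        by (intro set_lebesgue_integral_cong) (use t in \<open>auto simp: eq\<close>)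
      also have "\<dots> = S.hankel (\<lambda>w. S.Phi w / (of_real \<gamma> + S.Phi w)) t"
        using \<gamma> by (intro S.dens_space_laplace[OF t] S.dens_nonneg[OF t]) auto
      finally show "let r1 = - lam + sqrt (lam\<^sup>2 - \<gamma>); r2 = - lam - sqrt (lam\<^sup>2 - \<gamma>)
          in (LBINT x:{0..}. exp (- \<gamma> * x) * l x t) =
             1 / 2 * ((1 + lam / sqrt (lam\<^sup>2 - \<gamma>)) * mittag_leffler \<nu> 1 (r1 * t powr \<nu>)
                    + (1 - lam / sqrt (lam\<^sup>2 - \<gamma>)) * mittag_leffler \<nu> 1 (r2 * t powr \<nu>))"
        using S.resolvent_mittag_leffler[of \<gamma> t] \<gamma> t by (simp only: Let_def)
    }
  qed
  ultimately show ?thesis by blast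
qed

end
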